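(* Let $\gamma,k\in\mathbb{R}$ and let $g\in C^1(\mathbb{R})$ be a nonlinear function with $g(0)=0$ and $g'(0)=k$. Consider the equation $$D^\alpha x(t)=-\gamma x(t)+g\bigl(x(t-\tau_1)\bigr)-e^{-\gamma\tau_2}\,g\bigl(x(t-\tau_1-\tau_2)\bigr),\qquad 0<\alpha\le1.$$ Its equilibrium $x_*=0$ has the following stability behavior. (a) Delay-independent stability. The equilibrium is asymptotically stable for all $\tau_1\ge0$, $\tau_2\ge0$ and for $0<\alpha\le1$ if either (i) $\gamma>2k>0$, or (ii) $\gamma>-2k>0$. (b) Delay-independent instability. (i) If $\gamma<0$ and $k<0$ (i.e. $(k,\gamma)$ lies in the third quadrant of the $k\gamma$-plane), then the equilibrium is unstable for all $\tau_1\ge0$, $\tau_2\ge0$ and for $0<\alpha\le1$. (ii) For $\alpha=1$, if $k>0$ and $\gamma<0$ (i.e. $(k,\gamma)$ lies in the fourth quadrant of the $k\gamma$-plane), then the equilibrium is unstable, independently of the delays.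
   Context: $D^\alpha$ is the Caputo fractional derivative of order $\alpha$ with base point $0$ (the ordinary derivative when $\alpha=1$); $\tau_1,\tau_2\ge0$ are constant delays and solutions are determined by a continuous history on $[-(\tau_1+\tau_2),0]$. Stability, asymptotic stability and instability of the equilibrium are in the usual local sense and are studied via the linearization at $0$, $$D^\alpha x(t)=-\gamma x(t)+kx(t-\tau_1)-ke^{-\gamma\tau_2}x(t-\tau_1-\tau_2),$$ and the roots $\lambda$ of its characteristic equation $$\lambda^\alpha=-\gamma+ke^{-\lambda\tau_1}-ke^{-\gamma\tau_2}e^{-\lambda(\tau_1+\tau_2)}$$ (principal branch of $\lambda^\alpha$). *)

theory Defs
  imports "HOL-Analysis.Analysis"
begin

definition RL_integral :: "real \<Rightarrow> (real \<Rightarrow> real) \<Rightarrow> real \<Rightarrow> real" where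
  "RL_integral \<beta> f t = (LINT s:{0..t}|lborel. (t - s) powr (\<beta> - 1) * f s) / Gamma \<beta>"

text \<open>
  Caputo derivative of order \<open>0 < \<alpha> \<le> 1\<close> with base point \<open>0\<close>, in the form
  \<open>d/dt I\<^sup>1\<^sup>-\<^sup>\<alpha> (x - x 0)\<close> (Diethelm; Kilbas, Srivastava and Trujillo). For absolutely
  continuous \<open>x\<close> this is \<open>I\<^sup>1\<^sup>-\<^sup>\<alpha> x'\<close>. The latter formula is not usable here: for a history that is
  merely continuous, the solution of the delay equation need not be differentiable.
\<close>
definition has_caputo_derivative ::
  "real \<Rightarrow> (real \<Rightarrow> real) \<Rightarrow> real \<Rightarrow> real \<Rightarrow> bool" where
  "has_caputo_derivative \<alpha> x D t \<longleftrightarrow>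
     (if \<alpha> = 1 then (x has_real_derivative D) (at t)
      else (RL_integral (1 - \<alpha>) (\<lambda>s. x s - x 0) has_real_derivative D) (at t))"

text \<open>
  In the following, \<open>F\<close> is the right-hand side of the equation
  \<open>D\<^sup>\<alpha> x(t) = F (x t) (x (t - \<tau>1)) (x (t - \<tau>1 - \<tau>2))\<close>, and \<open>\<phi>\<close> is a history, of which only the
  values on \<open>[-(\<tau>1 + \<tau>2), 0]\<close> matter. Solutions live on \<open>[-(\<tau>1 + \<tau>2), T)\<close> with
  \<open>0 < T \<le> \<infinity>\<close>, so that solutions which blow up in finite time are not lost; the values of
  \<open>x\<close> outside this interval are irrelevant.
\<close>
definition is_solution ::
  "real \<Rightarrow> (real \<Rightarrow> real \<Rightarrow> real \<Rightarrow> real) \<Rightarrow> real \<Rightarrow> real \<Rightarrow> (real \<Rightarrow> real) \<Rightarrow> ereal \<Rightarrow> (real \<Rightarrow> real) \<Rightarrow> bool"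
where
  "is_solution \<alpha> F \<tau>1 \<tau>2 \<phi> T x \<longleftrightarrow>
     0 < T \<and>
     continuous_on {t. - (\<tau>1 + \<tau>2) \<le> t \<and> ereal t < T} x \<and>
     (\<forall>t\<in>{- (\<tau>1 + \<tau>2)..0}. x t = \<phi> t) \<and>
     (\<forall>t>0. ereal t < T \<longrightarrow>
        has_caputo_derivative \<alpha> x (F (x t) (x (t - \<tau>1)) (x (t - \<tau>1 - \<tau>2))) t)"

definition is_equilibrium :: "(real \<Rightarrow> real \<Rightarrow> real \<Rightarrow> real) \<Rightarrow> real \<Rightarrow> bool" where
  "is_equilibrium F xe \<longleftrightarrow> F xe xe xe = 0"

definition history_near :: "real \<Rightarrow> real \<Rightarrow> real \<Rightarrow> real \<Rightarrow> (real \<Rightarrow> real) \<Rightarrow> bool" where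
  "history_near \<tau>1 \<tau>2 xe \<delta> \<phi> \<longleftrightarrow>
     continuous_on {- (\<tau>1 + \<tau>2)..0} \<phi> \<and> (\<forall>t\<in>{- (\<tau>1 + \<tau>2)..0}. \<bar>\<phi> t - xe\<bar> < \<delta>)"

definition stable_equilibrium ::
  "real \<Rightarrow> (real \<Rightarrow> real \<Rightarrow> real \<Rightarrow> real) \<Rightarrow> real \<Rightarrow> real \<Rightarrow> real \<Rightarrow> bool" where
  "stable_equilibrium \<alpha> F \<tau>1 \<tau>2 xe \<longleftrightarrow>
     (\<forall>\<epsilon>>0. \<exists>\<delta>>0. \<forall>\<phi>. history_near \<tau>1 \<tau>2 xe \<delta> \<phi> \<longrightarrow>
        (\<forall>T x. is_solution \<alpha> F \<tau>1 \<tau>2 \<phi> T x \<longrightarrow> (\<forall>t\<ge>0. ereal t < T \<longrightarrow> \<bar>x t - xe\<bar> < \<epsilon>)))"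

text \<open>Global existence of the solutions with small history is part of asymptotic stability.\<close>
definition asymptotically_stable_equilibrium ::
  "real \<Rightarrow> (real \<Rightarrow> real \<Rightarrow> real \<Rightarrow> real) \<Rightarrow> real \<Rightarrow> real \<Rightarrow> real \<Rightarrow> bool" where
  "asymptotically_stable_equilibrium \<alpha> F \<tau>1 \<tau>2 xe \<longleftrightarrow>
     stable_equilibrium \<alpha> F \<tau>1 \<tau>2 xe \<and>
     (\<exists>\<delta>>0. \<forall>\<phi>. history_near \<tau>1 \<tau>2 xe \<delta> \<phi> \<longrightarrow>
        (\<exists>x. is_solution \<alpha> F \<tau>1 \<tau>2 \<phi> \<infinity> x) \<and>
        (\<forall>x. is_solution \<alpha> F \<tau>1 \<tau>2 \<phi> \<infinity> x \<longrightarrow> (x \<longlongrightarrow> xe) at_top))"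

text \<open>
  Negating stability says that arbitrarily close to the equilibrium there are histories with a
  (possibly non-global) solution that leaves a fixed neighbourhood of it.
\<close>
definition unstable_equilibrium ::
  "real \<Rightarrow> (real \<Rightarrow> real \<Rightarrow> real \<Rightarrow> real) \<Rightarrow> real \<Rightarrow> real \<Rightarrow> real \<Rightarrow> bool" where
  "unstable_equilibrium \<alpha> F \<tau>1 \<tau>2 xe \<longleftrightarrow> \<not> stable_equilibrium \<alpha> F \<tau>1 \<tau>2 xe"

text \<open>The variables \<open>u\<close>, \<open>v\<close>, \<open>w\<close> stand for \<open>x t\<close>, \<open>x (t - \<tau>1)\<close>, \<open>x (t - \<tau>1 - \<tau>2)\<close>.\<close>
definition delay_rhs ::
  "real \<Rightarrow> (real \<Rightarrow> real) \<Rightarrow> real \<Rightarrow> real \<Rightarrow> real \<Rightarrow> real \<Rightarrow> real" where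
  "delay_rhs \<gamma> g \<tau>2 u v w = - \<gamma> * u + g v - exp (- \<gamma> * \<tau>2) * g w"

end

theory Submission
  imports Defs "HOL-Probability.Characteristic_Functions" "HOL-Complex_Analysis.Complex_Analysis"
    "HOL-Real_Asymp.Real_Asymp"
begin

text \<open>
  Let \<open>B(t) = t\<^sup>\<alpha>\<^sup>-\<^sup>1 / \<Gamma>(\<alpha>)\<close> and let \<open>*\<close> be the convolution of functions on \<open>[0, \<infinity>)\<close>. A function solves
  the equation iff \<open>x = x 0 + B * F\<close>, where \<open>F\<close> is the right-hand side along \<open>x\<close>
  (\<open>solution_imp_volterra\<close>, \<open>volterra_imp_solution\<close>). This form is the same for \<open>\<alpha> = 1\<close> and
  \<open>\<alpha> < 1\<close>, and both cases are treated together from then on.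

  Stability (\<open>\<gamma> > 2 \<bar>k\<bar>\<close>). The delayed terms are regarded as a forcing \<open>h\<close> of the scalar equation
  \<open>D\<^sup>\<alpha> x = - \<gamma> x + h\<close>. The resolvent kernel \<open>e\<close>, defined by \<open>e + \<gamma> B * e = B\<close>, gives
  \<open>x = x 0 (1 - \<gamma> I) + e * h\<close> with \<open>I(t)\<close> the integral of \<open>e\<close> over \<open>[0, t]\<close>
  (\<open>variation_of_constants\<close>). The point is that \<open>e\<close> is positive (\<open>resolvent_pos\<close>) and has total mass
  \<open>1 / \<gamma>\<close> (\<open>resolvent_mass_le\<close>, \<open>resolvent_mass_tendsto\<close>): \<open>x(t)\<close> is an average of \<open>x 0\<close> and of
  the values of \<open>h / \<gamma>\<close>. Since \<open>exp (- \<gamma> \<tau>2) \<le> 1\<close>, near the equilibrium \<open>\<bar>h\<bar> \<le> 2 \<kappa> sup \<bar>x\<bar>\<close> with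
  \<open>2 \<kappa> < \<gamma>\<close>. Hence a solution never reaches the bound of its history, and each eventual bound of
  \<open>\<bar>x\<bar>\<close> improves by a fixed factor below 1. The delays do not enter these estimates.

  Instability (\<open>\<gamma> < 0\<close>). The linearization has a positive characteristic root: for \<open>\<alpha> = 1\<close> the number
  \<open>- \<gamma>\<close> is one, and in the third quadrant the intermediate value theorem gives one for every \<open>\<alpha>\<close>.
  It remains to show that a positive root \<open>l\<close> makes the nonlinear equation unstable
  (\<open>positive_root_instability\<close>). For \<open>\<alpha> < 1\<close> the memory reaches back to time 0, so solutions cannot be
  restarted and the usual cone and semigroup arguments are not available; the Laplace transform replaces
  them. If the equilibrium were stable, small histories would have bounded global solutions, whose
  transform \<open>X\<close> satisfies on the right half-plane
  \<open>m(z) X(z) = x 0 / z + z\<^sup>-\<^sup>\<alpha> Q(z)\<close>. Here \<open>m\<close> is the characteristic function divided by \<open>z\<^sup>\<alpha>\<close>, and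
  \<open>Q\<close> collects the history and the nonlinear part \<open>g x - k x\<close>. The zeros of \<open>m\<close> are countable, so
  some line \<open>Re z = \<mu>\<close> with \<open>0 < \<mu> < l\<close> avoids them and \<open>m\<close> is bounded below on it. By Plancherel the
  identity becomes a bound of \<open>exp (- \<mu> t) x(t)\<close> in \<open>L\<^sup>2\<close> by a multiple of \<open>x 0\<close>, because the nonlinear
  part is a small multiple of \<open>x\<close> itself. At \<open>z = l\<close> the left-hand side vanishes, which forces
  \<open>\<bar>Q(l)\<bar>\<close> to equal a fixed multiple of \<open>x 0\<close>; but for a history concentrated near time 0 the
  bound just obtained makes \<open>Q(l)\<close> an arbitrarily small multiple of \<open>x 0\<close>.
\<close>

section \<open>Convolution of causal functions\<close>

text \<open>
  The integral runs over the whole line: for functions that vanish on \<open>(-\<infinity>, 0)\<close> it is the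
  convolution over \<open>[0, t]\<close>, and it inherits the translation invariance of \<open>lborel\<close>.
\<close>
definition conv :: "(real \<Rightarrow> real) \<Rightarrow> (real \<Rightarrow> real) \<Rightarrow> real \<Rightarrow> real" where
  "conv a b t = (LINT s|lborel. a (t - s) * b s)"

definition causal_L1 :: "(real \<Rightarrow> real) \<Rightarrow> bool" where
  "causal_L1 a \<longleftrightarrow> a \<in> borel_measurable borel \<and> (\<forall>t<0. a t = 0) \<and>
     (\<forall>T. integrable lborel (\<lambda>s. indicator {..T} s * a s))"

text \<open>
  Kernels such as \<open>t\<^sup>\<alpha>\<^sup>-\<^sup>1\<close> are only locally integrable, while solutions and forcings are locally
  bounded. If a kernel is convolved with a locally bounded function, the integrand is integrable for every
  \<open>t\<close>, not only for almost every \<open>t\<close>, and the convolution is again locally bounded.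
\<close>
definition causal_bounded :: "(real \<Rightarrow> real) \<Rightarrow> bool" where
  "causal_bounded c \<longleftrightarrow> c \<in> borel_measurable borel \<and> (\<forall>t<0. c t = 0) \<and>
     (\<forall>T. \<exists>M. \<forall>t\<le>T. \<bar>c t\<bar> \<le> M)"

lemma causal_bounded_measurable [measurable_dest]: "causal_bounded a \<Longrightarrow> a \<in> borel_measurable borel"
  by (simp add: causal_bounded_def)

lemma causal_bounded_imp_L1:
  assumes "causal_bounded c" shows "causal_L1 c"
  unfolding causal_L1_def
proof (intro conjI allI)
  have [measurable]: "c \<in> borel_measurable borel" using assms by (simp add: causal_bounded_def)
  show "c \<in> borel_measurable borel" by measurable
  show "t < 0 \<longrightarrow> c t = 0" for t using assms by (simp add: causal_bounded_def)
  fix T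
  obtain M where M: "\<And>t. t \<le> T \<Longrightarrow> \<bar>c t\<bar> \<le> M" using assms unfolding causal_bounded_def by blast
  have "integrable lborel (\<lambda>s. indicator {0..T} s * \<bar>M\<bar>)"
    by (intro integrable_mult_left) (auto intro!: integrable_real_indicator simp: emeasure_lborel_Icc_eq)
  then show "integrable lborel (\<lambda>s. indicator {..T} s * c s)"
  proof (rule Bochner_Integration.integrable_bound)
    show "AE s in lborel. norm (indicator {..T} s * c s) \<le> norm (indicator {0..T} s * \<bar>M\<bar> :: real)"
    proof (rule AE_I2)
      fix s
      show "norm (indicator {..T} s * c s) \<le> norm (indicator {0..T} s * \<bar>M\<bar> :: real)"
        using M[of s] assms unfolding causal_bounded_def
        by (cases "s < 0") (auto simp: indicator_def abs_mult)
    qed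
  qed measurable
qed

lemma conv_commute: "conv a b t = conv b a t"
proof -
  have "conv a b t = \<bar>-1\<bar> *\<^sub>R (LINT s|lborel. a (t - (t + (-1) * s)) * b (t + (-1) * s))"
    unfolding conv_def by (rule lborel_integral_real_affine) simp
  also have "\<dots> = conv b a t" by (simp add: conv_def mult.commute)
  finally show ?thesis .
qed

text \<open>
  The value at \<open>t\<close> depends only on the restrictions to \<open>[0, t]\<close>. This is what allows a solution that
  exists only up to a finite time to be replaced by a globally defined function.
\<close>
lemma conv_causal_cong:
  assumes "\<forall>t<0. a t = 0" "\<forall>t<0. b t = 0" "\<forall>t<0. a' t = 0" "\<forall>t<0. b' t = 0"
    and "\<And>s. 0 \<le> s \<Longrightarrow> s \<le> t \<Longrightarrow> a s = a' s" and "\<And>s. 0 \<le> s \<Longrightarrow> s \<le> t \<Longrightarrow> b s = b' s"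
  shows "conv a b t = conv a' b' t"
  unfolding conv_def
proof (rule Bochner_Integration.integral_cong)
  fix s
  consider "s < 0" | "s > t" | "0 \<le> s" "s \<le> t" by linarith
  then show "a (t - s) * b s = a' (t - s) * b' s"
    using assms(1-4) assms(5)[of "t - s"] assms(6)[of s] by cases auto
qed simp

lemma conv_neg: "\<lbrakk>\<forall>t<0. a t = 0; \<forall>t<0. b t = 0; t < 0\<rbrakk> \<Longrightarrow> conv a b t = 0"
  unfolding conv_def
  by (rule integral_eq_zero_AE, rule AE_I2) (metis diff_gt_0_iff_gt less_trans mult_eq_0_iff not_less_iff_gr_or_eq diff_less_0_iff_less)

lemma conv_0:
  assumes "\<forall>t\<le>0. a t = 0" "\<forall>t<0. b t = 0"
  shows "conv a b 0 = 0"
  unfolding conv_def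
proof (rule integral_eq_zero_AE, rule AE_I2)
  fix s show "a (0 - s) * b s = 0" using assms by (cases "s < 0") auto
qed

lemma conv_integrable:
  assumes a: "causal_L1 a" and b: "causal_bounded b"
  shows "integrable lborel (\<lambda>s. a (t - s) * b s)"
proof -
  have [measurable]: "a \<in> borel_measurable borel" "b \<in> borel_measurable borel"
    using a b by (auto simp: causal_L1_def causal_bounded_def)
  obtain M where M: "\<And>s. s \<le> t \<Longrightarrow> \<bar>b s\<bar> \<le> M" using b unfolding causal_bounded_def by blast
  have "integrable lborel (\<lambda>s. indicator {..t} s * a s)" using a by (simp add: causal_L1_def)
  from lborel_integrable_real_affine[OF this, of "-1" t]
  have "integrable lborel (\<lambda>s. M * (indicator {..t} (t - s) * a (t - s)))" by simp
  then show ?thesis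
  proof (rule Bochner_Integration.integrable_bound)
    show "AE s in lborel. norm (a (t - s) * b s) \<le> norm (M * (indicator {..t} (t - s) * a (t - s)))"
    proof (rule AE_I2)
      fix s
      consider "s < 0" | "s > t" | "0 \<le> s" "s \<le> t" by linarith
      then show "norm (a (t - s) * b s) \<le> norm (M * (indicator {..t} (t - s) * a (t - s)))"
      proof cases
        case 3
        then show ?thesis using M[of s]
          by (auto simp: abs_mult mult.commute[of "\<bar>a (t-s)\<bar>"] intro!: mult_right_mono)
      qed (use a b in \<open>auto simp: causal_L1_def causal_bounded_def\<close>)
    qed
  qed measurable
qed

lemma conv_add:
  assumes "causal_L1 a" "causal_bounded b" "causal_bounded c"
  shows "conv a (\<lambda>s. b s + c s) t = conv a b t + conv a c t"
  unfolding conv_def using conv_integrable[OF assms(1,2), of t] conv_integrable[OF assms(1,3), of t]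
  by (simp add: distrib_left)

lemma conv_add_left:
  assumes "causal_L1 a" "causal_L1 b" "causal_bounded c"
  shows "conv (\<lambda>s. a s + b s) c t = conv a c t + conv b c t"
  unfolding conv_def using conv_integrable[OF assms(1,3), of t] conv_integrable[OF assms(2,3), of t]
  by (simp add: distrib_right)

lemma conv_scale: "conv a (\<lambda>s. r * b s) t = r * conv a b t"
  unfolding conv_def by (simp add: mult.left_commute[of _ r])

lemma conv_scale_left: "conv (\<lambda>s. r * a s) b t = r * conv a b t"
  unfolding conv_def by (simp add: mult.assoc)

lemma causal_bounded_add: "causal_bounded a \<Longrightarrow> causal_bounded b \<Longrightarrow> causal_bounded (\<lambda>s. a s + b s)"
  unfolding causal_bounded_def by (auto, meson abs_triangle_ineq add_mono order_trans)

lemma causal_bounded_scale: "causal_bounded a \<Longrightarrow> causal_bounded (\<lambda>s. r * a s)"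
  unfolding causal_bounded_def by (auto simp: abs_mult, meson abs_ge_zero mult_left_mono)

lemma causal_L1_scale: "causal_L1 a \<Longrightarrow> causal_L1 (\<lambda>s. r * a s)"
  unfolding causal_L1_def by (auto simp: mult.left_commute[of _ r])

lemma conv_mono:
  assumes a: "causal_L1 a" "\<And>s. a s \<ge> 0" and b: "causal_bounded b" "causal_bounded c"
    and le: "\<And>s. 0 \<le> s \<Longrightarrow> s \<le> t \<Longrightarrow> b s \<le> c s"
  shows "conv a b t \<le> conv a c t"
  unfolding conv_def
proof (rule integral_mono[OF conv_integrable conv_integrable])
  fix s
  consider "s < 0" | "s > t" | "0 \<le> s" "s \<le> t" by linarith
  then show "a (t - s) * b s \<le> a (t - s) * c s"
    using a b le[of s] by cases (auto simp: causal_L1_def causal_bounded_def intro: mult_left_mono)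
qed (use assms in auto)

lemma conv_abs_le:
  assumes a: "causal_L1 a" "\<And>s. a s \<ge> 0" and b: "causal_bounded b" "causal_bounded c"
    and le: "\<And>s. 0 \<le> s \<Longrightarrow> s \<le> t \<Longrightarrow> \<bar>b s\<bar> \<le> c s"
  shows "\<bar>conv a b t\<bar> \<le> conv a c t"
proof -
  have "conv a b t \<le> conv a c t" by (rule conv_mono) (use assms in \<open>auto simp: abs_le_iff\<close>)
  moreover have "conv a (\<lambda>s. (-1) * b s) t \<le> conv a c t"
    by (rule conv_mono) (use assms causal_bounded_scale[OF b(1), of "-1"] in \<open>auto simp: abs_le_iff\<close>)
  ultimately show ?thesis unfolding conv_scale by linarith
qed

lemma conv_L1_Fubini:
  fixes a b :: "real \<Rightarrow> 'a::{banach, second_countable_topology, real_normed_field}"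
  assumes a: "integrable lborel a" and b: "integrable lborel b"
  shows "integrable lborel (\<lambda>t. LINT s|lborel. a (t - s) * b s)"
    and "(LINT t|lborel. LINT s|lborel. a (t - s) * b s) = (LINT t|lborel. a t) * (LINT s|lborel. b s)"
proof -
  have [measurable]: "a \<in> borel_measurable borel" "b \<in> borel_measurable borel"
    using a b by auto
  have shift: "integrable lborel (\<lambda>t. a (t - s))" "(LINT t|lborel. a (t - s)) = (LINT t|lborel. a t)" for s
    using lborel_integrable_real_affine[OF a, of 1 "-s"] lborel_integral_real_affine[of 1 a "-s"] by (simp_all add: add.commute)
  have shiftn: "(LINT t|lborel. norm (a (t - s))) = (LINT t|lborel. norm (a t))" for s
    using lborel_integral_real_affine[of 1 "\<lambda>t. norm (a t)" "-s"] by (simp add: add.commute)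
  have I: "integrable (lborel \<Otimes>\<^sub>M lborel) (\<lambda>(s, t). a (t - s) * b s)"
  proof (rule lborel_pair.Fubini_integrable)
    show "integrable lborel (\<lambda>s. LINT t|lborel. norm (case (s, t) of (s, t) \<Rightarrow> a (t - s) * b s))"
      using b by (simp add: norm_mult shiftn)
    show "AE s in lborel. integrable lborel (\<lambda>t. case (s, t) of (s, t) \<Rightarrow> a (t - s) * b s)"
      using shift by simp
  qed measurable
  show "integrable lborel (\<lambda>t. LINT s|lborel. a (t - s) * b s)"
    using lborel_pair.integrable_snd[OF I] by simp
  have "(LINT t|lborel. LINT s|lborel. a (t - s) * b s) = (LINT s|lborel. LINT t|lborel. a (t - s) * b s)"
    using lborel_pair.Fubini_integral[OF I] by simp
  also have "\<dots> = (LINT t|lborel. a t) * (LINT s|lborel. b s)"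
    by (simp add: shift(2))
  finally show "(LINT t|lborel. LINT s|lborel. a (t - s) * b s) = (LINT t|lborel. a t) * (LINT s|lborel. b s)" .
qed

lemma conv_assoc_L1:
  assumes a: "integrable lborel a" and b: "integrable lborel b"
    and c[measurable]: "c \<in> borel_measurable borel" and M: "\<And>s. \<bar>c s\<bar> \<le> M"
  shows "conv a (conv b c) t = conv (conv a b) c t"
proof -
  have [measurable]: "a \<in> borel_measurable borel" "b \<in> borel_measurable borel"
    using a b by auto
  have at: "integrable lborel (\<lambda>s. a (t - s))"
    using lborel_integrable_real_affine[OF a, of "-1" t] by simp
  have bt: "integrable lborel (\<lambda>s. b (r - s))" for r
    using lborel_integrable_real_affine[OF b, of "-1" r] by simp
  have bn: "(LINT r|lborel. \<bar>b (s - r)\<bar>) = (LINT r|lborel. \<bar>b r\<bar>)" for s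
    using lborel_integral_real_affine[of "-1" "\<lambda>t. \<bar>b t\<bar>" s] by simp
  have dom: "integrable (lborel \<Otimes>\<^sub>M lborel) (\<lambda>(s, r). M * (a (t - s) * b (s - r)))"
  proof (rule lborel_pair.Fubini_integrable)
    show "integrable lborel (\<lambda>s. LINT r|lborel. norm (case (s, r) of (s, r) \<Rightarrow> M * (a (t - s) * b (s - r))))"
      using at by (simp add: abs_mult bn)
  qed (use bt in auto)
  have I: "integrable (lborel \<Otimes>\<^sub>M lborel) (\<lambda>(s, r). a (t - s) * (b (s - r) * c r))"
  proof (rule Bochner_Integration.integrable_bound[OF dom])
    show "AE x in lborel \<Otimes>\<^sub>M lborel. norm (case x of (s, r) \<Rightarrow> a (t - s) * (b (s - r) * c r))
            \<le> norm (case x of (s, r) \<Rightarrow> M * (a (t - s) * b (s - r)))"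
    proof (rule AE_I2, clarify)
      fix s r
      have "\<bar>c r\<bar> * (\<bar>a (t - s)\<bar> * \<bar>b (s - r)\<bar>) \<le> \<bar>M\<bar> * (\<bar>a (t - s)\<bar> * \<bar>b (s - r)\<bar>)"
        using M[of r] by (intro mult_right_mono) auto
      then show "norm (a (t - s) * (b (s - r) * c r)) \<le> norm (M * (a (t - s) * b (s - r)))"
        by (simp add: abs_mult mult_ac)
    qed
  qed measurable
  have "conv a (conv b c) t = (LINT s|lborel. LINT r|lborel. a (t - s) * (b (s - r) * c r))"
    by (simp add: conv_def)
  also have "\<dots> = (LINT r|lborel. LINT s|lborel. a (t - s) * (b (s - r) * c r))"
    using lborel_pair.Fubini_integral[OF I] by simp
  also have "\<dots> = (LINT r|lborel. (LINT s|lborel. a (t - s) * b (s - r)) * c r)"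
    by (simp add: mult.assoc[symmetric])
  also have "(\<lambda>r. LINT s|lborel. a (t - s) * b (s - r)) = (\<lambda>r. conv a b (t - r))"
  proof
    fix r
    show "(LINT s|lborel. a (t - s) * b (s - r)) = conv a b (t - r)"
      unfolding conv_def
      using lborel_integral_real_affine[of 1 "\<lambda>s. a (t - s) * b (s - r)" r] by (simp add: algebra_simps)
  qed
  finally show ?thesis by (simp add: conv_def)
qed

text \<open>
  At a fixed time both sides only see \<open>[0, t]\<close>, where the factors can be cut off; the cut-off kernels are
  integrable, and there Fubini applies.
\<close>
lemma conv_assoc:
  assumes a: "causal_L1 a" and b: "causal_L1 b" and c: "causal_bounded c"
  shows "conv a (conv b c) t = conv (conv a b) c t"
proof -
  define tr where "tr = (\<lambda>(f :: real \<Rightarrow> real) s. indicator {..t} s * f s)"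
  have z: "\<forall>t<0. a t = 0" "\<forall>t<0. b t = 0" "\<forall>t<0. c t = 0"
    using a b c by (auto simp: causal_L1_def causal_bounded_def)
  then have z': "\<forall>t<0. tr a t = 0" "\<forall>t<0. tr b t = 0" "\<forall>t<0. tr c t = 0"
    by (auto simp: tr_def)
  have e: "s \<le> t \<Longrightarrow> tr f s = f s" for s f by (simp add: tr_def)
  obtain M where M: "\<And>s. s \<le> t \<Longrightarrow> \<bar>c s\<bar> \<le> M" using c unfolding causal_bounded_def by blast
  have [measurable]: "c \<in> borel_measurable borel" using c by (simp add: causal_bounded_def)
  have "conv a (conv b c) t = conv (tr a) (conv (tr b) (tr c)) t"
    by (intro conv_causal_cong) (use z z' e in \<open>auto intro!: conv_neg conv_causal_cong\<close>)
  also have "\<dots> = conv (conv (tr a) (tr b)) (tr c) t"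
  proof (rule conv_assoc_L1)
    show "\<bar>tr c s\<bar> \<le> \<bar>M\<bar>" for s using M[of s] by (auto simp: tr_def indicator_def)
  qed (use a b in \<open>auto simp: tr_def causal_L1_def\<close>)
  also have "\<dots> = conv (conv a b) c t"
    by (intro conv_causal_cong) (use z z' e in \<open>auto intro!: conv_neg conv_causal_cong\<close>)
  finally show ?thesis .
qed

lemma conv_causal_bounded:
  assumes a: "causal_L1 a" and b: "causal_bounded b"
  shows "causal_bounded (conv a b)"
  unfolding causal_bounded_def
proof (intro conjI allI impI)
  have [measurable]: "a \<in> borel_measurable borel" "b \<in> borel_measurable borel"
    using a b by (auto simp: causal_L1_def causal_bounded_def)
  show "conv a b \<in> borel_measurable borel" unfolding conv_def[abs_def] by measurable
  show "t < 0 \<Longrightarrow> conv a b t = 0" for t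
    using a b by (intro conv_neg) (auto simp: causal_L1_def causal_bounded_def)
  fix T
  obtain M where M: "\<And>s. s \<le> T \<Longrightarrow> \<bar>b s\<bar> \<le> M" using b unfolding causal_bounded_def by blast
  have aT: "integrable lborel (\<lambda>s. indicator {..T} s * a s)" using a by (simp add: causal_L1_def)
  show "\<exists>K. \<forall>t\<le>T. \<bar>conv a b t\<bar> \<le> K"
  proof (intro exI allI impI)
    fix t assume t: "t \<le> T"
    have i: "integrable lborel (\<lambda>s. \<bar>M\<bar> * \<bar>indicator {..T} (t - s) * a (t - s)\<bar>)"
      using lborel_integrable_real_affine[OF aT, of "-1" t] by simp
    have "\<bar>conv a b t\<bar> \<le> (LINT s|lborel. \<bar>a (t - s) * b s\<bar>)"
      unfolding conv_def by (rule integral_abs_bound)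
    also have "\<dots> \<le> (LINT s|lborel. \<bar>M\<bar> * \<bar>indicator {..T} (t - s) * a (t - s)\<bar>)"
    proof (rule integral_mono[OF _ i])
      show "integrable lborel (\<lambda>s. \<bar>a (t - s) * b s\<bar>)" using conv_integrable[OF a b] by simp
      fix s
      consider "s < 0" | "s > t" | "0 \<le> s" "s \<le> t" by linarith
      then show "\<bar>a (t - s) * b s\<bar> \<le> \<bar>M\<bar> * \<bar>indicator {..T} (t - s) * a (t - s)\<bar>"
      proof cases
        case 3
        then show ?thesis using M[of s] t
          by (auto simp: abs_mult mult.commute[of "\<bar>a (t-s)\<bar>"] intro!: mult_right_mono)
      qed (use a b in \<open>auto simp: causal_L1_def causal_bounded_def\<close>)
    qed
    also have "\<dots> = (LINT s|lborel. \<bar>M\<bar> * \<bar>indicator {..T} s * a s\<bar>)"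
      using lborel_integral_real_affine[of "-1" "\<lambda>s. \<bar>M\<bar> * \<bar>indicator {..T} s * a s\<bar>" t] by auto
    finally show "\<bar>conv a b t\<bar> \<le> (LINT s|lborel. \<bar>M\<bar> * \<bar>indicator {..T} s * a s\<bar>)" .
  qed
qed

text \<open>
  Written as the integral of \<open>b (t - s) a s\<close>, the dependence on \<open>t\<close> sits in the factor \<open>b\<close>, which
  is continuous except for the jump at \<open>s = t\<close>; dominated convergence does the rest.
\<close>
lemma conv_continuous:
  assumes a: "causal_L1 a" and b: "causal_bounded b" and cont: "continuous_on {0..} b"
  shows "continuous_on {0..} (conv a b)"
  unfolding continuous_on_sequentially
proof (intro allI ballI impI)
  fix X :: "nat \<Rightarrow> real" and t :: real
  assume t: "t \<in> {0..}" and "(\<forall>n. X n \<in> {0..}) \<and> X \<longlonglongrightarrow> t"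
  then have X: "\<And>n. X n \<ge> 0" and lim: "X \<longlonglongrightarrow> t" by auto
  have [measurable]: "a \<in> borel_measurable borel" "b \<in> borel_measurable borel"
    using a b by (auto simp: causal_L1_def causal_bounded_def)
  obtain T where T: "\<And>n. \<bar>X n\<bar> \<le> T" using lim convergent_imp_Bseq[of X] by (auto simp: convergent_def Bseq_def)
  obtain M where M: "\<And>s. s \<le> T \<Longrightarrow> \<bar>b s\<bar> \<le> M" using b unfolding causal_bounded_def by blast
  have z: "\<And>s. s < 0 \<Longrightarrow> b s = 0" "\<And>s. s < 0 \<Longrightarrow> a s = 0" using a b by (auto simp: causal_L1_def causal_bounded_def)
  have "(\<lambda>n. LINT s|lborel. b (X n - s) * a s) \<longlonglongrightarrow> (LINT s|lborel. b (t - s) * a s)"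
  proof (rule integral_dominated_convergence[where w="\<lambda>s. M * \<bar>indicator {..T} s * a s\<bar>"])
    show "integrable lborel (\<lambda>s. M * \<bar>indicator {..T} s * a s\<bar>)" using a by (simp add: causal_L1_def)
    have "AE s in lborel. s \<noteq> t" by (rule AE_lborel_singleton)
    then show "AE s in lborel. (\<lambda>n. b (X n - s) * a s) \<longlonglongrightarrow> b (t - s) * a s"
    proof eventually_elim
      case (elim s)
      have l: "(\<lambda>n. X n - s) \<longlonglongrightarrow> t - s" by (intro tendsto_intros lim)
      have "(\<lambda>n. b (X n - s)) \<longlonglongrightarrow> b (t - s)"
      proof (cases "s < t")
        case True
        then have "isCont b (t - s)"
          using cont by (metis at_within_interior atLeast_iff continuous_on_eq_continuous_within diff_gt_0_iff_gt greaterThan_iff interior_real_atLeast order_less_imp_le)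
        then show ?thesis using l by (rule isCont_tendsto_compose)
      next
        case False
        with elim have "t - s < 0" by simp
        with l have "\<forall>\<^sub>F n in sequentially. X n - s < 0" by (rule order_tendstoD)
        then have "\<forall>\<^sub>F n in sequentially. b (X n - s) = b (t - s)"
          by eventually_elim (use z \<open>t - s < 0\<close> in auto)
        then show ?thesis by (rule tendsto_eventually)
      qed
      then show ?case by (intro tendsto_intros)
    qed
    show "AE s in lborel. norm (b (X n - s) * a s) \<le> M * \<bar>indicator {..T} s * a s\<bar>" for n
    proof (rule AE_I2)
      fix s
      consider "s < 0" | "s > X n" | "0 \<le> s" "s \<le> X n" by linarith
      then show "norm (b (X n - s) * a s) \<le> M * \<bar>indicator {..T} s * a s\<bar>"
      proof cases
        case 3
        then show ?thesis using M[of "X n - s"] T[of n]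
          by (auto simp: abs_mult intro!: mult_right_mono)
      next
        case 2
        have "M \<ge> 0" using M[of T] by linarith
        with 2 show ?thesis using z by auto
      qed (use z in auto)
    qed
  qed measurable
  then show "(conv a b \<circ> X) \<longlonglongrightarrow> conv a b t"
    unfolding comp_def by (subst (1 2) conv_commute) (simp add: conv_def)
qed

section \<open>Riemann--Liouville kernels and the Volterra form of the equation\<close>

text \<open>
  Convolution with \<open>frac_kernel \<beta>\<close> is the Riemann--Liouville integral of order \<open>\<beta>\<close>; see
  \<open>RL_integral_eq_conv\<close>. The value 0 at \<open>t = 0\<close> agrees with \<open>0 powr (\<beta> - 1) = 0\<close>.
\<close>
definition frac_kernel :: "real \<Rightarrow> real \<Rightarrow> real" where
  "frac_kernel \<beta> t = (if t > 0 then t powr (\<beta> - 1) / Gamma \<beta> else 0)"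

lemma frac_kernel_measurable [measurable]: "frac_kernel \<beta> \<in> borel_measurable borel"
  unfolding frac_kernel_def[abs_def] by measurable

lemma frac_kernel_nonneg: "\<beta> > 0 \<Longrightarrow> frac_kernel \<beta> t \<ge> 0"
  by (simp add: frac_kernel_def Gamma_real_pos less_imp_le)

lemma frac_kernel_nonpos_eq_0: "t \<le> 0 \<Longrightarrow> frac_kernel \<beta> t = 0"
  by (simp add: frac_kernel_def)

lemma frac_kernel_laplace_real:
  assumes "\<beta> > 0" "l > 0"
  shows "has_bochner_integral lborel (\<lambda>t. exp (- l * t) * frac_kernel \<beta> t) (l powr (- \<beta>))"
proof -
  let ?f = "\<lambda>t. exp (- t) * frac_kernel \<beta> t"
  have G: "Gamma \<beta> > 0" using assms by (simp add: Gamma_real_pos)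
  have "(\<integral>\<^sup>+ t. ennreal (indicator {0..} t * t powr (\<beta> - 1) / exp t) \<partial>lborel) = ennreal (Gamma \<beta>)"
    using Gamma_conv_nn_integral_real[OF assms(1)] by simp
  then have "has_bochner_integral lborel (\<lambda>t. indicator {0..} t * t powr (\<beta> - 1) / exp t) (Gamma \<beta>)"
    by (intro has_bochner_integral_nn_integral) (use G in auto)
  then have "has_bochner_integral lborel (\<lambda>t. (indicator {0..} t * t powr (\<beta> - 1) / exp t) * (1 / Gamma \<beta>)) (Gamma \<beta> * (1 / Gamma \<beta>))"
    by (rule has_bochner_integral_mult_left)
  also have "(\<lambda>t. (indicator {0..} t * t powr (\<beta> - 1) / exp t) * (1 / Gamma \<beta>)) = ?f"
    by (auto simp: fun_eq_iff frac_kernel_def indicator_def exp_minus divide_simps)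
  finally have "has_bochner_integral lborel ?f 1" using G by simp
  then have "has_bochner_integral lborel (\<lambda>t. ?f (0 + l * t)) (1 /\<^sub>R \<bar>l\<bar>)"
    using assms by (subst lborel_has_bochner_integral_real_affine_iff[symmetric]) auto
  then have "has_bochner_integral lborel (\<lambda>t. l powr (1 - \<beta>) * ?f (0 + l * t)) (l powr (1 - \<beta>) * (1 /\<^sub>R \<bar>l\<bar>))"
    by (rule has_bochner_integral_mult_right)
  also have "(\<lambda>t. l powr (1 - \<beta>) * ?f (0 + l * t)) = (\<lambda>t. exp (- l * t) * frac_kernel \<beta> t)"
    using assms by (auto simp: fun_eq_iff frac_kernel_def powr_mult powr_add[symmetric] zero_less_mult_iff mult.assoc[symmetric] 
       mult.left_commute[of "l powr _"] mult.commute[of "l powr _"])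
  also have "l powr (1 - \<beta>) * (1 /\<^sub>R \<bar>l\<bar>) = l powr (- \<beta>)"
    using assms by (simp add: powr_diff powr_minus field_simps)
  finally show ?thesis .
qed

lemma causal_L1_frac_kernel:
  assumes "\<beta> > 0" shows "causal_L1 (frac_kernel \<beta>)"
  unfolding causal_L1_def
proof (intro conjI allI impI)
  fix T
  have "integrable lborel (\<lambda>t. exp T * (exp (- 1 * t) * frac_kernel \<beta> t))"
    using frac_kernel_laplace_real[OF assms, of 1] by (intro integrable_mult_right) (auto simp: has_bochner_integral_iff)
  then show "integrable lborel (\<lambda>s. indicator {..T} s * frac_kernel \<beta> s)"
  proof (rule Bochner_Integration.integrable_bound)
    show "AE s in lborel. norm (indicator {..T} s * frac_kernel \<beta> s) \<le> norm (exp T * (exp (- 1 * s) * frac_kernel \<beta> s))"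
    proof (rule AE_I2)
      fix s
      show "norm (indicator {..T} s * frac_kernel \<beta> s) \<le> norm (exp T * (exp (- 1 * s) * frac_kernel \<beta> s))"
      proof (cases "s \<le> T")
        case True
        then have "1 \<le> exp (T - s)" by simp
        then have "1 * frac_kernel \<beta> s \<le> exp (T - s) * frac_kernel \<beta> s"
          by (intro mult_right_mono frac_kernel_nonneg assms)
        then show ?thesis using True frac_kernel_nonneg[OF assms, of s]
          by (simp add: exp_diff exp_minus field_simps)
      qed simp
    qed
  qed measurable
qed (auto simp: frac_kernel_nonpos_eq_0)

lemma frac_kernel_1: "frac_kernel 1 t = (if t > 0 then 1 else 0)"
  by (simp add: frac_kernel_def)

lemma causal_bounded_frac_kernel_1: "causal_bounded (frac_kernel 1)"
  unfolding causal_bounded_def by (auto simp: frac_kernel_1 intro!: exI[of _ 1])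

text \<open>
  Substituting \<open>s = t u\<close> turns the convolution into a Beta integral. With \<open>a + b = 1\<close> this is
  Abel's identity, on which the inversion of fractional integrals rests.
\<close>
lemma conv_frac_kernel:
  assumes "a > 0" "b > 0"
  shows "conv (frac_kernel a) (frac_kernel b) t = frac_kernel (a + b) t"
proof (cases "t > 0")
  case False
  have z: "frac_kernel a (t - s) * frac_kernel b s = 0" for s
    using False by (cases "s > 0") (auto simp: frac_kernel_def)
  then have "conv (frac_kernel a) (frac_kernel b) t = 0" unfolding conv_def by (simp only: z integral_zero)
  then show ?thesis using False by (simp add: frac_kernel_def)
next
  case t: True
  have GG: "Gamma a > 0" "Gamma b > 0" "Gamma (a + b) > 0" using assms by (auto intro: Gamma_real_pos)
  have B: "Beta b a = Gamma a * Gamma b / Gamma (a + b)" by (simp add: Beta_def add.commute)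
  define h where "h = (\<lambda>u::real. u powr (b - 1) * (1 - u) powr (a - 1))"
  have "(\<integral>\<^sup>+ u. ennreal (indicator {0..1} u * h u) \<partial>lborel) = ennreal (Beta b a)"
    by (rule nn_integral_has_integral_lebesgue[OF _ has_integral_Beta_real[OF assms(2,1), folded h_def]])
       (simp add: h_def)
  then have hb: "has_bochner_integral lborel (\<lambda>u. indicator {0..1} u * h u) (Beta b a)"
    by (intro has_bochner_integral_nn_integral)
       (use GG in \<open>auto simp: h_def B intro!: mult_nonneg_nonneg\<close>)
  have "conv (frac_kernel a) (frac_kernel b) t
     = t * (LINT u|lborel. frac_kernel a (t - (0 + t * u)) * frac_kernel b (0 + t * u))"
    unfolding conv_def using t by (subst lborel_integral_real_affine[of t _ 0]) auto
  also have "(\<lambda>u. frac_kernel a (t - (0 + t * u)) * frac_kernel b (0 + t * u))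
     = (\<lambda>u. t powr (a + b - 2) / (Gamma a * Gamma b) * (indicator {0..1} u * h u))"
  proof
    fix u
    have e1: "t - t * u = t * (1 - u)" by (simp add: algebra_simps)
    have e2: "t powr (a - 1) * t powr (b - 1) = t powr (a + b - 2)"
      by (simp add: powr_add[symmetric])
    consider "u \<le> 0" | "u \<ge> 1" | "0 < u" "u < 1" by linarith
    then show "frac_kernel a (t - (0 + t * u)) * frac_kernel b (0 + t * u)
       = t powr (a + b - 2) / (Gamma a * Gamma b) * (indicator {0..1} u * h u)"
    proof cases
      case 3
      then show ?thesis using t unfolding e2[symmetric]
        by (simp add: e1 frac_kernel_def h_def powr_mult zero_less_mult_iff)
    qed (use t in \<open>auto simp: e1 frac_kernel_def h_def indicator_def zero_less_mult_iff\<close>)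
  qed
  also have "(LINT u|lborel. t powr (a + b - 2) / (Gamma a * Gamma b) * (indicator {0..1} u * h u))
     = t powr (a + b - 2) / (Gamma a * Gamma b) * Beta b a"
    using hb by (subst integral_mult_right_zero) (simp add: has_bochner_integral_iff)
  also have "t * \<dots> = frac_kernel (a + b) t"
  proof -
    have "t * t powr (a + b - 2) = t powr (a + b - 1)"
      using t powr_add[of t 1 "a + b - 2"] by (simp add: algebra_simps)
    then show ?thesis using t GG by (simp add: B frac_kernel_def)
  qed
  finally show ?thesis .
qed

text \<open>
  Only the values on \<open>[0, \<infinity>)\<close> enter the fractional integrals, whereas a solution also carries its
  history.
\<close>
definition causal_part :: "(real \<Rightarrow> real) \<Rightarrow> real \<Rightarrow> real" where
  "causal_part f s = (if s < 0 then 0 else f s)"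

lemma causal_part_neg: "\<forall>t<0. causal_part f t = 0" by (simp add: causal_part_def)

lemma RL_integral_eq_conv:
  "RL_integral \<beta> f t = conv (frac_kernel \<beta>) (causal_part f) t"
  unfolding RL_integral_def conv_def set_lebesgue_integral_def
  by (subst integral_divide_zero[symmetric], rule Bochner_Integration.integral_cong)
     (auto simp: frac_kernel_def causal_part_def indicator_def)

lemma continuous_imp_causal_bounded:
  assumes "\<And>t. t < 0 \<Longrightarrow> f t = 0" and cont: "continuous_on {0..} f"
  shows "causal_bounded f"
  unfolding causal_bounded_def
proof (intro conjI allI impI)
  have "(\<lambda>t. if t \<in> {0..} then f t else 0) \<in> borel_measurable borel"
    by (rule borel_measurable_continuous_on_if) (use cont in auto)
  also have "(\<lambda>t. if t \<in> {0..} then f t else 0) = f" using assms(1) by (auto simp: fun_eq_iff)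
  finally show "f \<in> borel_measurable borel" .
  fix T
  have "compact (f ` {0..T})"
    by (intro compact_continuous_image continuous_on_subset[OF cont]) auto
  then obtain M where M: "\<And>t. t \<in> {0..T} \<Longrightarrow> norm (f t) \<le> M"
    by (meson compact_imp_bounded bounded_iff imageI)
  show "\<exists>M. \<forall>t\<le>T. \<bar>f t\<bar> \<le> M"
  proof (intro exI allI impI)
    fix t assume "t \<le> T" then show "\<bar>f t\<bar> \<le> \<bar>M\<bar>"
      using M[of t] assms(1)[of t] by (cases "t < 0") auto
  qed
qed (use assms in auto)

lemma continuous_on_causal_part:
  "continuous_on {0..} f \<Longrightarrow> continuous_on {0..} (causal_part f)"
  by (subst continuous_on_cong[OF refl, of _ _ f]) (auto simp: causal_part_def)

lemma causal_bounded_causal_part: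
  "continuous_on {0..} f \<Longrightarrow> causal_bounded (causal_part f)"
  by (rule continuous_imp_causal_bounded) (auto simp: causal_part_def intro: continuous_on_causal_part[unfolded causal_part_def[abs_def]])

text \<open>
  A function given on \<open>[0, T]\<close> is continued by its last value.
\<close>
lemma continuous_on_freeze:
  fixes f :: "real \<Rightarrow> real"
  assumes "continuous_on {0..T} f" "T \<ge> 0"
  shows "continuous_on {0..} (\<lambda>s. f (min s T))"
  by (rule continuous_on_compose2[OF assms(1)]) (use assms in \<open>auto intro!: continuous_intros\<close>)

lemma conv_frac_kernel_1:
  assumes b: "causal_bounded b" and "t \<ge> 0"
  shows "conv (frac_kernel 1) b t = integral {0..t} b"
proof -
  have i: "set_integrable lborel {0..t} b"
  proof -
    have "integrable lborel (\<lambda>s. indicator {..t} s * b s)"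
      using causal_bounded_imp_L1[OF b] by (simp add: causal_L1_def)
    also have "(\<lambda>s. indicator {..t} s * b s) = (\<lambda>s. indicator {0..t} s *\<^sub>R b s)"
      using b by (auto simp: fun_eq_iff indicator_def causal_bounded_def)
    finally show ?thesis by (simp add: set_integrable_def)
  qed
  have "conv (frac_kernel 1) b t = (LINT s:{0..t}|lborel. b s)"
    unfolding conv_def set_lebesgue_integral_def
  proof (rule integral_cong_AE)
    have "AE s in lborel. s \<noteq> t" by (rule AE_lborel_singleton)
    then show "AE s in lborel. frac_kernel 1 (t - s) * b s = indicator {0..t} s *\<^sub>R b s"
      by eventually_elim (use b in \<open>auto simp: frac_kernel_1 indicator_def causal_bounded_def\<close>)
  qed (use b in \<open>auto simp: causal_bounded_def\<close>)
  also have "\<dots> = integral {0..t} b" using i by (rule set_borel_integral_eq_integral)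
  finally show ?thesis .
qed

lemma conv_frac_kernel_1_deriv:
  assumes b: "causal_bounded b" and cont: "continuous_on {0..} b" and t: "t > 0"
  shows "(conv (frac_kernel 1) b has_real_derivative b t) (at t)"
proof -
  have "((\<lambda>s. integral {0..s} b) has_real_derivative b t) (at t within {0..t+1})"
    by (rule integral_has_real_derivative) (use t in \<open>auto intro: continuous_on_subset[OF cont]\<close>)
  then have "((\<lambda>s. integral {0..s} b) has_real_derivative b t) (at t)"
    using t by (subst (asm) at_within_interior) auto
  then show ?thesis
  proof (rule has_field_derivative_transform_within_open)
    show "open {0::real<..}" by simp
  qed (use t conv_frac_kernel_1[OF b] in auto)
qed

lemma frac_kernel_abel:
  assumes "0 < \<alpha>" "\<alpha> < 1" and b: "causal_bounded b"
  shows "conv (frac_kernel (1 - \<alpha>)) (conv (frac_kernel \<alpha>) b) t = conv (frac_kernel 1) b t"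
    "conv (frac_kernel \<alpha>) (conv (frac_kernel (1 - \<alpha>)) b) t = conv (frac_kernel 1) b t"
proof -
  have "conv (frac_kernel (1 - \<alpha>)) (frac_kernel \<alpha>) = frac_kernel 1"
       "conv (frac_kernel \<alpha>) (frac_kernel (1 - \<alpha>)) = frac_kernel 1"
    using assms conv_frac_kernel[of "1 - \<alpha>" \<alpha>] conv_frac_kernel[of \<alpha> "1 - \<alpha>"] by auto
  then show "conv (frac_kernel (1 - \<alpha>)) (conv (frac_kernel \<alpha>) b) t = conv (frac_kernel 1) b t"
    "conv (frac_kernel \<alpha>) (conv (frac_kernel (1 - \<alpha>)) b) t = conv (frac_kernel 1) b t"
    using assms by (simp_all add: conv_assoc causal_L1_frac_kernel)
qed

text \<open>
  Convolving the hypothesis with \<open>frac_kernel \<alpha>\<close> gives \<open>1 * v = 1 * (frac_kernel \<alpha> * F)\<close>; both sides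
  are then differentiated.
\<close>
lemma abel_inversion:
  assumes \<alpha>: "0 < \<alpha>" "\<alpha> < 1" and v: "causal_bounded v" "continuous_on {0..} v"
    and F: "causal_bounded F" "continuous_on {0..} F"
    and eq: "\<And>t. 0 \<le> t \<Longrightarrow> t \<le> T \<Longrightarrow> conv (frac_kernel (1 - \<alpha>)) v t = conv (frac_kernel 1) F t"
    and t: "0 < t" "t < T"
  shows "v t = conv (frac_kernel \<alpha>) F t"
proof -
  have L: "causal_L1 (frac_kernel \<alpha>)" "causal_L1 (frac_kernel 1)" "causal_L1 (frac_kernel (1 - \<alpha>))"
    using \<alpha> by (auto intro: causal_L1_frac_kernel)
  have BF: "causal_bounded (conv (frac_kernel \<alpha>) F)" "continuous_on {0..} (conv (frac_kernel \<alpha>) F)"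
    by (intro conv_causal_bounded conv_continuous L F)+
  have same: "conv (frac_kernel 1) v s = conv (frac_kernel 1) (conv (frac_kernel \<alpha>) F) s" if s: "0 < s" "s < T" for s
  proof -
    have "conv (frac_kernel 1) v s = conv (frac_kernel \<alpha>) (conv (frac_kernel (1 - \<alpha>)) v) s"
      using frac_kernel_abel(2)[OF \<alpha> v(1)] by simp
    also have "\<dots> = conv (frac_kernel \<alpha>) (conv (frac_kernel 1) F) s"
      by (rule conv_causal_cong)
         (use s eq L conv_causal_bounded[OF L(3) v(1)] conv_causal_bounded[OF L(2) F(1)]
           in \<open>auto simp: causal_L1_def causal_bounded_def\<close>)
    also have "\<dots> = conv (conv (frac_kernel \<alpha>) (frac_kernel 1)) F s" by (rule conv_assoc[OF L(1,2) F(1)])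
    also have "conv (frac_kernel \<alpha>) (frac_kernel 1) = conv (frac_kernel 1) (frac_kernel \<alpha>)"
      by (rule ext) (rule conv_commute)
    also have "conv \<dots> F s = conv (frac_kernel 1) (conv (frac_kernel \<alpha>) F) s"
      by (rule conv_assoc[OF L(2,1) F(1), symmetric])
    finally show ?thesis .
  qed
  have "(conv (frac_kernel 1) v has_real_derivative v t) (at t)"
    by (rule conv_frac_kernel_1_deriv) (use v t in auto)
  moreover have "(conv (frac_kernel 1) v has_real_derivative conv (frac_kernel \<alpha>) F t) (at t)"
  proof (rule has_field_derivative_transform_within_open)
    show "(conv (frac_kernel 1) (conv (frac_kernel \<alpha>) F) has_real_derivative conv (frac_kernel \<alpha>) F t) (at t)"
      by (rule conv_frac_kernel_1_deriv) (use BF t in auto)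
    show "open {0<..<T}" by simp
  qed (use t same in auto)
  ultimately show ?thesis by (rule DERIV_unique)
qed

definition rhs_along :: "(real \<Rightarrow> real \<Rightarrow> real \<Rightarrow> real) \<Rightarrow> real \<Rightarrow> real \<Rightarrow> (real \<Rightarrow> real) \<Rightarrow> real \<Rightarrow> real" where
  "rhs_along F \<tau>1 \<tau>2 x s = F (x s) (x (s - \<tau>1)) (x (s - \<tau>1 - \<tau>2))"

lemma continuous_on_rhs_along:
  assumes F: "continuous_on UNIV (\<lambda>(u, v, w). F u v w)" and \<tau>: "\<tau>1 \<ge> 0" "\<tau>2 \<ge> 0"
    and x: "continuous_on S x" and S: "\<And>t r. t \<in> S' \<Longrightarrow> - (\<tau>1 + \<tau>2) \<le> r - t \<Longrightarrow> r \<le> t \<Longrightarrow> r \<in> S"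
  shows "continuous_on S' (rhs_along F \<tau>1 \<tau>2 x)"
proof -
  have "continuous_on S' (\<lambda>s. (x s, x (s - \<tau>1), x (s - \<tau>1 - \<tau>2)))"
    by (intro continuous_intros continuous_on_compose2[OF x]) (use \<tau> in \<open>auto intro!: S\<close>)
  from continuous_on_compose2[OF F this] show ?thesis
    by (simp add: rhs_along_def[abs_def])
qed

text \<open>
  The equation says that the fractional integral of order \<open>1 - \<alpha>\<close> of \<open>x - x 0\<close> is a primitive of the
  right-hand side, so Abel inversion recovers \<open>x - x 0\<close>.
\<close>
lemma solution_imp_volterra:
  assumes sol: "is_solution \<alpha> F \<tau>1 \<tau>2 \<phi> T x" and \<alpha>: "0 < \<alpha>" "\<alpha> \<le> 1"
    and F: "continuous_on UNIV (\<lambda>(u, v, w). F u v w)" and \<tau>: "\<tau>1 \<ge> 0" "\<tau>2 \<ge> 0"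
    and t: "0 \<le> t" "ereal t < T"
  shows "x t = x 0 + conv (frac_kernel \<alpha>) (causal_part (rhs_along F \<tau>1 \<tau>2 x)) t"
proof (cases "t = 0")
  case True
  then show ?thesis by (simp add: conv_0 frac_kernel_nonpos_eq_0 causal_part_neg)
next
  case False
  with t have t0: "0 < t" by simp
  define p where "p = rhs_along F \<tau>1 \<tau>2 x"
  obtain T' where T': "t < T'" "ereal T' < T" using ereal_dense2[OF t(2)] by auto
  have le: "ereal s < T" if "s \<le> T'" for s using T' that by (meson ereal_less_eq(3) order_le_less_trans)
  have xc: "continuous_on {t. - (\<tau>1 + \<tau>2) \<le> t \<and> ereal t < T} x" using sol by (simp add: is_solution_def)
  have xc': "continuous_on {0..T'} x" by (rule continuous_on_subset[OF xc]) (use \<tau> le in auto)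
  have pc: "continuous_on {0..T'} p" unfolding p_def
    by (rule continuous_on_rhs_along[OF F \<tau> xc]) (use \<tau> le in auto)
  have D: "has_caputo_derivative \<alpha> x (p s) s" if "0 < s" "s \<le> T'" for s
    using sol that le[of s] by (simp add: is_solution_def p_def rhs_along_def)
  \<comment> \<open>The solution may stop at \<open>T\<close>, so everything is frozen at a time \<open>T'\<close> strictly between \<open>t\<close> and
    \<open>T\<close>; the room between \<open>t\<close> and \<open>T'\<close> is needed to differentiate at \<open>t\<close>.\<close>
  define pf where "pf = causal_part (\<lambda>s. p (min s T'))"
  define v where "v = causal_part (\<lambda>s. x (min s T') - x 0)"
  have pfb: "causal_bounded pf" "continuous_on {0..} pf" unfolding pf_def
    using T' t by (intro causal_bounded_causal_part continuous_on_causal_part continuous_on_freeze pc; simp)+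
  have vb: "causal_bounded v" "continuous_on {0..} v" unfolding v_def
    using T' t by (intro causal_bounded_causal_part continuous_on_causal_part continuous_intros continuous_on_freeze xc'; simp)+
  have L: "causal_L1 (frac_kernel \<alpha>)" using \<alpha> by (auto intro: causal_L1_frac_kernel)
  have pf_int: "integral {0..s} p = conv (frac_kernel 1) pf s" if "0 \<le> s" "s \<le> T'" for s
    unfolding conv_frac_kernel_1[OF pfb(1) that(1)]
    by (rule Henstock_Kurzweil_Integration.integral_cong) (use that in \<open>auto simp: pf_def causal_part_def\<close>)
  have "x t - x 0 = conv (frac_kernel \<alpha>) pf t"
  proof (cases "\<alpha> = 1")
    case True
    have "(p has_integral (x t - x 0)) {0..t}"
    proof (rule fundamental_theorem_of_calculus_interior)
      show "continuous_on {0..t} x" by (rule continuous_on_subset[OF xc']) (use T' in auto)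
      show "(x has_vector_derivative p s) (at s)" if "s \<in> {0<..<t}" for s
        using D[of s] that T' True by (simp add: has_caputo_derivative_def has_real_derivative_iff_has_vector_derivative)
    qed (use t in auto)
    then have "x t - x 0 = integral {0..t} p" by (simp add: integral_unique)
    then show ?thesis using pf_int[of t] True t T' by simp
  next
    case False
    then have \<alpha>1: "\<alpha> < 1" using \<alpha> by simp
    define J where "J = RL_integral (1 - \<alpha>) (\<lambda>s. x s - x 0)"
    have L': "causal_L1 (frac_kernel (1 - \<alpha>))" using \<alpha>1 by (auto intro: causal_L1_frac_kernel)
    have J: "J s = conv (frac_kernel (1 - \<alpha>)) v s" if "0 \<le> s" "s \<le> T'" for s
      unfolding J_def RL_integral_eq_conv
      by (rule conv_causal_cong) (use that in \<open>auto simp: v_def causal_part_def frac_kernel_def\<close>)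
    have "conv (frac_kernel (1 - \<alpha>)) v s = conv (frac_kernel 1) pf s" if s: "0 \<le> s" "s \<le> T'" for s
    proof -
      have "(p has_integral (J s - J 0)) {0..s}"
      proof (rule fundamental_theorem_of_calculus_interior)
        have "continuous_on {0..s} (conv (frac_kernel (1 - \<alpha>)) v)"
          by (rule continuous_on_subset[OF conv_continuous[OF L' vb]]) auto
        then show "continuous_on {0..s} J" 
          by (subst continuous_on_cong[OF refl J]) (use s in auto)
        show "(J has_vector_derivative p r) (at r)" if "r \<in> {0<..<s}" for r
          using D[of r] that s False 
          by (simp add: has_caputo_derivative_def has_real_derivative_iff_has_vector_derivative J_def)
      qed (use s in auto)
      moreover have "J 0 = 0" using s J[of 0] 
        by (simp add: conv_0 frac_kernel_nonpos_eq_0 v_def causal_part_neg)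
      ultimately have "J s = integral {0..s} p" by (simp add: integral_unique)
      then show ?thesis using J[OF s] pf_int[OF s] by simp
    qed
    from abel_inversion[OF \<alpha>(1) \<alpha>1 vb pfb this t0 T'(1)]
    have "v t = conv (frac_kernel \<alpha>) pf t" by simp
    then show ?thesis using t T' by (simp add: v_def causal_part_def)
  qed
  also have "\<dots> = conv (frac_kernel \<alpha>) (causal_part p) t"
    by (rule conv_causal_cong) (use T' in \<open>auto simp: pf_def causal_part_def frac_kernel_def\<close>)
  finally show ?thesis by (simp add: p_def)
qed

lemma volterra_imp_solution:
  assumes \<alpha>: "0 < \<alpha>" "\<alpha> \<le> 1"
    and F: "continuous_on UNIV (\<lambda>(u, v, w). F u v w)" and \<tau>: "\<tau>1 \<ge> 0" "\<tau>2 \<ge> 0"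
    and x: "continuous_on {- (\<tau>1 + \<tau>2)..} x" and hist: "\<And>t. t \<in> {- (\<tau>1 + \<tau>2)..0} \<Longrightarrow> x t = \<phi> t"
    and eq: "\<And>t. t \<ge> 0 \<Longrightarrow> x t = x 0 + conv (frac_kernel \<alpha>) (causal_part (rhs_along F \<tau>1 \<tau>2 x)) t"
  shows "is_solution \<alpha> F \<tau>1 \<tau>2 \<phi> \<infinity> x"
proof -
  define p where "p = causal_part (rhs_along F \<tau>1 \<tau>2 x)"
  have pc: "continuous_on {0..} (rhs_along F \<tau>1 \<tau>2 x)"
    by (rule continuous_on_rhs_along[OF F \<tau> x]) auto
  have pb: "causal_bounded p" "continuous_on {0..} p" unfolding p_def
    using pc by (auto intro: causal_bounded_causal_part continuous_on_causal_part)
  have "has_caputo_derivative \<alpha> x (p t) t" if t: "t > 0" for t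
  proof (cases "\<alpha> = 1")
    case True
    have "((\<lambda>t. x 0 + conv (frac_kernel 1) p t) has_real_derivative 0 + p t) (at t)"
      by (intro derivative_intros conv_frac_kernel_1_deriv pb t)
    then have "((\<lambda>t. x 0 + conv (frac_kernel 1) p t) has_real_derivative p t) (at t)" by simp
    then have "(x has_real_derivative p t) (at t)"
    proof (rule has_field_derivative_transform_within_open)
      show "open {0::real<..}" by simp
      show "x 0 + conv (frac_kernel 1) p s = x s" if "s \<in> {0<..}" for s
        using eq[of s, symmetric] that True by (simp add: p_def)
    qed (use t in auto)
    then show ?thesis using True by (simp add: has_caputo_derivative_def)
  next
    case False
    then have \<alpha>1: "\<alpha> < 1" using \<alpha> by simp
    have L: "causal_L1 (frac_kernel \<alpha>)" using \<alpha> by (auto intro: causal_L1_frac_kernel)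
    have "causal_part (\<lambda>s. x s - x 0) = conv (frac_kernel \<alpha>) p"
    proof
      fix s
      show "causal_part (\<lambda>s. x s - x 0) s = conv (frac_kernel \<alpha>) p s"
        using eq[of s, symmetric] conv_causal_bounded[OF L pb(1)]
        by (cases "s < 0") (auto simp: causal_part_def causal_bounded_def p_def[symmetric])
    qed
    then have "RL_integral (1 - \<alpha>) (\<lambda>s. x s - x 0) = conv (frac_kernel 1) p"
      by (intro ext) (simp add: RL_integral_eq_conv frac_kernel_abel(1)[OF \<alpha>(1) \<alpha>1 pb(1)])
    then show ?thesis using False conv_frac_kernel_1_deriv[OF pb t]
      by (simp add: has_caputo_derivative_def)
  qed
  then show ?thesis using x hist
    by (auto simp: is_solution_def p_def causal_part_def rhs_along_def atLeast_def)
qed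

section \<open>Global existence for Lipschitz right-hand sides\<close>

text \<open>
  Exponential weights are multiplicative under convolution, so a kernel acts on functions of growth
  \<open>exp (l s)\<close> with norm at most its Laplace transform \<open>A\<close> at \<open>l\<close>.
\<close>
lemma conv_exp_bound:
  assumes a: "causal_L1 a" "\<And>s. a s \<ge> 0" and A: "has_bochner_integral lborel (\<lambda>s. exp (- l * s) * a s) A"
    and b: "causal_bounded b" and le: "\<And>s. 0 \<le> s \<Longrightarrow> s \<le> t \<Longrightarrow> \<bar>b s\<bar> \<le> K * exp (l * s)"
    and K: "K \<ge> 0"
  shows "\<bar>conv a b t\<bar> \<le> K * exp (l * t) * A"
proof -
  have [measurable]: "a \<in> borel_measurable borel" "b \<in> borel_measurable borel"
    using a b by (auto simp: causal_L1_def causal_bounded_def)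
  have i: "integrable lborel (\<lambda>s. K * exp (l * t) * (exp (- l * s) * a s))"
    using A by (intro integrable_mult_right) (auto simp: has_bochner_integral_iff)
  have "\<bar>conv a b t\<bar> = \<bar>LINT s|lborel. b (t - s) * a s\<bar>"
    by (subst conv_commute) (simp add: conv_def)
  also have "\<dots> \<le> (LINT s|lborel. \<bar>b (t - s) * a s\<bar>)" by (rule integral_abs_bound)
  also have "\<dots> \<le> (LINT s|lborel. K * exp (l * t) * (exp (- l * s) * a s))"
  proof (rule integral_mono_AE[OF _ i])
    have le': "\<bar>b (t - s) * a s\<bar> \<le> K * exp (l * t) * (exp (- l * s) * a s)" for s
    proof -
      consider "s < 0" | "s > t" | "0 \<le> s" "s \<le> t" by linarith
      then show ?thesis
      proof cases
        case 3
        have "\<bar>b (t - s) * a s\<bar> \<le> K * exp (l * (t - s)) * a s"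
          using le[of "t - s"] 3 a(2)[of s] by (auto simp: abs_mult intro!: mult_right_mono)
        then show ?thesis by (simp add: right_diff_distrib exp_diff exp_minus field_simps)
      qed (use a b K in \<open>auto simp: causal_L1_def causal_bounded_def\<close>)
    qed
    then show "AE s in lborel. \<bar>b (t - s) * a s\<bar> \<le> K * exp (l * t) * (exp (- l * s) * a s)" by simp
    show "integrable lborel (\<lambda>s. \<bar>b (t - s) * a s\<bar>)"
      by (rule Bochner_Integration.integrable_bound[OF i])
         (simp_all only: real_norm_def abs_abs order_trans[OF le' abs_ge_self] AE_I2, measurable)
  qed
  also have "\<dots> = K * exp (l * t) * A"
    using A by (subst integral_mult_right_zero) (auto simp: has_bochner_integral_iff)
  finally show ?thesis .
qed

text \<open>
  The Volterra operator is a contraction for the norm \<open>sup (exp (- l t) \<bar>v t\<bar>)\<close> when \<open>l\<close> is large,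
  because the Laplace transform of the kernel at \<open>l\<close> is \<open>l powr (- \<alpha>)\<close>. This weight yields a solution on
  the whole half-line at once, without continuation.
\<close>
theorem lipschitz_solution_exists:
  assumes \<alpha>: "0 < \<alpha>" "\<alpha> \<le> 1" and \<tau>: "\<tau>1 \<ge> 0" "\<tau>2 \<ge> 0"
    and F: "continuous_on UNIV (\<lambda>(u, v, w). F u v w)"
    and L: "L > 0" "\<And>u v w u' v' w'. \<bar>F u v w - F u' v' w'\<bar> \<le> L * (\<bar>u - u'\<bar> + \<bar>v - v'\<bar> + \<bar>w - w'\<bar>)"
    and \<phi>: "continuous_on {- (\<tau>1 + \<tau>2)..0} \<phi>"
  shows "\<exists>x. is_solution \<alpha> F \<tau>1 \<tau>2 \<phi> \<infinity> x"
proof -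
  define B where "B = frac_kernel \<alpha>"
  have B: "causal_L1 B" "\<And>s. B s \<ge> 0" using \<alpha> by (auto simp: B_def causal_L1_frac_kernel frac_kernel_nonneg)
  \<comment> \<open>The right-hand side has three arguments, and each of them changes by at most twice the distance of the
    two functions \<open>y\<close>; so the factor is \<open>6 L l powr (- \<alpha>)\<close>, which this choice makes \<open>1 / 2\<close>.\<close>
  define l where "l = (12 * L) powr (1 / \<alpha>)"
  have l: "l > 0" using L by (simp add: l_def)
  have "l powr (- \<alpha>) = 1 / (12 * L)" using L \<alpha> by (simp add: l_def powr_powr powr_minus divide_simps)
  then have lap: "has_bochner_integral lborel (\<lambda>s. exp (- l * s) * B s) (1 / (12 * L))"
    using frac_kernel_laplace_real[OF \<alpha>(1) l] by (simp add: B_def)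
  define \<psi> where "\<psi> = (\<lambda>s. \<phi> (max (- (\<tau>1 + \<tau>2)) (min s 0)))"
  have \<psi>c: "continuous_on UNIV \<psi>" unfolding \<psi>_def
    by (rule continuous_on_compose2[OF \<phi>]) (use \<tau> in \<open>auto intro!: continuous_intros\<close>)
  have "compact (\<phi> ` {- (\<tau>1 + \<tau>2)..0})" by (intro compact_continuous_image \<phi>) auto
  then obtain M where M0: "\<And>s. s \<in> {- (\<tau>1 + \<tau>2)..0} \<Longrightarrow> norm (\<phi> s) \<le> M"
    by (meson compact_imp_bounded bounded_iff imageI)
  have M: "\<bar>\<psi> s\<bar> \<le> M" for s using M0[of "max (- (\<tau>1 + \<tau>2)) (min s 0)"] \<tau> by (auto simp: \<psi>_def)
  have \<psi>0: "\<psi> 0 = \<phi> 0" using \<tau> by (simp add: \<psi>_def)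
  \<comment> \<open>The fixed point is sought for \<open>y t = exp (- l t) (x t - x 0)\<close>. Subtracting \<open>y 0\<close> keeps the
    function \<open>X y\<close> continuous at 0 for every \<open>y\<close>, so that the operator acts on all bounded continuous functions;
    a fixed point has \<open>y 0 = 0\<close>.\<close>
  define X where "X = (\<lambda>(y :: real \<Rightarrow>\<^sub>C real) s. if s \<le> 0 then \<psi> s else \<phi> 0 + exp (l * s) * (apply_bcontfun y s - apply_bcontfun y 0))"
  have Xc: "continuous_on UNIV (X y)" for y
  proof -
    have "continuous_on ({..0} \<union> {0..}) (X y)" unfolding X_def
      by (rule continuous_on_If) (auto intro!: continuous_intros continuous_on_subset[OF \<psi>c] simp: \<psi>0)
    moreover have "{..0} \<union> {0::real..} = UNIV" by auto
    ultimately show ?thesis by simp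
  qed
  have Xd: "\<bar>X y r - X y' r\<bar> \<le> 2 * dist y y' * exp (l * s)" if "r \<le> s" "0 \<le> s" for y y' r s
  proof (cases "r \<le> 0")
    case False
    have "X y r - X y' r = exp (l * r) * ((y r - y' r) - (y 0 - y' 0))"
      using False by (simp add: X_def algebra_simps)
    then have "\<bar>X y r - X y' r\<bar> = exp (l * r) * \<bar>(y r - y' r) - (y 0 - y' 0)\<bar>"
      by (simp only: abs_mult abs_exp_cancel)
    also have "\<dots> \<le> exp (l * s) * (2 * dist y y')"
      using that l dist_bounded[of y r y'] dist_bounded[of y 0 y']
      by (intro mult_mono) (auto simp: dist_real_def)
    finally show ?thesis by (simp add: mult_ac)
  qed (simp add: X_def)
  define c where "c = (\<lambda>y. causal_part (rhs_along F \<tau>1 \<tau>2 (X y)))"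
  have cc: "continuous_on {0..} (rhs_along F \<tau>1 \<tau>2 (X y))" for y
    by (rule continuous_on_rhs_along[OF F \<tau> Xc]) simp
  have cb: "causal_bounded (c y)" "continuous_on {0..} (c y)" for y
    unfolding c_def using cc by (auto intro: causal_bounded_causal_part continuous_on_causal_part)
  have cd: "\<bar>c y s - c y' s\<bar> \<le> 6 * L * dist y y' * exp (l * s)" if "0 \<le> s" for y y' s
  proof -
    have "\<bar>c y s - c y' s\<bar> \<le> L * (\<bar>X y s - X y' s\<bar> + \<bar>X y (s - \<tau>1) - X y' (s - \<tau>1)\<bar>
        + \<bar>X y (s - \<tau>1 - \<tau>2) - X y' (s - \<tau>1 - \<tau>2)\<bar>)"
      using that L(2) by (simp add: c_def causal_part_def rhs_along_def)
    also have "\<dots> \<le> L * (2 * dist y y' * exp (l * s) + 2 * dist y y' * exp (l * s) + 2 * dist y y' * exp (l * s))"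
      using that \<tau> L(1) by (intro mult_left_mono add_mono Xd) auto
    finally show ?thesis by (simp add: algebra_simps)
  qed
  define T where "T = (\<lambda>y t. exp (- l * t) * conv B (c y) t)"
  have Bz: "conv B (c y) t = 0" if "t \<le> 0" for t y
    using that conv_0[of B "c y"] conv_neg[of B "c y" t]
    by (cases "t = 0") (auto simp: B_def frac_kernel_nonpos_eq_0 c_def causal_part_def)
  have Tc: "continuous_on UNIV (T y)" for y
  proof -
    have "continuous_on ({..0} \<union> {0..}) (\<lambda>t. if t \<le> 0 then 0 else conv B (c y) t)"
      by (rule continuous_on_If) (auto intro!: conv_continuous B cb simp: Bz)
    moreover have "{..0} \<union> {0::real..} = UNIV" by auto
    moreover have "(\<lambda>t. if t \<le> 0 then 0 else conv B (c y) t) = conv B (c y)" using Bz by auto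
    ultimately have "continuous_on UNIV (conv B (c y))" by (simp only:)
    then show ?thesis unfolding T_def by (intro continuous_intros)
  qed
  have Tbound: "\<bar>exp (- l * t) * conv B b t\<bar> \<le> K / (12 * L)"
    if "causal_bounded b" "\<And>s. 0 \<le> s \<Longrightarrow> \<bar>b s\<bar> \<le> K * exp (l * s)" "K \<ge> 0" for b K t
  proof -
    have "\<bar>conv B b t\<bar> \<le> K * exp (l * t) * (1 / (12 * L))"
      by (rule conv_exp_bound[OF B lap that(1) _ that(3)]) (use that in auto)
    then have "exp (- l * t) * \<bar>conv B b t\<bar> \<le> exp (- l * t) * (K * exp (l * t) * (1 / (12 * L)))"
      by (intro mult_left_mono) auto
    also have "exp (- l * t) * (K * exp (l * t) * (1 / (12 * L))) = (exp (- l * t) * exp (l * t)) * (K / (12 * L))"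
      by (simp only: mult_ac times_divide_eq_left times_divide_eq_right mult_1_left mult_1_right)
    also have "exp (- l * t) * exp (l * t) = 1" by (simp add: exp_minus)
    finally show ?thesis by (simp add: abs_mult)
  qed
  have Tin: "T y \<in> bcontfun" for y
  proof (rule bcontfun_normI[OF Tc])
    fix t
    define K where "K = 6 * L * dist y 0 + \<bar>F 0 0 0\<bar> + L * (3 * (M + \<bar>\<phi> 0\<bar>))"
    have M0': "M \<ge> 0" using M[of 0] by linarith
    have "\<bar>c y s\<bar> \<le> K * exp (l * s)" if s: "0 \<le> s" for s
    proof -
      have X0: "\<bar>X 0 r\<bar> \<le> M + \<bar>\<phi> 0\<bar>" for r using M[of r] M0' by (auto simp: X_def)
      have "\<bar>c 0 s\<bar> \<le> \<bar>F 0 0 0\<bar> + \<bar>c 0 s - F 0 0 0\<bar>" by linarith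
      also have "\<bar>c 0 s - F 0 0 0\<bar> \<le> L * (\<bar>X 0 s - 0\<bar> + \<bar>X 0 (s - \<tau>1) - 0\<bar> + \<bar>X 0 (s - \<tau>1 - \<tau>2) - 0\<bar>)"
        using s L(2)[of "X 0 s" "X 0 (s - \<tau>1)" "X 0 (s - \<tau>1 - \<tau>2)" 0 0 0]
        by (simp add: c_def causal_part_def rhs_along_def)
      also have "\<dots> \<le> L * ((M + \<bar>\<phi> 0\<bar>) + (M + \<bar>\<phi> 0\<bar>) + (M + \<bar>\<phi> 0\<bar>))"
        using L(1) X0 by (intro mult_left_mono add_mono) auto
      finally have "\<bar>c 0 s\<bar> \<le> \<bar>F 0 0 0\<bar> + L * (3 * (M + \<bar>\<phi> 0\<bar>))" by simp
      also have "\<dots> \<le> (\<bar>F 0 0 0\<bar> + L * (3 * (M + \<bar>\<phi> 0\<bar>))) * exp (l * s)"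
      proof -
        have "0 \<le> \<bar>F 0 0 0\<bar> + L * (3 * (M + \<bar>\<phi> 0\<bar>))" using L(1) M0' by simp
        moreover have "1 \<le> exp (l * s)" using l s by simp
        ultimately show ?thesis by (metis mult_left_mono mult.right_neutral)
      qed
      finally show ?thesis using cd[OF s, of y 0] by (simp add: K_def algebra_simps)
    qed
    then show "norm (T y t) \<le> K / (12 * L)" unfolding T_def real_norm_def
      by (intro Tbound cb) (use L M0' in \<open>auto simp: K_def\<close>)
  qed
  define TT where "TT = (\<lambda>y. Bcontfun (T y))"
  have TT: "apply_bcontfun (TT y) = T y" for y using Tin by (simp add: TT_def Bcontfun_inverse)
  have "\<exists>!y. TT y = y"
  proof (rule banach_fix_type)
    show "\<forall>y y'. dist (TT y) (TT y') \<le> 1 / 2 * dist y y'"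
    proof (intro allI, rule dist_bound)
      fix y y' t
      have d: "conv B (\<lambda>s. c y s + (-1) * c y' s) t = conv B (c y) t + (-1) * conv B (c y') t"
        using conv_add[OF B(1) cb(1)[of y] causal_bounded_scale[OF cb(1), of "-1"]] by (simp only: conv_scale)
      have "T y t - T y' t = exp (- l * t) * conv B (\<lambda>s. c y s + (-1) * c y' s) t"
        unfolding d by (simp add: T_def right_diff_distrib)
      moreover have "\<bar>exp (- l * t) * conv B (\<lambda>s. c y s + (-1) * c y' s) t\<bar> \<le> (6 * L * dist y y') / (12 * L)"
      proof (rule Tbound)
        show "causal_bounded (\<lambda>s. c y s + (-1) * c y' s)"
          by (intro causal_bounded_add causal_bounded_scale cb)
        show "\<bar>c y s + (-1) * c y' s\<bar> \<le> 6 * L * dist y y' * exp (l * s)" if "0 \<le> s" for s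
          using cd[OF that, of y y'] by simp
      qed (use L in simp)
      ultimately show "dist (TT y t) (TT y' t) \<le> 1 / 2 * dist y y'"
        using L(1) by (simp add: TT dist_real_def)
    qed
  qed auto
  then obtain y where "TT y = y" by auto
  then have y: "apply_bcontfun y t = T y t" for t using TT[of y] by simp
  have y0: "apply_bcontfun y 0 = 0" by (simp add: y T_def Bz)
  have "is_solution \<alpha> F \<tau>1 \<tau>2 \<phi> \<infinity> (X y)"
  proof (rule volterra_imp_solution[OF \<alpha> F \<tau>])
    show "X y t = \<phi> t" if "t \<in> {- (\<tau>1 + \<tau>2)..0}" for t
      using that \<tau> by (auto simp: X_def \<psi>_def max_def min_def)
    show "X y t = X y 0 + conv (frac_kernel \<alpha>) (causal_part (rhs_along F \<tau>1 \<tau>2 (X y))) t" if "t \<ge> 0" for t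
    proof (cases "t = 0")
      case True then show ?thesis using Bz[of 0 y] by (simp add: B_def c_def)
    next
      case False
      then have "X y t = \<phi> 0 + exp (l * t) * T y t" using that y0 by (simp add: X_def y[symmetric])
      also have "exp (l * t) * T y t = conv B (c y) t" by (simp add: T_def exp_minus)
      finally have "X y t = \<phi> 0 + conv B (c y) t" .
      moreover have "X y 0 = \<phi> 0" by (simp add: X_def \<psi>0)
      ultimately show ?thesis by (simp add: B_def c_def)
    qed
  qed (use Xc in \<open>auto intro: continuous_on_subset\<close>)
  then show ?thesis by (intro exI[of _ "X y"])
qed

section \<open>The resolvent kernel and its positivity\<close>

lemma first_time_le:
  fixes f :: "real \<Rightarrow> real"
  assumes cont: "continuous_on {a..b} f" and ab: "a \<le> b" and fa: "f a > c" and fb: "f b \<le> c"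
  obtains t where "a < t" "t \<le> b" "f t = c" "\<And>s. a \<le> s \<Longrightarrow> s < t \<Longrightarrow> f s > c"
proof -
  define A where "A = {a..b} \<inter> f -` {..c}"
  have "closed A" unfolding A_def by (rule continuous_closed_preimage[OF cont]) auto
  then have cA: "compact A" unfolding A_def by (metis compact_Icc compact_Int_closed Int_absorb inf_assoc)
  have "b \<in> A" using assms by (auto simp: A_def)
  then obtain t where t: "t \<in> A" "\<And>s. s \<in> A \<Longrightarrow> t \<le> s"
    using continuous_attains_inf[OF cA, of "\<lambda>x. x"] by (auto simp: continuous_on_id)
  have gt: "f s > c" if "a \<le> s" "s < t" for s
    using t(2)[of s] that t(1) by (cases "f s \<le> c") (auto simp: A_def)
  have at: "a < t" using t(1) fa by (cases "a = t") (auto simp: A_def)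
  have "f t = c"
  proof (rule ccontr)
    assume "f t \<noteq> c"
    then have "f t < c" using t(1) by (auto simp: A_def)
    moreover have "continuous_on {a..t} f" using cont t(1) by (auto simp: A_def intro: continuous_on_subset)
    ultimately obtain s where "a \<le> s" "s \<le> t" "f s = c"
      using IVT2'[of f t c a] fa at by auto
    with \<open>f t < c\<close> gt[of s] show False by (cases "s = t") auto
  qed
  then show ?thesis using that[OF at _ _ gt] t(1) by (auto simp: A_def)
qed

text \<open>
  For \<open>\<beta> \<ge> 1\<close> the kernel is increasing, so its value at \<open>x\<close> is controlled by the integral over
  \<open>[x, x + 1]\<close>, which is at most its Laplace transform at 1. Read backwards this is the lower bound
  \<open>\<Gamma>(\<beta>) \<ge> x powr (\<beta> - 1) exp (- x - 1)\<close> for all \<open>x\<close>, which is what makes the Mittag-Leffler series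
  converge everywhere.
\<close>
lemma frac_kernel_le_exp:
  assumes "\<beta> \<ge> 1" "x > 0" shows "frac_kernel \<beta> x \<le> exp (x + 1)"
proof -
  have lap: "has_bochner_integral lborel (\<lambda>t. exp (- 1 * t) * frac_kernel \<beta> t) 1"
    using frac_kernel_laplace_real[of \<beta> 1] assms by simp
  have G: "Gamma \<beta> > 0" using assms by (simp add: Gamma_real_pos)
  have "exp (- x - 1) * frac_kernel \<beta> x = (LINT s|lborel. indicator {x..x+1} s * (exp (- x - 1) * frac_kernel \<beta> x))"
    by simp
  also have "\<dots> \<le> (LINT s|lborel. exp (- 1 * s) * frac_kernel \<beta> s)"
  proof (rule integral_mono)
    show "integrable lborel (\<lambda>s. indicator {x..x+1} s * (exp (- x - 1) * frac_kernel \<beta> x))"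
      by (intro integrable_mult_left) (auto intro!: integrable_real_indicator simp: emeasure_lborel_Icc_eq)
    show "integrable lborel (\<lambda>s. exp (- 1 * s) * frac_kernel \<beta> s)" using lap by (simp add: has_bochner_integral_iff)
    fix s
    show "indicator {x..x+1} s * (exp (- x - 1) * frac_kernel \<beta> x) \<le> exp (- 1 * s) * frac_kernel \<beta> s"
    proof (cases "s \<in> {x..x+1}")
      case True
      have "frac_kernel \<beta> x \<le> frac_kernel \<beta> s" using True assms G
        by (auto simp: frac_kernel_def intro!: divide_right_mono powr_mono2)
      then show ?thesis using True assms frac_kernel_nonneg[of \<beta> x] by (auto intro!: mult_mono)
    qed (use assms frac_kernel_nonneg[of \<beta> s] in auto)
  qed
  also have "\<dots> = 1" using lap by (simp add: has_bochner_integral_iff)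
  finally show ?thesis by (simp add: exp_diff exp_minus exp_add field_simps)
qed

text \<open>
  The Mittag-Leffler function with both parameters equal to \<open>\<alpha>\<close>.
\<close>
definition mittag_leffler :: "real \<Rightarrow> real \<Rightarrow> real" where
  "mittag_leffler \<alpha> z = (\<Sum>n. inverse (Gamma (\<alpha> * real (n + 1))) * z ^ n)"

lemma mittag_leffler_summable_abs:
  assumes \<alpha>: "\<alpha> > 0"
  shows "summable (\<lambda>n. norm (inverse (Gamma (\<alpha> * real (n + 1))) * z ^ n))"
proof -
  \<comment> \<open>With this \<open>x\<close> the bound above compares the series with a geometric series of ratio \<open>1 / 2\<close>.\<close>
  define x where "x = (2 * \<bar>z\<bar> + 1) powr (1 / \<alpha>)"
  have x: "x > 0" "x powr \<alpha> = 2 * \<bar>z\<bar> + 1" using \<alpha> by (auto simp: x_def powr_powr)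
  define C where "C = exp (x + 1) * x powr (1 - \<alpha>)"
  obtain N where N: "real N \<ge> 1 / \<alpha>" using real_arch_simple by blast
  show ?thesis
  proof (rule summable_comparison_test'[where N=N])
    show "summable (\<lambda>n. C * (1/2) ^ n)" by (intro summable_mult summable_geometric) auto
    fix n assume "n \<ge> N"
    then have "1 / \<alpha> \<le> real (n + 1)" using N by linarith
    then have b: "\<alpha> * real (n + 1) \<ge> 1" using \<alpha> by (simp add: field_simps)
    have G: "Gamma (\<alpha> * real (n + 1)) > 0" using b by (intro Gamma_real_pos) linarith
    have e: "x powr (\<alpha> * real (n + 1) - 1) = (x powr \<alpha>) ^ n / x powr (1 - \<alpha>)"
    proof -
      have "(x powr \<alpha>) ^ n / x powr (1 - \<alpha>) = x powr (\<alpha> * real n - (1 - \<alpha>))"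
        using x(1) by (simp add: powr_diff powr_powr powr_realpow[symmetric])
      then show ?thesis by (simp add: algebra_simps)
    qed
    define g where "g = Gamma (\<alpha> * real (n + 1))"
    define P where "P = x powr (1 - \<alpha>)"
    have gP: "g > 0" "P > 0" using G x by (auto simp: g_def P_def)
    have "(2 * \<bar>z\<bar>) ^ n / P / g \<le> (x powr \<alpha>) ^ n / P / g"
      using gP x by (intro divide_right_mono power_mono) auto
    also have "\<dots> = frac_kernel (\<alpha> * real (n + 1)) x"
      using x by (simp only: frac_kernel_def e if_True g_def P_def)
    also have "\<dots> \<le> exp (x + 1)" by (rule frac_kernel_le_exp[OF b x(1)])
    finally have "(2 * \<bar>z\<bar>) ^ n / g \<le> exp (x + 1) * P" using gP by (simp add: field_simps)
    then have "2 ^ n * \<bar>z\<bar> ^ n / g \<le> C" by (simp only: C_def P_def power_mult_distrib)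
    then have "\<bar>z\<bar> ^ n / g \<le> C * (1 / 2) ^ n" using gP by (simp add: power_one_over field_simps)
    moreover have "norm (norm (inverse (Gamma (\<alpha> * real (n + 1))) * z ^ n)) = \<bar>z\<bar> ^ n / g"
      using gP unfolding g_def[symmetric] by (simp add: abs_mult power_abs divide_inverse)
    ultimately show "norm (norm (inverse (Gamma (\<alpha> * real (n + 1))) * z ^ n)) \<le> C * (1/2) ^ n" by simp
  qed
qed

lemma isCont_mittag_leffler: "\<alpha> > 0 \<Longrightarrow> isCont (mittag_leffler \<alpha>) z"
  unfolding mittag_leffler_def[abs_def]
  by (rule isCont_powser_converges_everywhere, rule summable_norm_cancel, rule mittag_leffler_summable_abs)

lemma mittag_leffler_0: "mittag_leffler \<alpha> 0 = 1 / Gamma \<alpha>"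
  unfolding mittag_leffler_def by (subst powser_zero) (simp add: divide_inverse)

text \<open>
  The Neumann series of \<open>e + \<gamma> B * e = B\<close> with \<open>B = frac_kernel \<alpha>\<close>, summed: the iterated convolutions
  of \<open>B\<close> are the kernels of order \<open>n \<alpha>\<close>. For \<open>\<alpha> = 1\<close> and \<open>t > 0\<close> it is
  \<open>exp (- \<gamma> t)\<close>.
\<close>
definition resolvent :: "real \<Rightarrow> real \<Rightarrow> real \<Rightarrow> real" where
  "resolvent \<alpha> \<gamma> t = (if t > 0 then t powr (\<alpha> - 1) * mittag_leffler \<alpha> (- \<gamma> * t powr \<alpha>) else 0)"

lemma resolvent_term:
  assumes "t > 0"
  shows "c ^ n * frac_kernel (\<alpha> * real (n + 1)) t
     = t powr (\<alpha> - 1) * (inverse (Gamma (\<alpha> * real (n + 1))) * (c * t powr \<alpha>) ^ n)"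
proof -
  have "t powr (\<alpha> * real (n + 1) - 1) = t powr (\<alpha> - 1) * (t powr \<alpha>) ^ n"
    using assms by (simp add: powr_realpow[symmetric] powr_powr powr_add[symmetric] algebra_simps)
  then show ?thesis using assms by (simp add: frac_kernel_def power_mult_distrib divide_inverse)
qed

lemma resolvent_sums:
  assumes \<alpha>: "\<alpha> > 0"
  shows "summable (\<lambda>n. norm (c ^ n * frac_kernel (\<alpha> * real (n + 1)) t))"
    and "(\<lambda>n. (- \<gamma>) ^ n * frac_kernel (\<alpha> * real (n + 1)) t) sums resolvent \<alpha> \<gamma> t"
proof -
  show s: "summable (\<lambda>n. norm (c ^ n * frac_kernel (\<alpha> * real (n + 1)) t))" for c
  proof (cases "t > 0")
    case True
    show ?thesis unfolding resolvent_term[OF True]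
      using summable_mult[OF mittag_leffler_summable_abs[OF \<alpha>, of "c * t powr \<alpha>"], of "t powr (\<alpha> - 1)"]
      by (simp add: norm_mult abs_mult) 
  qed (simp add: frac_kernel_def)
  show "(\<lambda>n. (- \<gamma>) ^ n * frac_kernel (\<alpha> * real (n + 1)) t) sums resolvent \<alpha> \<gamma> t"
  proof (cases "t > 0")
    case True
    show ?thesis unfolding resolvent_term[OF True] resolvent_def mittag_leffler_def if_P[OF True]
      using summable_norm_cancel[OF mittag_leffler_summable_abs[OF \<alpha>]]
      by (intro sums_mult summable_sums)
  qed (simp add: frac_kernel_def resolvent_def)
qed

lemma resolvent_continuous: "\<alpha> > 0 \<Longrightarrow> continuous_on {0<..} (resolvent \<alpha> \<gamma>)"
proof -
  assume \<alpha>: "\<alpha> > 0"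
  have "continuous_on {0<..} (\<lambda>t. t powr (\<alpha> - 1) * mittag_leffler \<alpha> (- \<gamma> * t powr \<alpha>))"
    by (intro continuous_intros continuous_on_compose2[OF continuous_at_imp_continuous_on[of UNIV "mittag_leffler \<alpha>"]])
       (auto simp: isCont_mittag_leffler \<alpha>)
  then show ?thesis by (subst continuous_on_cong[OF refl]) (auto simp: resolvent_def)
qed

lemma causal_L1_resolvent:
  assumes \<alpha>: "\<alpha> > 0" shows "causal_L1 (resolvent \<alpha> \<gamma>)"
  unfolding causal_L1_def
proof (intro conjI allI impI)
  have [measurable]: "mittag_leffler \<alpha> \<in> borel_measurable borel"
    by (intro borel_measurable_continuous_onI continuous_at_imp_continuous_on) (auto simp: isCont_mittag_leffler \<alpha>)
  show m[measurable]: "resolvent \<alpha> \<gamma> \<in> borel_measurable borel" unfolding resolvent_def[abs_def] by measurable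
  fix T :: real
  define R where "R = \<bar>\<gamma>\<bar> * \<bar>T\<bar> powr \<alpha>"
  have "compact (mittag_leffler \<alpha> ` {- R..R})"
    by (intro compact_continuous_image continuous_at_imp_continuous_on) (auto simp: isCont_mittag_leffler \<alpha>)
  then obtain K where K: "\<And>z. z \<in> {-R..R} \<Longrightarrow> norm (mittag_leffler \<alpha> z) \<le> K"
    by (meson compact_imp_bounded bounded_iff imageI)
  have G: "Gamma \<alpha> > 0" using \<alpha> by (simp add: Gamma_real_pos)
  have "integrable lborel (\<lambda>s. (K * Gamma \<alpha>) * (indicator {..T} s * frac_kernel \<alpha> s))"
    using causal_L1_frac_kernel[OF \<alpha>] by (auto simp: causal_L1_def)
  then show "integrable lborel (\<lambda>s. indicator {..T} s * resolvent \<alpha> \<gamma> s)"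
  proof (rule Bochner_Integration.integrable_bound)
    show "AE s in lborel. norm (indicator {..T} s * resolvent \<alpha> \<gamma> s) \<le> norm ((K * Gamma \<alpha>) * (indicator {..T} s * frac_kernel \<alpha> s))"
    proof (rule AE_I2)
      fix s
      show "norm (indicator {..T} s * resolvent \<alpha> \<gamma> s) \<le> norm ((K * Gamma \<alpha>) * (indicator {..T} s * frac_kernel \<alpha> s))"
      proof (cases "0 < s \<and> s \<le> T")
        case True
        have "\<bar>\<gamma>\<bar> * s powr \<alpha> \<le> R" unfolding R_def using True \<alpha> by (intro mult_left_mono powr_mono2) auto
        moreover have "\<bar>- \<gamma> * s powr \<alpha>\<bar> = \<bar>\<gamma>\<bar> * s powr \<alpha>" by (simp add: abs_mult)
        ultimately have "- \<gamma> * s powr \<alpha> \<in> {-R..R}" unfolding atLeastAtMost_iff by linarith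
        from K[OF this] have "\<bar>resolvent \<alpha> \<gamma> s\<bar> \<le> s powr (\<alpha> - 1) * K" using True by (simp add: resolvent_def abs_mult)
        also have "\<dots> = (K * Gamma \<alpha>) * frac_kernel \<alpha> s" using True G by (simp add: frac_kernel_def)
        also have "\<dots> \<le> \<bar>\<dots>\<bar>" by simp
        finally show ?thesis using True by simp
      qed (auto simp: indicator_def resolvent_def frac_kernel_def)
    qed
  qed measurable
qed (simp add: resolvent_def)

text \<open>
  Convolution with \<open>frac_kernel \<alpha>\<close> shifts the series by one term. Integrability of a product of two
  kernels comes for free: their convolution is known to be nonzero, and an integral of a non-integrable
  function would be 0.
\<close>
lemma resolvent_equation:
  assumes \<alpha>: "\<alpha> > 0" and \<gamma>: "\<gamma> > 0"
  shows "integrable lborel (\<lambda>s. frac_kernel \<alpha> (t - s) * resolvent \<alpha> \<gamma> s)"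
    and "\<gamma> * conv (frac_kernel \<alpha>) (resolvent \<alpha> \<gamma>) t = frac_kernel \<alpha> t - resolvent \<alpha> \<gamma> t"
proof -
  have *: "integrable lborel (\<lambda>s. frac_kernel \<alpha> (t - s) * resolvent \<alpha> \<gamma> s) \<and>
    \<gamma> * conv (frac_kernel \<alpha>) (resolvent \<alpha> \<gamma>) t = frac_kernel \<alpha> t - resolvent \<alpha> \<gamma> t"
  proof (cases "t > 0")
    case False
    have z: "frac_kernel \<alpha> (t - s) * resolvent \<alpha> \<gamma> s = 0" for s
      using False by (cases "s > 0") (auto simp: frac_kernel_def resolvent_def)
    show ?thesis using False unfolding conv_def z by (simp add: frac_kernel_def resolvent_def)
  next
    case t: True
    define f where "f = (\<lambda>n s. frac_kernel \<alpha> (t - s) * ((- \<gamma>) ^ n * frac_kernel (\<alpha> * real (n + 1)) s))"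
    have cv: "conv (frac_kernel \<alpha>) (frac_kernel (\<alpha> * real (n + 1))) t = frac_kernel (\<alpha> * real (n + 2)) t" for n
    proof -
      have "\<alpha> + \<alpha> * real (n + 1) = \<alpha> * real (n + 2)" by (simp add: algebra_simps)
      then show ?thesis using conv_frac_kernel[of \<alpha> "\<alpha> * real (n + 1)" t] \<alpha> by simp
    qed
    have i0: "integrable lborel (\<lambda>s. frac_kernel \<alpha> (t - s) * frac_kernel (\<alpha> * real (n + 1)) s)" for n
    proof (rule ccontr)
      assume "\<not> ?thesis"
      then have "conv (frac_kernel \<alpha>) (frac_kernel (\<alpha> * real (n + 1))) t = 0"
        unfolding conv_def by (rule not_integrable_integral_eq)
      moreover have "frac_kernel (\<alpha> * real (n + 2)) t > 0" using t \<alpha> by (simp add: frac_kernel_def Gamma_real_pos)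
      ultimately show False unfolding cv by simp
    qed
    have f_eq: "f n = (\<lambda>s. (- \<gamma>) ^ n * (frac_kernel \<alpha> (t - s) * frac_kernel (\<alpha> * real (n + 1)) s))" for n
      by (simp only: f_def mult.left_commute)
    have fi: "integrable lborel (f n)" for n
      unfolding f_eq by (rule integrable_mult_right[OF i0])
    have fint: "integral\<^sup>L lborel (f n) = (- \<gamma>) ^ n * frac_kernel (\<alpha> * real (n + 2)) t" for n
      unfolding f_eq integral_mult_right_zero cv[unfolded conv_def] ..
    have fnint: "(LINT s|lborel. norm (f n s)) = \<gamma> ^ n * frac_kernel (\<alpha> * real (n + 2)) t" for n
    proof -
      have "norm (f n s) = \<gamma> ^ n * (frac_kernel \<alpha> (t - s) * frac_kernel (\<alpha> * real (n + 1)) s)" for s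
        unfolding f_eq norm_mult norm_power using \<alpha> \<gamma> by (simp add: abs_of_nonneg frac_kernel_nonneg del: of_nat_add)
      then show ?thesis by (simp only: integral_mult_right_zero cv[unfolded conv_def])
    qed
    have sm: "summable (\<lambda>n. LINT s|lborel. norm (f n s))"
    proof -
      have "summable (\<lambda>n. norm (\<gamma> ^ Suc n * frac_kernel (\<alpha> * real (Suc n + 1)) t))"
        using resolvent_sums(1)[OF \<alpha>, of \<gamma> t] by (subst summable_Suc_iff)
      then have "summable (\<lambda>n. (1 / \<gamma>) * norm (\<gamma> ^ Suc n * frac_kernel (\<alpha> * real (Suc n + 1)) t))"
        by (rule summable_mult)
      moreover have "(1 / \<gamma>) * norm (\<gamma> ^ Suc n * frac_kernel (\<alpha> * real (Suc n + 1)) t)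
          = \<gamma> ^ n * frac_kernel (\<alpha> * real (n + 2)) t" for n
        using \<gamma> \<alpha> frac_kernel_nonneg[of "\<alpha> * real (n + 2)" t] by (simp add: abs_mult)
      ultimately show ?thesis by (simp only: fnint)
    qed
    have ps: "AE s in lborel. summable (\<lambda>n. norm (f n s))"
      using summable_mult[OF resolvent_sums(1)[OF \<alpha>, of "- \<gamma>"]]
      by (intro AE_I2) (simp add: f_def abs_mult)
    have pt: "(\<Sum>n. f n s) = frac_kernel \<alpha> (t - s) * resolvent \<alpha> \<gamma> s" for s
      unfolding f_def by (rule sums_unique[symmetric], intro sums_mult resolvent_sums(2) \<alpha>)
    have I: "integrable lborel (\<lambda>s. frac_kernel \<alpha> (t - s) * resolvent \<alpha> \<gamma> s)"
      using integrable_suminf[of lborel f, OF fi ps sm] by (simp only: pt)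
    have "(\<lambda>n. integral\<^sup>L lborel (f n)) sums conv (frac_kernel \<alpha>) (resolvent \<alpha> \<gamma>) t"
      using sums_integral[of lborel f, OF fi ps sm] by (simp only: pt conv_def)
    then have "(\<lambda>n. - \<gamma> * ((- \<gamma>) ^ n * frac_kernel (\<alpha> * real (n + 2)) t)) sums (- \<gamma> * conv (frac_kernel \<alpha>) (resolvent \<alpha> \<gamma>) t)"
      unfolding fint by (rule sums_mult)
    moreover have "(\<lambda>n. (- \<gamma>) ^ Suc n * frac_kernel (\<alpha> * real (Suc n + 1)) t) sums (resolvent \<alpha> \<gamma> t - frac_kernel \<alpha> t)"
      using resolvent_sums(2)[OF \<alpha>, of \<gamma> t] by (subst sums_Suc_iff) simp
    ultimately have "- \<gamma> * conv (frac_kernel \<alpha>) (resolvent \<alpha> \<gamma>) t = resolvent \<alpha> \<gamma> t - frac_kernel \<alpha> t"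
      by (simp add: sums_unique2 mult.assoc)
    then show ?thesis using I by simp
  qed
  then show "integrable lborel (\<lambda>s. frac_kernel \<alpha> (t - s) * resolvent \<alpha> \<gamma> s)"
    "\<gamma> * conv (frac_kernel \<alpha>) (resolvent \<alpha> \<gamma>) t = frac_kernel \<alpha> t - resolvent \<alpha> \<gamma> t" by auto
qed

text \<open>
  Log-convexity of the kernel, in the form that compares two final times \<open>t < t'\<close>: the ratio of the values is
  largest at \<open>s = 0\<close>.
\<close>
lemma frac_kernel_ratio:
  assumes "0 < \<alpha>" "\<alpha> \<le> 1" "0 < s" "s < t" "t < t'"
  shows "frac_kernel \<alpha> (t' - s) \<le> (t / t') powr (1 - \<alpha>) * frac_kernel \<alpha> (t - s)"
proof -
  have "(t - s) / (t' - s) \<le> t / t'" using assms by (simp add: field_simps)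
  then have "((t - s) / (t' - s)) powr (1 - \<alpha>) \<le> (t / t') powr (1 - \<alpha>)"
    using assms by (intro powr_mono2) auto
  then have "((t - s) / (t' - s)) powr (1 - \<alpha>) * (t - s) powr (\<alpha> - 1) \<le> (t / t') powr (1 - \<alpha>) * (t - s) powr (\<alpha> - 1)"
    by (intro mult_right_mono) auto
  also have "((t - s) / (t' - s)) powr (1 - \<alpha>) * (t - s) powr (\<alpha> - 1) = (t' - s) powr (\<alpha> - 1)"
  proof -
    have "((t - s) / (t' - s)) powr (1 - \<alpha>) = (t - s) powr (1 - \<alpha>) / (t' - s) powr (1 - \<alpha>)"
      by (rule powr_divide)
    then have "((t - s) / (t' - s)) powr (1 - \<alpha>) * (t - s) powr (\<alpha> - 1)
        = ((t - s) powr (1 - \<alpha>) * (t - s) powr (\<alpha> - 1)) / (t' - s) powr (1 - \<alpha>)"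
      by (simp only: times_divide_eq_left)
    also have "(t - s) powr (1 - \<alpha>) * (t - s) powr (\<alpha> - 1) = 1"
      using assms by (simp add: powr_add[symmetric])
    also have "1 / (t' - s) powr (1 - \<alpha>) = (t' - s) powr (\<alpha> - 1)"
      using powr_minus_divide[of "t' - s" "1 - \<alpha>"] by (simp only: minus_diff_eq)
    finally show ?thesis .
  qed
  finally show ?thesis using assms Gamma_real_pos[of \<alpha>]
    by (simp add: frac_kernel_def divide_right_mono)
qed

text \<open>
  At a first zero \<open>t1\<close> the resolvent equation reads \<open>\<gamma> (B * e) t1 = B t1\<close>. Compare with an earlier time
  \<open>r\<close>, using \<open>frac_kernel_ratio\<close> on \<open>[0, r]\<close> where \<open>e\<close> is positive: the factor
  \<open>q = (r / t1) powr (1 - \<alpha>)\<close> satisfies \<open>q B r = B t1\<close> exactly, the kernel terms cancel, and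
  \<open>q e r\<close> is at most \<open>\<gamma>\<close> times the integral of \<open>B (t1 - s) e s\<close> over \<open>[r, t1]\<close>. If \<open>r\<close> maximizes
  \<open>e\<close> on \<open>[t1 - d, t1]\<close>, that integral is at most \<open>e r\<close> times \<open>d powr \<alpha> / \<Gamma>(\<alpha> + 1)\<close>, which is too small
  for small \<open>d\<close>.
\<close>
lemma resolvent_pos:
  assumes \<alpha>: "0 < \<alpha>" "\<alpha> \<le> 1" and \<gamma>: "\<gamma> > 0" and t: "t > 0"
  shows "resolvent \<alpha> \<gamma> t > 0"
proof (rule ccontr)
  assume neg: "\<not> resolvent \<alpha> \<gamma> t > 0"
  define e where "e = resolvent \<alpha> \<gamma>"
  define B where "B = frac_kernel \<alpha>"
  \<comment> \<open>For \<open>\<alpha> < 1\<close> the kernel \<open>e\<close> is singular at 0; its sign is that of \<open>m\<close>, which is continuous up to 0.\<close>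
  define m where "m = (\<lambda>s. mittag_leffler \<alpha> (- \<gamma> * s powr \<alpha>))"
  have em: "e s = s powr (\<alpha> - 1) * m s" if "s > 0" for s using that by (simp add: e_def resolvent_def m_def)
  have G: "Gamma \<alpha> > 0" using \<alpha> by (simp add: Gamma_real_pos)
  have mc: "continuous_on {0..t} m" unfolding m_def
    by (intro continuous_on_compose2[OF continuous_at_imp_continuous_on[of UNIV "mittag_leffler \<alpha>"]] continuous_intros continuous_on_powr')
       (use \<alpha> in \<open>auto simp: isCont_mittag_leffler\<close>)
  have "m 0 > 0" using G \<alpha> by (simp add: m_def mittag_leffler_0)
  moreover have "m t \<le> 0" 
  proof (rule ccontr)
    assume "\<not> m t \<le> 0"
    then have "t powr (\<alpha> - 1) * m t > 0" using t by (intro mult_pos_pos) auto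
    then show False using neg em[OF t] by (simp add: e_def)
  qed
  ultimately obtain t1 where t1: "0 < t1" "m t1 = 0" and pos: "\<And>s. 0 \<le> s \<Longrightarrow> s < t1 \<Longrightarrow> m s > 0"
    using first_time_le[OF mc] t by (metis less_imp_le)
  have et1: "e t1 = 0" using em[OF t1(1)] t1 by simp
  have epos: "e s > 0" if "0 < s" "s < t1" for s using em[OF that(1)] pos[of s] that by simp
  have ez: "e s = 0" if "s \<le> 0" for s using that by (simp add: e_def resolvent_def)
  have G1: "Gamma (\<alpha> + 1) > 0" by (rule Gamma_real_pos) (use \<alpha> in simp)
  have "((\<lambda>d. ((t1 - d) / t1) powr (1 - \<alpha>)) \<longlongrightarrow> ((t1 - 0) / t1) powr (1 - \<alpha>)) (at_right 0)"
    using t1 by (intro tendsto_intros) auto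
  moreover have "((\<lambda>d. \<gamma> * (d powr \<alpha> / Gamma (\<alpha> + 1))) \<longlongrightarrow> \<gamma> * (0 powr \<alpha> / Gamma (\<alpha> + 1))) (at_right 0)"
  proof -
    have "\<forall>\<^sub>F d in at_right (0::real). 0 \<le> d"
      by (rule eventually_mono[OF eventually_at_right_less]) simp
    then have "((\<lambda>d::real. d powr \<alpha>) \<longlongrightarrow> 0 powr \<alpha>) (at_right 0)"
      using \<alpha> by (intro tendsto_powr' tendsto_ident_at tendsto_const) auto
    moreover have "Gamma (\<alpha> + 1) \<noteq> 0" using G1 by linarith
    ultimately show ?thesis by (intro tendsto_mult tendsto_divide tendsto_const)
  qed
  ultimately have "((\<lambda>d. ((t1 - d) / t1) powr (1 - \<alpha>) - \<gamma> * (d powr \<alpha> / Gamma (\<alpha> + 1))) \<longlongrightarrow> ((t1 - 0) / t1) powr (1 - \<alpha>) - \<gamma> * (0 powr \<alpha> / Gamma (\<alpha> + 1))) (at_right 0)"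
    by (rule tendsto_diff)
  then have ev1: "\<forall>\<^sub>F d in at_right 0. 0 < ((t1 - d) / t1) powr (1 - \<alpha>) - \<gamma> * (d powr \<alpha> / Gamma (\<alpha> + 1))"
  proof (rule order_tendstoD(1))
    show "0 < ((t1 - 0) / t1) powr (1 - \<alpha>) - \<gamma> * (0 powr \<alpha> / Gamma (\<alpha> + 1))" using t1(1) by simp
  qed
  have ev2: "\<forall>\<^sub>F d in at_right 0. d \<in> {0<..<t1}" by (rule eventually_at_right_real[OF t1(1)])
  have "\<exists>d. 0 < ((t1 - d) / t1) powr (1 - \<alpha>) - \<gamma> * (d powr \<alpha> / Gamma (\<alpha> + 1)) \<and> d \<in> {0<..<t1}"
    by (rule eventually_happens'[OF trivial_limit_at_right_real eventually_conj[OF ev1 ev2]])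
  then obtain d where d0: "0 < ((t1 - d) / t1) powr (1 - \<alpha>) - \<gamma> * (d powr \<alpha> / Gamma (\<alpha> + 1))" "d \<in> {0<..<t1}"
    by (elim exE conjE)
  then have d: "0 < d" "d < t1" "\<gamma> * (d powr \<alpha> / Gamma (\<alpha> + 1)) < ((t1 - d) / t1) powr (1 - \<alpha>)"
    by (simp_all del: Gamma_plus1)
  have "continuous_on {t1 - d..t1} e" unfolding e_def
    by (rule continuous_on_subset[OF resolvent_continuous]) (use \<alpha> d in auto)
  then obtain r where r: "r \<in> {t1 - d..t1}" and max: "\<And>s. s \<in> {t1 - d..t1} \<Longrightarrow> e s \<le> e r"
    using continuous_attains_sup[of "{t1 - d..t1}" e] d by auto
  have er: "e r > 0" using max[of "t1 - d"] epos[of "t1 - d"] d by auto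
  then have rt1: "r < t1" using r et1 by (cases "r = t1") auto
  have r0: "r > 0" using r d by auto
  define q where "q = (r / t1) powr (1 - \<alpha>)"
  have q: "q \<ge> 0" by (simp add: q_def)
  have Bq: "q * B r = B t1"
  proof -
    have "r powr (1 - \<alpha>) * r powr (\<alpha> - 1) = 1" using r0 by (simp add: powr_add[symmetric])
    moreover have "1 / t1 powr (1 - \<alpha>) = t1 powr (\<alpha> - 1)"
      using powr_minus_divide[of t1 "1 - \<alpha>"] by (simp only: minus_diff_eq)
    moreover have "q = r powr (1 - \<alpha>) / t1 powr (1 - \<alpha>)" unfolding q_def by (rule powr_divide)
    ultimately have "q * r powr (\<alpha> - 1) = t1 powr (\<alpha> - 1)" by (simp only: times_divide_eq_left)
    then show ?thesis using r0 t1(1) by (simp add: B_def frac_kernel_def)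
  qed
  \<comment> \<open>The factor \<open>frac_kernel 1 (s - r)\<close> is the indicator of \<open>s > r\<close>.\<close>
  have shift: "integrable lborel (\<lambda>s. B (t1 - s) * frac_kernel 1 (s - r))"
    "(LINT s|lborel. B (t1 - s) * frac_kernel 1 (s - r)) = (t1 - r) powr \<alpha> / Gamma (\<alpha> + 1)"
  proof -
    have "integrable lborel (\<lambda>s. B ((t1 - r) - s) * frac_kernel 1 s)"
      unfolding B_def by (intro conv_integrable causal_L1_frac_kernel \<alpha> causal_bounded_frac_kernel_1)
    from lborel_integrable_real_affine[OF this, of 1 "- r"] show "integrable lborel (\<lambda>s. B (t1 - s) * frac_kernel 1 (s - r))"
      by (simp add: algebra_simps)
    have "(LINT s|lborel. B (t1 - s) * frac_kernel 1 (s - r)) = conv B (frac_kernel 1) (t1 - r)"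
      unfolding conv_def using lborel_integral_real_affine[of 1 "\<lambda>s. B ((t1 - r) - s) * frac_kernel 1 s" "-r"] by (simp add: algebra_simps)
    also have "\<dots> = frac_kernel (\<alpha> + 1) (t1 - r)" unfolding B_def using \<alpha> by (intro conv_frac_kernel) auto
    finally show "(LINT s|lborel. B (t1 - s) * frac_kernel 1 (s - r)) = (t1 - r) powr \<alpha> / Gamma (\<alpha> + 1)"
      using rt1 by (simp add: frac_kernel_def)
  qed
  have I: "integrable lborel (\<lambda>s. B (u - s) * e s)" for u unfolding B_def e_def by (rule resolvent_equation(1)[OF \<alpha>(1) \<gamma>])
  have RE: "\<gamma> * conv B e u = B u - e u" for u unfolding B_def e_def by (rule resolvent_equation(2)[OF \<alpha>(1) \<gamma>])
  have "conv B e t1 \<le> (LINT s|lborel. q * (B (r - s) * e s) + e r * (B (t1 - s) * frac_kernel 1 (s - r)))"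
    unfolding conv_def
  proof (rule integral_mono_AE)
    show "integrable lborel (\<lambda>s. B (t1 - s) * e s)" by (rule I)
    show "integrable lborel (\<lambda>s. q * (B (r - s) * e s) + e r * (B (t1 - s) * frac_kernel 1 (s - r)))"
      by (intro Bochner_Integration.integrable_add integrable_mult_right I shift(1))
    have "AE s in lborel. s \<noteq> r" by (rule AE_lborel_singleton)
    then show "AE s in lborel. B (t1 - s) * e s \<le> q * (B (r - s) * e s) + e r * (B (t1 - s) * frac_kernel 1 (s - r))"
    proof eventually_elim
      case (elim s)
      have Bnn: "B u \<ge> 0" for u using \<alpha> by (simp add: B_def frac_kernel_nonneg)
      consider "s \<le> 0" | "0 < s" "s < r" | "r < s" "s \<le> t1" | "s > t1" using elim by linarith
      then show ?case
      proof cases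
        case 1 then show ?thesis using er Bnn by (simp add: ez frac_kernel_1)
      next
        case 2
        have "B (t1 - s) * e s \<le> (q * B (r - s)) * e s"
          using frac_kernel_ratio[OF \<alpha> 2 rt1] epos[of s] 2 rt1 by (intro mult_right_mono) (auto simp: B_def q_def)
        then show ?thesis using 2 by (simp add: frac_kernel_1 mult_ac)
      next
        case 3
        then have "B (t1 - s) * e s \<le> B (t1 - s) * e r" using max[of s] r Bnn by (intro mult_left_mono) auto
        then show ?thesis using 3 by (simp add: frac_kernel_1 B_def frac_kernel_nonpos_eq_0 mult_ac)
      next
        case 4 then show ?thesis using rt1 by (simp add: B_def frac_kernel_nonpos_eq_0)
      qed
    qed
  qed
  also have "\<dots> = q * conv B e r + e r * ((t1 - r) powr \<alpha> / Gamma (\<alpha> + 1))"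
    using I[of r] shift by (simp add: conv_def)
  finally have "\<gamma> * conv B e t1 \<le> \<gamma> * (q * conv B e r + e r * ((t1 - r) powr \<alpha> / Gamma (\<alpha> + 1)))"
    using \<gamma> by (intro mult_left_mono) auto
  also have "\<dots> = q * (\<gamma> * conv B e r) + e r * (\<gamma> * ((t1 - r) powr \<alpha> / Gamma (\<alpha> + 1)))" by (simp add: algebra_simps)
  finally have "B t1 \<le> B t1 - q * e r + e r * (\<gamma> * ((t1 - r) powr \<alpha> / Gamma (\<alpha> + 1)))"
    unfolding RE right_diff_distrib Bq et1 by simp
  then have "q * e r \<le> e r * (\<gamma> * ((t1 - r) powr \<alpha> / Gamma (\<alpha> + 1)))" by linarith
  then have "q * e r \<le> \<gamma> * ((t1 - r) powr \<alpha> / Gamma (\<alpha> + 1)) * e r" by (simp only: mult.commute)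
  then have "q \<le> \<gamma> * ((t1 - r) powr \<alpha> / Gamma (\<alpha> + 1))" using er by (rule mult_right_le_imp_le)
  also have "\<dots> \<le> \<gamma> * (d powr \<alpha> / Gamma (\<alpha> + 1))"
    using \<gamma> \<alpha> r rt1 G1 by (intro mult_left_mono divide_right_mono powr_mono2) (auto simp del: Gamma_plus1)
  also have "\<dots> < ((t1 - d) / t1) powr (1 - \<alpha>)" by (rule d)
  also have "\<dots> \<le> q" unfolding q_def using r t1(1) d \<alpha> by (intro powr_mono2 divide_right_mono) auto
  finally show False by simp
qed

section \<open>The mass of the resolvent kernel and variation of constants\<close>

text \<open>
  Unlike \<open>frac_kernel 1\<close>, it has the value 1 at 0, so that \<open>x = x 0 heaviside + B * F\<close> holds at \<open>t = 0\<close>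
  too.
\<close>
definition heaviside :: "real \<Rightarrow> real" where
  "heaviside t = (if t < 0 then 0 else 1)"

lemma causal_bounded_heaviside: "causal_bounded heaviside"
  unfolding causal_bounded_def heaviside_def[abs_def] by (auto intro!: exI[of _ 1])

lemma conv_heaviside: "conv (frac_kernel \<beta>) heaviside t = conv (frac_kernel \<beta>) (frac_kernel 1) t"
  unfolding conv_def
proof (rule integral_cong_AE)
  have "AE s in lborel. s \<noteq> (0::real)" by (rule AE_lborel_singleton)
  then show "AE s in lborel. frac_kernel \<beta> (t - s) * heaviside s = frac_kernel \<beta> (t - s) * frac_kernel 1 s"
    by eventually_elim (auto simp: heaviside_def frac_kernel_1)
qed (use causal_bounded_measurable[OF causal_bounded_heaviside] in measurable)

lemma conv_shift: "conv a (\<lambda>s. b (s - r)) t = conv a b (t - r)"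
  unfolding conv_def using lborel_integral_real_affine[of 1 "\<lambda>s. a (t - s) * b (s - r)" r]
  by (simp add: algebra_simps)

definition resolvent_mass :: "real \<Rightarrow> real \<Rightarrow> real \<Rightarrow> real" where
  "resolvent_mass \<alpha> \<gamma> t = conv (resolvent \<alpha> \<gamma>) heaviside t"

context
  fixes \<alpha> \<gamma> :: real
  assumes \<alpha>: "0 < \<alpha>" "\<alpha> \<le> 1" and \<gamma>: "\<gamma> > 0"
begin

lemma resolvent_nonneg: "resolvent \<alpha> \<gamma> t \<ge> 0"
  using resolvent_pos[OF \<alpha> \<gamma>, of t] by (cases "t > 0") (auto simp: resolvent_def)

lemma resolvent_conv_kernel:
  "conv (resolvent \<alpha> \<gamma>) (frac_kernel \<alpha>) = (\<lambda>s. (1 / \<gamma>) * (frac_kernel \<alpha> s + (-1) * resolvent \<alpha> \<gamma> s))"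
proof
  fix s
  have "\<gamma> * conv (resolvent \<alpha> \<gamma>) (frac_kernel \<alpha>) s = frac_kernel \<alpha> s - resolvent \<alpha> \<gamma> s"
    by (subst conv_commute) (rule resolvent_equation(2)[OF \<alpha>(1) \<gamma>])
  then show "conv (resolvent \<alpha> \<gamma>) (frac_kernel \<alpha>) s = (1 / \<gamma>) * (frac_kernel \<alpha> s + (-1) * resolvent \<alpha> \<gamma> s)"
    using \<gamma> by (simp add: field_simps)
qed

text \<open>
  The resolvent equation \<open>\<gamma> e * B = B - e\<close>, convolved with \<open>c\<close>.
\<close>
lemma resolvent_conv_conv:
  assumes c: "causal_bounded c"
  shows "\<gamma> * conv (resolvent \<alpha> \<gamma>) (conv (frac_kernel \<alpha>) c) t = conv (frac_kernel \<alpha>) c t - conv (resolvent \<alpha> \<gamma>) c t"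
proof -
  have L: "causal_L1 (frac_kernel \<alpha>)" "causal_L1 (resolvent \<alpha> \<gamma>)"
    using \<alpha> by (auto intro: causal_L1_frac_kernel causal_L1_resolvent)
  have "conv (resolvent \<alpha> \<gamma>) (conv (frac_kernel \<alpha>) c) t = (1 / \<gamma>) * (conv (frac_kernel \<alpha>) c t + (-1) * conv (resolvent \<alpha> \<gamma>) c t)"
    unfolding conv_assoc[OF L(2,1) c] resolvent_conv_kernel conv_scale_left
    by (subst conv_add_left) (use L c causal_L1_scale[OF L(2), of "-1"] in \<open>auto simp only: conv_scale_left\<close>)
  then show ?thesis using \<gamma> by simp
qed

text \<open>
  The resolvent equation integrated over \<open>[0, t]\<close>. Comparing its two sides for large \<open>t\<close> yields both bounds on
  the mass.
\<close>
lemma resolvent_mass_equation: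
  assumes "t > 0"
  shows "resolvent_mass \<alpha> \<gamma> t + \<gamma> * conv (frac_kernel \<alpha>) (resolvent_mass \<alpha> \<gamma>) t = t powr \<alpha> / Gamma (\<alpha> + 1)"
proof -
  have L: "causal_L1 (frac_kernel \<alpha>)" "causal_L1 (resolvent \<alpha> \<gamma>)"
    using \<alpha> by (auto intro: causal_L1_frac_kernel causal_L1_resolvent)
  have "conv (resolvent \<alpha> \<gamma>) (conv (frac_kernel \<alpha>) heaviside) t = conv (conv (frac_kernel \<alpha>) (resolvent \<alpha> \<gamma>)) heaviside t"
    unfolding conv_assoc[OF L(2,1) causal_bounded_heaviside]
    by (rule arg_cong[where f="\<lambda>a. conv a heaviside t"]) (rule ext, rule conv_commute)
  also have "\<dots> = conv (frac_kernel \<alpha>) (resolvent_mass \<alpha> \<gamma>) t"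
    unfolding conv_assoc[OF L(1,2) causal_bounded_heaviside, symmetric] resolvent_mass_def[abs_def] ..
  finally have "\<gamma> * conv (frac_kernel \<alpha>) (resolvent_mass \<alpha> \<gamma>) t = conv (frac_kernel \<alpha>) heaviside t - resolvent_mass \<alpha> \<gamma> t"
    using resolvent_conv_conv[OF causal_bounded_heaviside, of t] by (simp add: resolvent_mass_def)
  moreover have "conv (frac_kernel \<alpha>) heaviside t = t powr \<alpha> / Gamma (\<alpha> + 1)"
    using assms \<alpha> by (simp add: conv_heaviside conv_frac_kernel frac_kernel_def)
  ultimately show ?thesis by simp
qed

lemma causal_bounded_resolvent_mass: "causal_bounded (resolvent_mass \<alpha> \<gamma>)"
  unfolding resolvent_mass_def[abs_def]
  by (intro conv_causal_bounded causal_L1_resolvent \<alpha> causal_bounded_heaviside)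

lemma resolvent_mass_nonneg: "resolvent_mass \<alpha> \<gamma> t \<ge> 0"
  unfolding resolvent_mass_def conv_def
  by (rule integral_nonneg_AE, rule AE_I2) (auto simp: heaviside_def resolvent_nonneg)

lemma resolvent_mass_mono:
  assumes "s \<le> t" shows "resolvent_mass \<alpha> \<gamma> s \<le> resolvent_mass \<alpha> \<gamma> t"
proof -
  have "conv (resolvent \<alpha> \<gamma>) heaviside s = conv (resolvent \<alpha> \<gamma>) (\<lambda>r. heaviside (r - (t - s))) t"
    by (simp add: conv_shift)
  also have "\<dots> \<le> conv (resolvent \<alpha> \<gamma>) heaviside t"
  proof (rule conv_mono)
    show "causal_bounded (\<lambda>r. heaviside (r - (t - s)))"
      using assms causal_bounded_measurable[OF causal_bounded_heaviside]
      unfolding causal_bounded_def by (auto simp: heaviside_def intro!: exI[of _ 1])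
  qed (use assms in \<open>auto simp: causal_L1_resolvent \<alpha> resolvent_nonneg causal_bounded_heaviside, auto simp: heaviside_def\<close>)
  finally show ?thesis by (simp add: resolvent_mass_def)
qed

text \<open>
  If \<open>q = \<gamma> I(t) > 1\<close>, monotonicity and the integrated equation give
  \<open>q (s - t) powr \<alpha> \<le> s powr \<alpha>\<close> for all \<open>s > t\<close>, which fails as \<open>s\<close> tends to infinity.
\<close>
lemma resolvent_mass_le: "\<gamma> * resolvent_mass \<alpha> \<gamma> t \<le> 1"
proof (rule ccontr)
  define q where "q = \<gamma> * resolvent_mass \<alpha> \<gamma> t"
  assume "\<not> \<gamma> * resolvent_mass \<alpha> \<gamma> t \<le> 1"
  then have q: "q > 1" by (simp add: q_def)
  have "t \<ge> 0"
  proof (rule ccontr)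
    assume "\<not> t \<ge> 0"
    then have "resolvent_mass \<alpha> \<gamma> t = 0" using causal_bounded_resolvent_mass by (auto simp: causal_bounded_def)
    then show False using q by (simp add: q_def)
  qed
  have G1: "Gamma (\<alpha> + 1) > 0" by (rule Gamma_real_pos) (use \<alpha> in simp)
  have key: "q * ((s - t) / s) powr \<alpha> \<le> 1" if s: "s > t" for s
  proof -
    have s0: "s > 0" using s \<open>t \<ge> 0\<close> by simp
    have L: "causal_L1 (frac_kernel \<alpha>)" using \<alpha> by (auto intro: causal_L1_frac_kernel)
    have sh: "causal_bounded (\<lambda>r. heaviside (r - t))"
      using \<open>t \<ge> 0\<close> causal_bounded_measurable[OF causal_bounded_heaviside]
      unfolding causal_bounded_def by (auto simp: heaviside_def intro!: exI[of _ 1])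
    have "resolvent_mass \<alpha> \<gamma> t * ((s - t) powr \<alpha> / Gamma (\<alpha> + 1))
        = conv (frac_kernel \<alpha>) (\<lambda>r. resolvent_mass \<alpha> \<gamma> t * heaviside (r - t)) s"
      unfolding conv_scale conv_shift conv_heaviside using s \<alpha> by (simp add: conv_frac_kernel frac_kernel_def)
    also have "\<dots> \<le> conv (frac_kernel \<alpha>) (resolvent_mass \<alpha> \<gamma>) s"
      by (rule conv_mono[OF L frac_kernel_nonneg causal_bounded_scale[OF sh] causal_bounded_resolvent_mass])
         (use \<alpha> resolvent_mass_mono resolvent_mass_nonneg in \<open>auto simp: heaviside_def\<close>)
    finally have "\<gamma> * (resolvent_mass \<alpha> \<gamma> t * ((s - t) powr \<alpha> / Gamma (\<alpha> + 1))) \<le> \<gamma> * conv (frac_kernel \<alpha>) (resolvent_mass \<alpha> \<gamma>) s"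
      using \<gamma> by (intro mult_left_mono) auto
    also have "\<dots> \<le> s powr \<alpha> / Gamma (\<alpha> + 1)"
      using resolvent_mass_equation[OF s0] resolvent_mass_nonneg[of s] by linarith
    finally have "q * (s - t) powr \<alpha> / Gamma (\<alpha> + 1) \<le> s powr \<alpha> / Gamma (\<alpha> + 1)"
      by (simp only: q_def mult.assoc times_divide_eq_right)
    then have "q * (s - t) powr \<alpha> \<le> s powr \<alpha>" using G1 by (simp add: divide_le_cancel del: Gamma_plus1)
    moreover have "((s - t) / s) powr \<alpha> = (s - t) powr \<alpha> / s powr \<alpha>" by (rule powr_divide)
    ultimately show ?thesis using s0 by (simp only: times_divide_eq_right) (simp add: divide_le_eq_1)
  qed
  have "((\<lambda>s::real. (s - t) / s) \<longlongrightarrow> 1) at_top" by real_asymp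
  then have "((\<lambda>s::real. q * ((s - t) / s) powr \<alpha>) \<longlongrightarrow> q * 1 powr \<alpha>) at_top"
    by (intro tendsto_intros) auto
  then have "q * 1 powr \<alpha> \<le> 1"
    by (rule tendsto_upperbound) (rule eventually_mono[OF eventually_gt_at_top[of t]], erule key, simp)
  then show False using q by simp
qed

text \<open>
  A bound \<open>\<gamma> I \<le> a < 1\<close> would make the left-hand side of \<open>resolvent_mass_equation\<close> at most
  \<open>a / \<gamma> + a t powr \<alpha> / \<Gamma>(\<alpha> + 1)\<close>, less than the right-hand side for large \<open>t\<close>.
\<close>
lemma resolvent_mass_tendsto: "((\<lambda>t. \<gamma> * resolvent_mass \<alpha> \<gamma> t) \<longlongrightarrow> 1) at_top"
proof (rule order_tendstoI)
  fix a :: real assume a: "1 < a"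
  show "\<forall>\<^sub>F t in at_top. \<gamma> * resolvent_mass \<alpha> \<gamma> t < a"
    by (rule always_eventually) (use resolvent_mass_le a in \<open>auto intro: le_less_trans\<close>)
next
  fix a :: real assume a: "a < 1"
  have "\<exists>t. \<gamma> * resolvent_mass \<alpha> \<gamma> t > a"
  proof (rule ccontr)
    assume "\<not> ?thesis"
    then have le: "resolvent_mass \<alpha> \<gamma> t \<le> a / \<gamma>" for t using \<gamma> by (simp add: not_less field_simps)
    have L: "causal_L1 (frac_kernel \<alpha>)" using \<alpha> by (auto intro: causal_L1_frac_kernel)
    have key: "t powr \<alpha> / Gamma (\<alpha> + 1) * (1 - a) \<le> a / \<gamma>" if t: "t > 0" for t
    proof -
      have "conv (frac_kernel \<alpha>) (resolvent_mass \<alpha> \<gamma>) t \<le> conv (frac_kernel \<alpha>) (\<lambda>s. (a / \<gamma>) * heaviside s) t"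
        by (rule conv_mono[OF L frac_kernel_nonneg causal_bounded_resolvent_mass causal_bounded_scale[OF causal_bounded_heaviside]])
           (use \<alpha> le in \<open>auto simp: heaviside_def\<close>)
      also have "\<dots> = (a / \<gamma>) * (t powr \<alpha> / Gamma (\<alpha> + 1))"
        unfolding conv_scale conv_heaviside using t \<alpha> by (simp add: conv_frac_kernel frac_kernel_def)
      finally have "\<gamma> * conv (frac_kernel \<alpha>) (resolvent_mass \<alpha> \<gamma>) t \<le> \<gamma> * ((a / \<gamma>) * (t powr \<alpha> / Gamma (\<alpha> + 1)))"
        using \<gamma> by (intro mult_left_mono) auto
      also have "\<dots> = a * (t powr \<alpha> / Gamma (\<alpha> + 1))" using \<gamma> by simp
      finally show ?thesis
        using resolvent_mass_equation[OF t] le[of t] by (simp only: right_diff_distrib mult_1_right mult.commute[of _ a])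
    qed
    have G1: "Gamma (\<alpha> + 1) > 0" by (rule Gamma_real_pos) (use \<alpha> in simp)
    define A where "A = (1 - a) / Gamma (\<alpha> + 1)"
    have A: "A > 0" using a G1 by (simp add: A_def del: Gamma_plus1)
    define z where "z = (\<bar>a / \<gamma>\<bar> + 1) / A"
    have z: "z > 0" "z * A = \<bar>a / \<gamma>\<bar> + 1" 
      unfolding z_def using A by (intro divide_pos_pos add_nonneg_pos, auto)
    define t where "t = z powr (1 / \<alpha>)"
    have t: "t > 0" "t powr \<alpha> = z" using \<alpha> z(1) by (simp_all add: t_def powr_powr)
    have "t powr \<alpha> / Gamma (\<alpha> + 1) * (1 - a) = t powr \<alpha> * A" by (simp only: A_def times_divide_eq_left times_divide_eq_right)
    also have "\<dots> = \<bar>a / \<gamma>\<bar> + 1" by (simp only: t z)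
    also have "\<dots> > a / \<gamma>" by linarith
    finally show False using key[OF t(1)] by linarith
  qed
  then obtain t where t: "\<gamma> * resolvent_mass \<alpha> \<gamma> t > a" ..
  show "\<forall>\<^sub>F t in at_top. a < \<gamma> * resolvent_mass \<alpha> \<gamma> t"
    using eventually_ge_at_top[of t]
  proof eventually_elim
    case (elim s)
    then have "\<gamma> * resolvent_mass \<alpha> \<gamma> t \<le> \<gamma> * resolvent_mass \<alpha> \<gamma> s"
      using \<gamma> by (intro mult_left_mono resolvent_mass_mono) auto
    then show ?case using t by linarith
  qed
qed

text \<open>
  Convolve \<open>x = x0 + B * (h - \<gamma> x)\<close> with \<open>\<gamma> e\<close>. By \<open>resolvent_conv_conv\<close> the last term becomes
  \<open>B * (h - \<gamma> x) - e * (h - \<gamma> x) = (x - x0) - e * h + \<gamma> e * x\<close>, and \<open>\<gamma> e * x\<close> cancels.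
\<close>
lemma variation_of_constants:
  assumes x: "causal_bounded x" and h: "causal_bounded h"
    and eq: "\<And>s. 0 \<le> s \<Longrightarrow> s \<le> t \<Longrightarrow> x s = x0 + conv (frac_kernel \<alpha>) (\<lambda>s. h s + (- \<gamma>) * x s) s" and t: "t \<ge> 0"
  shows "x t = x0 * (1 - \<gamma> * resolvent_mass \<alpha> \<gamma> t) + conv (resolvent \<alpha> \<gamma>) h t"
proof -
  let ?e = "resolvent \<alpha> \<gamma>" and ?p = "\<lambda>s. h s + (- \<gamma>) * x s"
  have L: "causal_L1 (frac_kernel \<alpha>)" "causal_L1 ?e"
    using \<alpha> by (auto intro: causal_L1_frac_kernel causal_L1_resolvent)
  have p: "causal_bounded ?p" by (intro causal_bounded_add causal_bounded_scale x h)
  have Bp: "causal_bounded (conv (frac_kernel \<alpha>) ?p)" by (rule conv_causal_bounded[OF L(1) p])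
  have U: "causal_bounded (\<lambda>s. x0 * heaviside s)" by (intro causal_bounded_scale causal_bounded_heaviside)
  have "conv ?e x t = conv ?e (\<lambda>s. x0 * heaviside s + conv (frac_kernel \<alpha>) ?p s) t"
  proof (rule conv_causal_cong)
    show "x s = x0 * heaviside s + conv (frac_kernel \<alpha>) ?p s" if "0 \<le> s" "s \<le> t" for s
      using eq[OF that] that by (simp add: heaviside_def)
  qed (use L x Bp in \<open>auto simp: causal_L1_def causal_bounded_def heaviside_def\<close>)
  also have "\<dots> = x0 * resolvent_mass \<alpha> \<gamma> t + conv ?e (conv (frac_kernel \<alpha>) ?p) t"
    using conv_add[OF L(2) U Bp] by (simp add: conv_scale resolvent_mass_def)
  finally have "\<gamma> * conv ?e x t = x0 * (\<gamma> * resolvent_mass \<alpha> \<gamma> t) + \<gamma> * conv ?e (conv (frac_kernel \<alpha>) ?p) t"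
    by (simp add: algebra_simps)
  also have "\<gamma> * conv ?e (conv (frac_kernel \<alpha>) ?p) t = (x t - x0) - conv ?e ?p t"
    unfolding resolvent_conv_conv[OF p] using eq[OF t order_refl] by simp
  also have "conv ?e ?p t = conv ?e h t + (- \<gamma>) * conv ?e x t"
    using conv_add[OF L(2) h causal_bounded_scale[OF x, of "- \<gamma>"], of t] by (simp only: conv_scale)
  finally show ?thesis by (simp add: algebra_simps)
qed

lemma conv_resolvent_abs_le:
  assumes H: "continuous_on {0..t} H" and t: "t \<ge> 0" and b: "causal_bounded b"
    and le: "\<And>s. 0 \<le> s \<Longrightarrow> s \<le> t \<Longrightarrow> \<bar>H s\<bar> \<le> b s"
  shows "\<bar>conv (resolvent \<alpha> \<gamma>) (causal_part H) t\<bar> \<le> conv (resolvent \<alpha> \<gamma>) b t"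
proof -
  have L: "causal_L1 (resolvent \<alpha> \<gamma>)" using \<alpha> by (auto intro: causal_L1_resolvent)
  have "conv (resolvent \<alpha> \<gamma>) (causal_part H) t = conv (resolvent \<alpha> \<gamma>) (causal_part (\<lambda>s. H (min s t))) t"
    by (rule conv_causal_cong) (use L in \<open>auto simp: causal_part_def causal_L1_def\<close>)
  also have "\<bar>\<dots>\<bar> \<le> conv (resolvent \<alpha> \<gamma>) b t"
    by (rule conv_abs_le[OF L resolvent_nonneg causal_bounded_causal_part[OF continuous_on_freeze[OF H t]] b])
       (use le in \<open>auto simp: causal_part_def\<close>)
  finally show ?thesis .
qed

end

section \<open>Delay-independent asymptotic stability\<close>

definition delayed_feedback :: "real \<Rightarrow> (real \<Rightarrow> real) \<Rightarrow> real \<Rightarrow> real \<Rightarrow> (real \<Rightarrow> real) \<Rightarrow> real \<Rightarrow> real" where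
  "delayed_feedback \<gamma> g \<tau>1 \<tau>2 x s = g (x (s - \<tau>1)) - exp (- \<gamma> * \<tau>2) * g (x (s - \<tau>1 - \<tau>2))"

lemma rhs_along_delay_rhs:
  "rhs_along (delay_rhs \<gamma> g \<tau>2) \<tau>1 \<tau>2 x s = delayed_feedback \<gamma> g \<tau>1 \<tau>2 x s + (- \<gamma>) * x s"
  by (simp add: rhs_along_def delay_rhs_def delayed_feedback_def)

lemma continuous_delay_rhs:
  assumes "continuous_on UNIV g"
  shows "continuous_on UNIV (\<lambda>(u, v, w). delay_rhs \<gamma> g \<tau>2 u v w)"
  unfolding delay_rhs_def split_beta
  by (intro continuous_intros continuous_on_compose2[OF assms]) auto

lemma continuous_delayed_feedback:
  assumes g: "continuous_on UNIV g" and \<tau>: "\<tau>1 \<ge> 0" "\<tau>2 \<ge> 0" and x: "continuous_on {- (\<tau>1 + \<tau>2)..t} x"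
  shows "continuous_on {0..t} (delayed_feedback \<gamma> g \<tau>1 \<tau>2 x)"
  unfolding delayed_feedback_def[abs_def]
  by (intro continuous_intros continuous_on_compose2[OF g] continuous_on_compose2[OF x]) (use \<tau> in auto)

lemma solution_continuous:
  assumes "is_solution \<alpha> F \<tau>1 \<tau>2 \<phi> T x" "ereal t < T"
  shows "continuous_on {- (\<tau>1 + \<tau>2)..t} x"
  using assms unfolding is_solution_def
  by (auto elim!: continuous_on_subset intro: le_less_trans[of "ereal _" "ereal t"])

lemma delay_solution_representation:
  assumes sol: "is_solution \<alpha> (delay_rhs \<gamma> g \<tau>2) \<tau>1 \<tau>2 \<phi> T x" and \<alpha>: "0 < \<alpha>" "\<alpha> \<le> 1" and \<gamma>: "\<gamma> > 0"
    and g: "continuous_on UNIV g" and \<tau>: "\<tau>1 \<ge> 0" "\<tau>2 \<ge> 0" and t: "0 \<le> t" "ereal t < T"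
  shows "x t = x 0 * (1 - \<gamma> * resolvent_mass \<alpha> \<gamma> t)
     + conv (resolvent \<alpha> \<gamma>) (causal_part (delayed_feedback \<gamma> g \<tau>1 \<tau>2 x)) t"
proof -
  define h where "h = causal_part (\<lambda>s. delayed_feedback \<gamma> g \<tau>1 \<tau>2 x (min s t))"
  define y where "y = causal_part (\<lambda>s. x (min s t))"
  have xc: "continuous_on {- (\<tau>1 + \<tau>2)..t} x" using solution_continuous[OF sol t(2)] .
  have h: "causal_bounded h" unfolding h_def
    by (intro causal_bounded_causal_part continuous_on_freeze continuous_delayed_feedback g \<tau> xc t)
  have y: "causal_bounded y" unfolding y_def
    by (intro causal_bounded_causal_part continuous_on_freeze continuous_on_subset[OF xc] t) (use \<tau> in auto)
  have "y s = x 0 + conv (frac_kernel \<alpha>) (\<lambda>s. h s + (- \<gamma>) * y s) s" if s: "0 \<le> s" "s \<le> t" for s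
  proof -
    have sT: "ereal s < T" using s t by (meson ereal_less_eq(3) le_less_trans)
    have "x s = x 0 + conv (frac_kernel \<alpha>) (causal_part (rhs_along (delay_rhs \<gamma> g \<tau>2) \<tau>1 \<tau>2 x)) s"
      by (rule solution_imp_volterra[OF sol \<alpha> continuous_delay_rhs[OF g] \<tau> s(1) sT])
    also have "conv (frac_kernel \<alpha>) (causal_part (rhs_along (delay_rhs \<gamma> g \<tau>2) \<tau>1 \<tau>2 x)) s
       = conv (frac_kernel \<alpha>) (\<lambda>s. h s + (- \<gamma>) * y s) s"
      by (rule conv_causal_cong) (use s in \<open>auto simp: causal_part_def rhs_along_delay_rhs h_def y_def frac_kernel_def\<close>)
    finally show ?thesis using s by (simp add: y_def causal_part_def)
  qed
  from variation_of_constants[OF \<alpha> \<gamma> y h this t(1)]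
  have "y t = x 0 * (1 - \<gamma> * resolvent_mass \<alpha> \<gamma> t) + conv (resolvent \<alpha> \<gamma>) h t" by simp
  also have "conv (resolvent \<alpha> \<gamma>) h t = conv (resolvent \<alpha> \<gamma>) (causal_part (delayed_feedback \<gamma> g \<tau>1 \<tau>2 x)) t"
    by (rule conv_causal_cong) (auto simp: h_def causal_part_def resolvent_def)
  finally show ?thesis using t by (simp add: y_def causal_part_def)
qed

lemma delayed_feedback_le:
  assumes \<kappa>: "\<And>v. \<bar>v\<bar> \<le> r \<Longrightarrow> \<bar>g v\<bar> \<le> \<kappa> * \<bar>v\<bar>" "\<kappa> \<ge> 0" and \<gamma>: "\<gamma> > 0" and \<tau>: "\<tau>2 \<ge> 0"
    and M: "M \<le> r" "\<bar>x (s - \<tau>1)\<bar> \<le> M" "\<bar>x (s - \<tau>1 - \<tau>2)\<bar> \<le> M"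
  shows "\<bar>delayed_feedback \<gamma> g \<tau>1 \<tau>2 x s\<bar> \<le> 2 * \<kappa> * M"
proof -
  have g: "\<bar>g v\<bar> \<le> \<kappa> * M" if "\<bar>v\<bar> \<le> M" for v
    using \<kappa>(1)[of v] that M(1) mult_left_mono[OF that \<kappa>(2)] by linarith
  have "exp (- \<gamma> * \<tau>2) * \<bar>g (x (s - \<tau>1 - \<tau>2))\<bar> \<le> 1 * (\<kappa> * M)"
    using g[OF M(3)] \<gamma> \<tau> by (intro mult_mono) auto
  moreover have "\<bar>exp (- \<gamma> * \<tau>2) * g (x (s - \<tau>1 - \<tau>2))\<bar> = exp (- \<gamma> * \<tau>2) * \<bar>g (x (s - \<tau>1 - \<tau>2))\<bar>" by (simp add: abs_mult)
  ultimately show ?thesis unfolding delayed_feedback_def using g[OF M(2)] by linarith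
qed

text \<open>
  At a first time with \<open>\<bar>x\<bar> = \<delta>\<close> variation of constants gives
  \<open>\<delta> \<le> \<bar>x 0\<bar> (1 - \<gamma> I) + (2 \<kappa> / \<gamma>) \<delta> (\<gamma> I)\<close>, a weighted mean of two numbers below \<open>\<delta>\<close>.
\<close>
lemma delay_solution_stays_small:
  assumes sol: "is_solution \<alpha> (delay_rhs \<gamma> g \<tau>2) \<tau>1 \<tau>2 \<phi> T x" and \<alpha>: "0 < \<alpha>" "\<alpha> \<le> 1" and \<gamma>: "\<gamma> > 0"
    and g: "continuous_on UNIV g" and \<tau>: "\<tau>1 \<ge> 0" "\<tau>2 \<ge> 0"
    and \<kappa>: "\<And>v. \<bar>v\<bar> \<le> r \<Longrightarrow> \<bar>g v\<bar> \<le> \<kappa> * \<bar>v\<bar>" "\<kappa> \<ge> 0" "2 * \<kappa> < \<gamma>"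
    and \<delta>: "0 < \<delta>" "\<delta> \<le> r" and near: "history_near \<tau>1 \<tau>2 0 \<delta> \<phi>"
    and t: "- (\<tau>1 + \<tau>2) \<le> t" "ereal t < T"
  shows "\<bar>x t\<bar> < \<delta>"
proof (rule ccontr)
  assume big: "\<not> \<bar>x t\<bar> < \<delta>"
  have hist: "\<bar>x s\<bar> < \<delta>" if "- (\<tau>1 + \<tau>2) \<le> s" "s \<le> 0" for s
    using sol near that by (auto simp: is_solution_def history_near_def)
  have t0: "t \<ge> 0" using big hist[of t] t by (cases "t \<le> 0") auto
  have xc: "continuous_on {0..t} x" by (rule continuous_on_subset[OF solution_continuous[OF sol t(2)]]) (use \<tau> in auto)
  obtain t1 where t1: "0 < t1" "t1 \<le> t" "- \<bar>x t1\<bar> = - \<delta>" "\<And>s. 0 \<le> s \<Longrightarrow> s < t1 \<Longrightarrow> - \<bar>x s\<bar> > - \<delta>"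
  proof (rule first_time_le[of 0 t "\<lambda>s. - \<bar>x s\<bar>" "- \<delta>"])
    show "continuous_on {0..t} (\<lambda>s. - \<bar>x s\<bar>)" by (intro continuous_intros xc)
  qed (use t0 hist[of 0] \<tau> big in auto)
  have le: "\<bar>x s\<bar> \<le> \<delta>" if "- (\<tau>1 + \<tau>2) \<le> s" "s \<le> t1" for s
    using hist[of s] t1(4)[of s] t1(3) that by (cases "s \<le> 0"; cases "s = t1") auto
  have t1T: "ereal t1 < T" using t1(2) t(2) by (meson ereal_less_eq(3) le_less_trans)
  define H where "H = delayed_feedback \<gamma> g \<tau>1 \<tau>2 x"
  define I where "I = resolvent_mass \<alpha> \<gamma> t1"
  have I: "I \<ge> 0" "\<gamma> * I \<le> 1" using resolvent_mass_nonneg[OF \<alpha> \<gamma>] resolvent_mass_le[OF \<alpha> \<gamma>] by (auto simp: I_def)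
  have Hc: "continuous_on {0..t1} H" unfolding H_def
    by (rule continuous_delayed_feedback[OF g \<tau> solution_continuous[OF sol t1T]])
  have "\<bar>conv (resolvent \<alpha> \<gamma>) (causal_part H) t1\<bar> \<le> conv (resolvent \<alpha> \<gamma>) (\<lambda>s. (2 * \<kappa> * \<delta>) * heaviside s) t1"
  proof (rule conv_resolvent_abs_le[OF \<alpha> \<gamma> Hc])
    show "\<bar>H s\<bar> \<le> 2 * \<kappa> * \<delta> * heaviside s" if "0 \<le> s" "s \<le> t1" for s
      unfolding H_def using that delayed_feedback_le[OF \<kappa>(1,2) \<gamma> \<tau>(2) \<delta>(2), of x s \<tau>1] le \<tau> by (auto simp: heaviside_def)
  qed (use t1 in \<open>auto intro: causal_bounded_scale causal_bounded_heaviside\<close>)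
  also have "\<dots> = 2 * \<kappa> * \<delta> * I" by (simp add: conv_scale I_def resolvent_mass_def)
  finally have c: "\<bar>conv (resolvent \<alpha> \<gamma>) (causal_part H) t1\<bar> \<le> 2 * \<kappa> * \<delta> * I" .
  have "x t1 = x 0 * (1 - \<gamma> * I) + conv (resolvent \<alpha> \<gamma>) (causal_part H) t1"
    unfolding H_def I_def using delay_solution_representation[OF sol \<alpha> \<gamma> g \<tau> _ t1T] t1(1) by simp
  then have "\<bar>x t1\<bar> \<le> \<bar>x 0\<bar> * (1 - \<gamma> * I) + 2 * \<kappa> * \<delta> * I"
    using c I abs_triangle_ineq[of "x 0 * (1 - \<gamma> * I)" "conv (resolvent \<alpha> \<gamma>) (causal_part H) t1"] by (simp add: abs_mult)
  also have "\<dots> < \<delta>"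
  proof (cases "\<gamma> * I = 1")
    case True
    then have "I > 0" using \<gamma> I by (cases "I = 0") auto
    then have "(2 * \<kappa>) * (\<delta> * I) < \<gamma> * (\<delta> * I)" using \<kappa>(3) \<delta> by (intro mult_strict_right_mono) auto
    also have "\<gamma> * (\<delta> * I) = \<delta>" by (metis True mult.left_commute mult_1_right)
    finally show ?thesis using True by (simp add: mult.assoc)
  next
    case False
    then have "\<bar>x 0\<bar> * (1 - \<gamma> * I) < \<delta> * (1 - \<gamma> * I)"
      using hist[of 0] \<tau> I by (intro mult_strict_right_mono) auto
    moreover have "(2 * \<kappa>) * (\<delta> * I) \<le> \<gamma> * (\<delta> * I)" using \<kappa>(3) \<delta> I by (intro mult_right_mono) auto
    ultimately show ?thesis by (simp add: algebra_simps)
  qed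
  finally show False using t1(3) by simp
qed

text \<open>
  If \<open>\<bar>x\<bar> \<le> M\<close> from some time on, the forcing is eventually at most \<open>2 \<kappa> M\<close>. The contributions of
  \<open>x 0\<close> and of the forcing before that time fade out, since \<open>\<gamma> I\<close> tends to 1, and the rest has
  limit at most \<open>(2 \<kappa> / \<gamma>) M\<close>. So the eventual bound improves by any factor \<open>\<theta>\<close> above \<open>2 \<kappa> / \<gamma>\<close>, and
  this can be iterated.
\<close>
lemma delay_solution_tendsto_0:
  assumes sol: "is_solution \<alpha> (delay_rhs \<gamma> g \<tau>2) \<tau>1 \<tau>2 \<phi> \<infinity> x" and \<alpha>: "0 < \<alpha>" "\<alpha> \<le> 1" and \<gamma>: "\<gamma> > 0"
    and g: "continuous_on UNIV g" and \<tau>: "\<tau>1 \<ge> 0" "\<tau>2 \<ge> 0"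
    and \<kappa>: "\<And>v. \<bar>v\<bar> \<le> r \<Longrightarrow> \<bar>g v\<bar> \<le> \<kappa> * \<bar>v\<bar>" "\<kappa> \<ge> 0" "2 * \<kappa> < \<gamma>"
    and small: "\<And>t. - (\<tau>1 + \<tau>2) \<le> t \<Longrightarrow> \<bar>x t\<bar> \<le> r" and r: "r > 0"
  shows "(x \<longlongrightarrow> 0) at_top"
proof -
  define I where "I = resolvent_mass \<alpha> \<gamma>"
  have I: "I t \<ge> 0" "\<gamma> * I t \<le> 1" for t using resolvent_mass_nonneg[OF \<alpha> \<gamma>] resolvent_mass_le[OF \<alpha> \<gamma>] by (auto simp: I_def)
  have Ilim: "((\<lambda>t. \<gamma> * I t) \<longlongrightarrow> 1) at_top" unfolding I_def by (rule resolvent_mass_tendsto[OF \<alpha> \<gamma>])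
  have Ilim': "(I \<longlongrightarrow> 1 / \<gamma>) at_top"
    using tendsto_divide[OF Ilim tendsto_const[of \<gamma>]] \<gamma> by simp
  define \<theta> where "\<theta> = (1 + 2 * \<kappa> / \<gamma>) / 2"
  have q: "2 * \<kappa> / \<gamma> < 1" "2 * \<kappa> / \<gamma> \<ge> 0" using \<kappa> \<gamma> by auto
  then have \<theta>: "0 < \<theta>" "\<theta> < 1" "2 * \<kappa> / \<gamma> < \<theta>" by (auto simp: \<theta>_def)
  define H where "H = delayed_feedback \<gamma> g \<tau>1 \<tau>2 x"
  have Hc: "continuous_on {0..t} H" for t unfolding H_def
    by (rule continuous_delayed_feedback[OF g \<tau> solution_continuous[OF sol]]) simp
  have step: "\<exists>S\<ge>0. \<forall>t\<ge>S. \<bar>x t\<bar> \<le> \<theta> * M" if M: "0 < M" "M \<le> r" and S: "S \<ge> 0" "\<And>t. t \<ge> S \<Longrightarrow> \<bar>x t\<bar> \<le> M" for M S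
  proof -
    define R where "R = S + \<tau>1 + \<tau>2"
    have R0: "R \<ge> 0" using S \<tau> by (simp add: R_def)
    have bound: "\<bar>x t\<bar> \<le> \<bar>x 0\<bar> * (1 - \<gamma> * I t) + (2 * \<kappa> * M * I t + 2 * \<kappa> * r * (I t - I (t - R)))" if t: "t \<ge> 0" for t
    proof -
      let ?b = "\<lambda>s. (2 * \<kappa> * M + 2 * \<kappa> * r) * heaviside s + (- (2 * \<kappa> * r)) * heaviside (s - R)"
      have Ub: "causal_bounded (\<lambda>s. heaviside (s - R))"
        using R0 causal_bounded_measurable[OF causal_bounded_heaviside]
        unfolding causal_bounded_def by (auto simp: heaviside_def intro!: exI[of _ 1])
      have b1: "causal_bounded (\<lambda>s. (2 * \<kappa> * M + 2 * \<kappa> * r) * heaviside s)"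
        and b2: "causal_bounded (\<lambda>s. (- (2 * \<kappa> * r)) * heaviside (s - R))"
        by (intro causal_bounded_scale causal_bounded_heaviside Ub)+
      have "\<bar>conv (resolvent \<alpha> \<gamma>) (causal_part H) t\<bar> \<le> conv (resolvent \<alpha> \<gamma>) ?b t"
      proof (rule conv_resolvent_abs_le[OF \<alpha> \<gamma> Hc t causal_bounded_add[OF b1 b2]])
        fix s assume s: "0 \<le> s" "s \<le> t"
        have h1: "\<bar>H s\<bar> \<le> 2 * \<kappa> * r" unfolding H_def
          by (rule delayed_feedback_le[OF \<kappa>(1,2) \<gamma> \<tau>(2)]) (use s small \<tau> in auto)
        have h2: "2 * \<kappa> * M \<ge> 0" using \<kappa> M by (intro mult_nonneg_nonneg) auto
        have e: "?b s = (if s < R then 2 * \<kappa> * M + 2 * \<kappa> * r else 2 * \<kappa> * M)"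
          using s by (simp add: heaviside_def)
        show "\<bar>H s\<bar> \<le> ?b s"
        proof (cases "s < R")
          case True
          then show ?thesis unfolding e if_P[OF True] using h1 h2 by linarith
        next
          case False
          have "\<bar>H s\<bar> \<le> 2 * \<kappa> * M" unfolding H_def
            by (rule delayed_feedback_le[OF \<kappa>(1,2) \<gamma> \<tau>(2) M(2)]) (use False S(2) \<tau> in \<open>auto simp: R_def\<close>)
          then show ?thesis unfolding e if_not_P[OF False] .
        qed
      qed
      also have "\<dots> = (2 * \<kappa> * M + 2 * \<kappa> * r) * I t + (- (2 * \<kappa> * r)) * I (t - R)"
        by (subst conv_add[OF causal_L1_resolvent[OF \<alpha>(1)] b1 b2])
           (simp only: conv_scale conv_shift I_def resolvent_mass_def)
      also have "\<dots> = 2 * \<kappa> * M * I t + 2 * \<kappa> * r * (I t - I (t - R))" by (simp add: algebra_simps)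
      finally have c: "\<bar>conv (resolvent \<alpha> \<gamma>) (causal_part H) t\<bar> \<le> 2 * \<kappa> * M * I t + 2 * \<kappa> * r * (I t - I (t - R))" .
      have "x t = x 0 * (1 - \<gamma> * I t) + conv (resolvent \<alpha> \<gamma>) (causal_part H) t"
        unfolding H_def I_def using delay_solution_representation[OF sol \<alpha> \<gamma> g \<tau> t] by simp
      then have "\<bar>x t\<bar> \<le> \<bar>x 0 * (1 - \<gamma> * I t)\<bar> + \<bar>conv (resolvent \<alpha> \<gamma>) (causal_part H) t\<bar>"
        by (simp only: abs_triangle_ineq)
      moreover have "\<bar>x 0 * (1 - \<gamma> * I t)\<bar> = \<bar>x 0\<bar> * (1 - \<gamma> * I t)" using I(2)[of t] by (simp add: abs_mult)
      ultimately show ?thesis using c by linarith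
    qed
    have shift: "filterlim (\<lambda>t. t - R) at_top at_top" by real_asymp
    have "((\<lambda>t. \<bar>x 0\<bar> * (1 - \<gamma> * I t) + (2 * \<kappa> * M * I t + 2 * \<kappa> * r * (I t - I (t - R))))
        \<longlongrightarrow> \<bar>x 0\<bar> * (1 - 1) + (2 * \<kappa> * M * (1 / \<gamma>) + 2 * \<kappa> * r * (1 / \<gamma> - 1 / \<gamma>))) at_top"
      by (intro tendsto_intros Ilim Ilim' filterlim_compose[OF Ilim' shift])
    moreover have "\<bar>x 0\<bar> * (1 - 1) + (2 * \<kappa> * M * (1 / \<gamma>) + 2 * \<kappa> * r * (1 / \<gamma> - 1 / \<gamma>)) < \<theta> * M"
      using mult_strict_right_mono[OF \<theta>(3) M(1)] by simp
    ultimately have "\<forall>\<^sub>F t in at_top. \<bar>x 0\<bar> * (1 - \<gamma> * I t) + (2 * \<kappa> * M * I t + 2 * \<kappa> * r * (I t - I (t - R))) < \<theta> * M"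
      by (rule order_tendstoD)
    then obtain N where N: "\<And>t. t \<ge> N \<Longrightarrow> \<bar>x 0\<bar> * (1 - \<gamma> * I t) + (2 * \<kappa> * M * I t + 2 * \<kappa> * r * (I t - I (t - R))) < \<theta> * M"
      unfolding eventually_at_top_linorder by blast
    show ?thesis
    proof (intro exI[of _ "max 0 N"] conjI allI impI)
      fix t assume "t \<ge> max 0 N"
      then show "\<bar>x t\<bar> \<le> \<theta> * M" using bound[of t] N[of t] by simp
    qed simp
  qed
  have iter: "\<exists>S\<ge>0. \<forall>t\<ge>S. \<bar>x t\<bar> \<le> \<theta> ^ n * r" for n
  proof (induction n)
    case 0
    show ?case using small \<tau> by (intro exI[of _ 0]) auto
  next
    case (Suc n)
    then obtain S where S: "S \<ge> 0" "\<And>t. t \<ge> S \<Longrightarrow> \<bar>x t\<bar> \<le> \<theta> ^ n * r" by blast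
    have "\<theta> ^ n * r \<le> 1 * r" using \<theta> r by (intro mult_right_mono power_le_one) auto
    then show ?case using step[of "\<theta> ^ n * r" S] S \<theta> r by (simp add: mult.assoc)
  qed
  show ?thesis
  proof (rule tendstoI)
    fix \<epsilon> :: real assume \<epsilon>: "\<epsilon> > 0"
    have "(\<lambda>n. \<theta> ^ n * r) \<longlonglongrightarrow> 0 * r" using \<theta> by (intro tendsto_intros LIMSEQ_realpow_zero) auto
    then have "\<forall>\<^sub>F n in sequentially. \<theta> ^ n * r < \<epsilon>" by (rule order_tendstoD) (use \<epsilon> in simp)
    then obtain n where n: "\<theta> ^ n * r < \<epsilon>" by (auto simp: eventually_sequentially)
    obtain S where S: "\<And>t. t \<ge> S \<Longrightarrow> \<bar>x t\<bar> \<le> \<theta> ^ n * r" using iter[of n] by blast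
    show "\<forall>\<^sub>F t in at_top. dist (x t) 0 < \<epsilon>"
      using eventually_ge_at_top[of S] by eventually_elim (use S n in \<open>auto simp: dist_real_def intro: le_less_trans\<close>)
  qed
qed

text \<open>
  Composing with the clamp to \<open>[-r, r]\<close> makes a continuously differentiable function globally Lipschitz. A
  solution of the truncated equation that stays below \<open>r\<close> solves the original one.
\<close>
definition truncate :: "real \<Rightarrow> (real \<Rightarrow> real) \<Rightarrow> real \<Rightarrow> real" where
  "truncate r g v = g (max (- r) (min r v))"

lemma truncate_eq: "\<bar>v\<bar> \<le> r \<Longrightarrow> truncate r g v = g v"
  by (auto simp: truncate_def max_def min_def abs_if split: if_splits)

lemma truncate_lipschitz:
  assumes g: "g C1_differentiable_on UNIV" and r: "r > 0"
  obtains K where "K > 0" "\<And>u v. \<bar>truncate r g u - truncate r g v\<bar> \<le> K * \<bar>u - v\<bar>"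
proof -
  obtain D where D: "\<And>x. (g has_vector_derivative D x) (at x)" and Dc: "continuous_on UNIV D"
    using g unfolding C1_differentiable_on_def by auto
  have "compact (D ` {-r..r})" by (intro compact_continuous_image continuous_on_subset[OF Dc]) auto
  then obtain K where K: "\<And>x. x \<in> {-r..r} \<Longrightarrow> norm (D x) \<le> K" by (meson compact_imp_bounded bounded_iff imageI)
  have K0: "K \<ge> 0" using K[of 0] r norm_ge_zero[of "D 0"] by auto
  have lt: "\<bar>g b - g a\<bar> \<le> K * \<bar>b - a\<bar>" if "a < b" "a \<in> {-r..r}" "b \<in> {-r..r}" for a b
  proof -
    have "\<And>z. a \<le> z \<Longrightarrow> z \<le> b \<Longrightarrow> DERIV g z :> D z"
      using D by (simp add: has_real_derivative_iff_has_vector_derivative)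
    from MVT2[OF that(1) this] obtain z where z: "a < z" "z < b" "g b - g a = (b - a) * D z" by auto
    then have "\<bar>g b - g a\<bar> = \<bar>b - a\<bar> * \<bar>D z\<bar>" by (simp add: abs_mult)
    also have "\<dots> \<le> \<bar>b - a\<bar> * K" using K[of z] z that by (intro mult_left_mono) auto
    finally show ?thesis by (simp add: mult.commute)
  qed
  have le: "\<bar>g b - g a\<bar> \<le> K * \<bar>b - a\<bar>" if "a \<in> {-r..r}" "b \<in> {-r..r}" for a b
    using lt[of a b] lt[of b a] that by (cases a b rule: linorder_cases) (auto simp: abs_minus_commute)
  show ?thesis
  proof (rule that[of "K + 1"])
    show "K + 1 > 0" using K0 by simp
    fix u v
    have "\<bar>truncate r g u - truncate r g v\<bar> \<le> K * \<bar>max (- r) (min r u) - max (- r) (min r v)\<bar>"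
      unfolding truncate_def by (rule le) (use r in auto)
    also have "\<dots> \<le> (K + 1) * \<bar>u - v\<bar>"
      using K0 by (intro mult_mono) (auto simp: max_def min_def abs_if)
    finally show "\<bar>truncate r g u - truncate r g v\<bar> \<le> (K + 1) * \<bar>u - v\<bar>" .
  qed
qed

lemma is_solution_transfer:
  assumes "is_solution \<alpha> F \<tau>1 \<tau>2 \<phi> \<infinity> x" "0 < T"
    and "\<And>t. 0 < t \<Longrightarrow> ereal t < T \<Longrightarrow> F (x t) (x (t - \<tau>1)) (x (t - \<tau>1 - \<tau>2)) = F' (x t) (x (t - \<tau>1)) (x (t - \<tau>1 - \<tau>2))"
  shows "is_solution \<alpha> F' \<tau>1 \<tau>2 \<phi> T x"
  using assms unfolding is_solution_def by (auto elim!: continuous_on_subset)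

lemma C1_continuous: "g C1_differentiable_on UNIV \<Longrightarrow> continuous_on UNIV (g :: real \<Rightarrow> real)"
  by (simp add: C1_differentiable_imp_continuous_on)

lemma continuous_truncate: "continuous_on UNIV g \<Longrightarrow> continuous_on UNIV (truncate r g)"
  unfolding truncate_def[abs_def] by (rule continuous_on_compose2[of UNIV g]) (auto intro!: continuous_intros)

lemma truncated_solution_exists:
  assumes g: "g C1_differentiable_on UNIV" and r: "r > 0" and \<alpha>: "0 < \<alpha>" "\<alpha> \<le> 1" and \<tau>: "\<tau>1 \<ge> 0" "\<tau>2 \<ge> 0"
    and \<phi>: "continuous_on {- (\<tau>1 + \<tau>2)..0} \<phi>"
  shows "\<exists>x. is_solution \<alpha> (delay_rhs \<gamma> (truncate r g) \<tau>2) \<tau>1 \<tau>2 \<phi> \<infinity> x"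
proof -
  obtain K where K: "K > 0" "\<And>u v. \<bar>truncate r g u - truncate r g v\<bar> \<le> K * \<bar>u - v\<bar>"
    using truncate_lipschitz[OF g r] by blast
  define E where "E = exp (- \<gamma> * \<tau>2)"
  define L where "L = \<bar>\<gamma>\<bar> + K + E * K"
  have E: "E > 0" by (simp add: E_def)
  show ?thesis
  proof (rule lipschitz_solution_exists[OF \<alpha> \<tau> continuous_delay_rhs[OF continuous_truncate[OF C1_continuous[OF g]]] _ _ \<phi>])
    show "L > 0" using K E by (simp add: L_def add_nonneg_pos add_pos_pos)
    fix u v w u' v' w' :: real
    have "\<bar>delay_rhs \<gamma> (truncate r g) \<tau>2 u v w - delay_rhs \<gamma> (truncate r g) \<tau>2 u' v' w'\<bar>
       = \<bar>(- \<gamma>) * (u - u') + (truncate r g v - truncate r g v') - E * (truncate r g w - truncate r g w')\<bar>"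
      by (simp add: delay_rhs_def E_def algebra_simps)
    also have "\<dots> \<le> \<bar>(- \<gamma>) * (u - u')\<bar> + \<bar>truncate r g v - truncate r g v'\<bar> + \<bar>E * (truncate r g w - truncate r g w')\<bar>"
      by linarith
    also have "\<dots> \<le> \<bar>\<gamma>\<bar> * \<bar>u - u'\<bar> + K * \<bar>v - v'\<bar> + E * (K * \<bar>w - w'\<bar>)"
      using E K(2) by (intro add_mono) (auto simp: abs_mult intro!: mult_left_mono)
    also have "\<dots> \<le> L * \<bar>u - u'\<bar> + L * \<bar>v - v'\<bar> + L * \<bar>w - w'\<bar>"
      unfolding mult.assoc[symmetric, of E] using E K(1)
      by (intro add_mono mult_right_mono) (auto simp: L_def)
    finally show "\<bar>delay_rhs \<gamma> (truncate r g) \<tau>2 u v w - delay_rhs \<gamma> (truncate r g) \<tau>2 u' v' w'\<bar>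
       \<le> L * (\<bar>u - u'\<bar> + \<bar>v - v'\<bar> + \<bar>w - w'\<bar>)" by (simp add: distrib_left)
  qed
qed

lemma derivative_at_0_bound:
  fixes g :: "real \<Rightarrow> real"
  assumes "g 0 = 0" "(g has_real_derivative k) (at 0)" "\<eta> > 0"
  obtains r where "r > 0" "\<And>v. \<bar>v\<bar> \<le> r \<Longrightarrow> \<bar>g v - k * v\<bar> \<le> \<eta> * \<bar>v\<bar>"
proof -
  have "(g has_derivative (*) k) (at 0)" using assms(2) by (simp add: has_field_derivative_def)
  then obtain d where d: "d > 0" "\<And>y. norm (y - 0) < d \<Longrightarrow> norm (g y - g 0 - k * (y - 0)) \<le> \<eta> * norm (y - 0)"
    unfolding has_derivative_at_alt using assms(3) by blast
  show ?thesis by (rule that[of "d / 2"]) (use d(1) d(2) assms(1) in auto)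
qed

text \<open>
  The slack in \<open>\<gamma> > 2 \<bar>k\<bar>\<close> allows a bound \<open>\<bar>g v\<bar> \<le> \<kappa> \<bar>v\<bar>\<close> with \<open>2 \<kappa> < \<gamma>\<close> near 0. In
  \<open>delay_solution_stays_small\<close> the bound on the solution is the bound on the history, so \<open>\<delta> = \<epsilon>\<close> works for small
  \<open>\<epsilon>\<close>.
\<close>
theorem delay_independent_stability:
  assumes g: "g C1_differentiable_on UNIV" "g 0 = 0" "(g has_real_derivative k) (at 0)"
    and \<gamma>: "\<gamma> > 2 * \<bar>k\<bar>" and \<alpha>: "0 < \<alpha>" "\<alpha> \<le> 1" and \<tau>: "\<tau>1 \<ge> 0" "\<tau>2 \<ge> 0"
  shows "asymptotically_stable_equilibrium \<alpha> (delay_rhs \<gamma> g \<tau>2) \<tau>1 \<tau>2 0"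
proof -
  have \<gamma>0: "\<gamma> > 0" using \<gamma> by linarith
  have gc: "continuous_on UNIV g" by (rule C1_continuous[OF g(1)])
  define \<eta> where "\<eta> = (\<gamma> - 2 * \<bar>k\<bar>) / 4"
  have \<eta>: "\<eta> > 0" using \<gamma> by (simp add: \<eta>_def)
  define \<kappa> where "\<kappa> = \<bar>k\<bar> + \<eta>"
  have \<kappa>: "\<kappa> \<ge> 0" "2 * \<kappa> < \<gamma>"
    using \<gamma> \<eta> by (simp add: \<kappa>_def, simp add: \<kappa>_def \<eta>_def field_simps)
  obtain r where r: "r > 0" "\<And>v. \<bar>v\<bar> \<le> r \<Longrightarrow> \<bar>g v - k * v\<bar> \<le> \<eta> * \<bar>v\<bar>"
    using derivative_at_0_bound[OF g(2,3) \<eta>] by blast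
  have gk: "\<bar>g v\<bar> \<le> \<kappa> * \<bar>v\<bar>" if "\<bar>v\<bar> \<le> r" for v
  proof -
    have "\<bar>g v\<bar> \<le> \<bar>k * v\<bar> + \<bar>g v - k * v\<bar>" by linarith
    then show ?thesis using r(2)[OF that] by (simp add: \<kappa>_def abs_mult distrib_right)
  qed
  have small: "\<bar>x t\<bar> < \<delta>" if "is_solution \<alpha> (delay_rhs \<gamma> g \<tau>2) \<tau>1 \<tau>2 \<phi> T x" "0 < \<delta>" "\<delta> \<le> r" "history_near \<tau>1 \<tau>2 0 \<delta> \<phi>"
    "- (\<tau>1 + \<tau>2) \<le> t" "ereal t < T" for x T \<delta> \<phi> t
    by (rule delay_solution_stays_small[OF that(1) \<alpha> \<gamma>0 gc \<tau> gk \<kappa> that(2-6)])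
  show ?thesis
    unfolding asymptotically_stable_equilibrium_def stable_equilibrium_def
  proof (intro conjI allI impI)
    fix \<epsilon> :: real assume \<epsilon>: "\<epsilon> > 0"
    show "\<exists>\<delta>>0. \<forall>\<phi>. history_near \<tau>1 \<tau>2 0 \<delta> \<phi> \<longrightarrow>
        (\<forall>T x. is_solution \<alpha> (delay_rhs \<gamma> g \<tau>2) \<tau>1 \<tau>2 \<phi> T x \<longrightarrow> (\<forall>t\<ge>0. ereal t < T \<longrightarrow> \<bar>x t - 0\<bar> < \<epsilon>))"
    proof (intro exI[of _ "min \<epsilon> r"] conjI allI impI)
      fix \<phi> T x and t :: real assume "history_near \<tau>1 \<tau>2 0 (min \<epsilon> r) \<phi>" "is_solution \<alpha> (delay_rhs \<gamma> g \<tau>2) \<tau>1 \<tau>2 \<phi> T x"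
        "0 \<le> t" "ereal t < T"
      then have "\<bar>x t\<bar> < min \<epsilon> r" using small[of \<phi> T x "min \<epsilon> r" t] \<epsilon> r(1) \<tau> by auto
      then show "\<bar>x t - 0\<bar> < \<epsilon>" by simp
    qed (use \<epsilon> r in auto)
  next
    show "\<exists>\<delta>>0. \<forall>\<phi>. history_near \<tau>1 \<tau>2 0 \<delta> \<phi> \<longrightarrow> (\<exists>x. is_solution \<alpha> (delay_rhs \<gamma> g \<tau>2) \<tau>1 \<tau>2 \<phi> \<infinity> x) \<and>
          (\<forall>x. is_solution \<alpha> (delay_rhs \<gamma> g \<tau>2) \<tau>1 \<tau>2 \<phi> \<infinity> x \<longrightarrow> (x \<longlongrightarrow> 0) at_top)"
    proof (intro exI[of _ r] conjI allI impI)
      fix \<phi> assume near: "history_near \<tau>1 \<tau>2 0 r \<phi>"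
      obtain x where x: "is_solution \<alpha> (delay_rhs \<gamma> (truncate r g) \<tau>2) \<tau>1 \<tau>2 \<phi> \<infinity> x"
        using truncated_solution_exists[OF g(1) r(1) \<alpha> \<tau>] near unfolding history_near_def by blast
      have tk: "\<bar>truncate r g v\<bar> \<le> \<kappa> * \<bar>v\<bar>" if "\<bar>v\<bar> \<le> r" for v using gk[OF that] truncate_eq[OF that] by simp
      have xs: "\<bar>x t\<bar> < r" if "- (\<tau>1 + \<tau>2) \<le> t" for t
        by (rule delay_solution_stays_small[OF x \<alpha> \<gamma>0 continuous_truncate[OF gc] \<tau> tk \<kappa> r(1) order_refl near that]) simp_all
      have "is_solution \<alpha> (delay_rhs \<gamma> g \<tau>2) \<tau>1 \<tau>2 \<phi> \<infinity> x"
        by (rule is_solution_transfer[OF x]) (use \<tau> xs in \<open>auto simp: delay_rhs_def truncate_eq less_imp_le\<close>)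
      then show "\<exists>x. is_solution \<alpha> (delay_rhs \<gamma> g \<tau>2) \<tau>1 \<tau>2 \<phi> \<infinity> x" by (intro exI[of _ x])
    next
      fix \<phi> x assume near: "history_near \<tau>1 \<tau>2 0 r \<phi>" and sol: "is_solution \<alpha> (delay_rhs \<gamma> g \<tau>2) \<tau>1 \<tau>2 \<phi> \<infinity> x"
      show "(x \<longlongrightarrow> 0) at_top"
        by (rule delay_solution_tendsto_0[OF sol \<alpha> \<gamma>0 gc \<tau> gk \<kappa> _ r(1)])
           (use small[OF sol r(1) order_refl near] in \<open>auto intro: less_imp_le\<close>)
    qed (use r in auto)
  qed
qed

section \<open>Laplace transforms and the Plancherel identity\<close>

text \<open>
  For real \<open>z\<close> this is a Gamma integral. For complex \<open>z\<close>, every point of the right half-plane lies in the disc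
  of radius \<open>a\<close> about a large real \<open>a\<close>. Expanding \<open>exp ((a - z) t)\<close> there and integrating termwise gives
  the binomial series of \<open>z powr (- \<beta>)\<close> around \<open>a\<close>.
\<close>
lemma frac_kernel_laplace_complex:
  assumes \<beta>: "\<beta> > 0" and z: "Re z > 0"
  shows "has_bochner_integral lborel (\<lambda>t. exp (- z * of_real t) * of_real (frac_kernel \<beta> t)) (z powr (- of_real \<beta>))"
proof -
  \<comment> \<open>Any \<open>a > (cmod z)\<^sup>2 / (2 Re z)\<close> satisfies \<open>cmod (a - z) < a\<close>.\<close>
  define a where "a = (cmod z)\<^sup>2 / Re z"
  have z0: "z \<noteq> 0" "cmod z > 0" using z by auto
  have a: "a > 0" using z z0 by (simp add: a_def)
  have az: "cmod (a - z) < a"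
  proof -
    have "(cmod (a - z))\<^sup>2 = a\<^sup>2 - 2 * (a * Re z) + (cmod z)\<^sup>2"
      by (simp only: cmod_power2) (simp add: power2_eq_square algebra_simps)
    moreover have "a * Re z = (cmod z)\<^sup>2" using z by (simp add: a_def)
    ultimately have "(cmod (a - z))\<^sup>2 = a\<^sup>2 - (cmod z)\<^sup>2" by simp
    then have "(cmod (a - z))\<^sup>2 < a\<^sup>2" using z0 by simp
    then show ?thesis by (rule power2_less_imp_less) (use a in simp)
  qed
  define w where "w = (z - of_real a) / of_real a"
  have w: "cmod w < 1" using az a by (simp add: w_def norm_divide norm_minus_commute)
  have G: "Gamma \<beta> > 0" using \<beta> by (simp add: Gamma_real_pos)
  define c where "c = (\<lambda>n. pochhammer \<beta> n / fact n)"
  have cnn: "c n \<ge> 0" for n using \<beta> by (simp add: c_def pochhammer_nonneg)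
  define f where "f = (\<lambda>n t. (of_real (exp (- a * t) * (frac_kernel \<beta> t * t ^ n)) * (of_real a - z) ^ n / fact n :: complex))"
  have shift: "frac_kernel \<beta> t * t ^ n = pochhammer \<beta> n * frac_kernel (\<beta> + real n) t" for n t
  proof (cases "t > 0")
    case True
    have "Gamma (\<beta> + real n) = pochhammer \<beta> n * Gamma \<beta>"
    proof -
      have "\<beta> \<notin> \<int>\<^sub>\<le>\<^sub>0" using \<beta> by (auto elim!: nonpos_Ints_cases)
      then show ?thesis using pochhammer_Gamma[of \<beta> n] G by (simp add: field_simps)
    qed
    moreover have "t powr (\<beta> + real n - 1) = t powr (\<beta> - 1) * t ^ n"
      using True by (simp add: powr_realpow[symmetric] powr_add[symmetric] algebra_simps)
    moreover have "pochhammer \<beta> n > 0" using \<beta> by (rule pochhammer_pos)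
    ultimately show ?thesis using True G by (simp add: frac_kernel_def)
  qed (simp add: frac_kernel_def)
  have int: "has_bochner_integral lborel (\<lambda>t. exp (- a * t) * (frac_kernel \<beta> t * t ^ n)) (pochhammer \<beta> n * a powr (- \<beta> - real n))" for n
  proof -
    have "has_bochner_integral lborel (\<lambda>t. pochhammer \<beta> n * (exp (- a * t) * frac_kernel (\<beta> + real n) t)) (pochhammer \<beta> n * a powr (- (\<beta> + real n)))"
      by (intro has_bochner_integral_mult_right frac_kernel_laplace_real) (use \<beta> a in auto)
    then show ?thesis unfolding shift by (simp add: mult_ac)
  qed
  have fint: "has_bochner_integral lborel (f n) (of_real (a powr - \<beta>) * ((- of_real \<beta> gchoose n) * w ^ n))" for n
  proof -
    have "has_bochner_integral lborel (f n) (of_real (pochhammer \<beta> n * a powr (- \<beta> - real n)) * (of_real a - z) ^ n / fact n)"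
      unfolding f_def by (intro has_bochner_integral_divide_zero has_bochner_integral_mult_left has_bochner_integral_of_real int)
    also have "of_real (pochhammer \<beta> n * a powr (- \<beta> - real n)) * (of_real a - z) ^ n / fact n
       = of_real (a powr - \<beta>) * ((- of_real \<beta> gchoose n) * w ^ n)"
    proof -
      have 1: "a powr (- \<beta> - real n) = a powr (- \<beta>) / a ^ n" using a by (simp add: powr_diff powr_realpow)
      have 2: "(- of_real \<beta> gchoose n) = (- 1) ^ n * of_real (pochhammer \<beta> n) / (fact n :: complex)"
        by (simp add: gbinomial_pochhammer pochhammer_of_real)
      have 3: "(of_real a - z) ^ n = (- 1) ^ n * (of_real a * w) ^ n"
        using a by (simp add: w_def power_mult_distrib[symmetric])
      show ?thesis unfolding 1 2 3 using a by (simp add: power_mult_distrib field_simps)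
    qed
    finally show ?thesis .
  qed
  have nf: "norm (f n t) = exp (- a * t) * (frac_kernel \<beta> t * t ^ n) * (cmod (of_real a - z) ^ n / fact n)" for n t
  proof -
    have "frac_kernel \<beta> t * t ^ n \<ge> 0" using frac_kernel_nonneg[OF \<beta>, of t]
      by (cases "t > 0") (auto simp: frac_kernel_nonpos_eq_0)
    then have "exp (- a * t) * (frac_kernel \<beta> t * t ^ n) \<ge> 0" by (rule mult_nonneg_nonneg[OF exp_ge_zero])
    from abs_of_nonneg[OF this] show ?thesis
      by (simp only: f_def norm_mult[where 'a=complex] norm_divide norm_power norm_of_real norm_fact times_divide_eq_right)
  qed
  have nfint: "(LINT t|lborel. norm (f n t)) = a powr (- \<beta>) * (norm ((- \<beta>) gchoose n) * (cmod w) ^ n)" for n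
  proof -
    have "(LINT t|lborel. norm (f n t)) = (pochhammer \<beta> n * a powr (- \<beta> - real n)) * (cmod (of_real a - z) ^ n / fact n)"
      unfolding nf using int[of n] by (subst integral_mult_left_zero) (simp add: has_bochner_integral_iff)
    also have "cmod (of_real a - z) = a * cmod w" using a by (simp add: w_def norm_divide norm_minus_commute)
    also have "a powr (- \<beta> - real n) = a powr (- \<beta>) / a ^ n" using a by (simp add: powr_diff powr_realpow)
    also have "norm ((- \<beta>) gchoose n) = pochhammer \<beta> n / fact n"
      using \<beta> by (simp add: gbinomial_pochhammer abs_mult pochhammer_nonneg)
    ultimately show ?thesis using a by (simp add: power_mult_distrib)
  qed
  have "summable (\<lambda>n. ((- \<beta>) gchoose n) * (- cmod w) ^ n)"
    using gen_binomial_real[of "- cmod w" "- \<beta>"] w by (simp add: sums_iff)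
  also have "(\<lambda>n. ((- \<beta>) gchoose n) * (- cmod w) ^ n) = (\<lambda>n. norm ((- \<beta>) gchoose n) * (cmod w) ^ n)"
  proof
    fix n
    have "((- \<beta>) gchoose n) = (- 1) ^ n * c n" by (simp add: gbinomial_pochhammer c_def)
    then show "((- \<beta>) gchoose n) * (- cmod w) ^ n = norm ((- \<beta>) gchoose n) * (cmod w) ^ n"
      using cnn[of n] by (simp add: abs_mult power_minus[of "cmod w"])
  qed
  finally have sm: "summable (\<lambda>n. LINT t|lborel. norm (f n t))" unfolding nfint by (rule summable_mult)
  have pt: "(\<lambda>n. f n t) sums (exp (- z * of_real t) * of_real (frac_kernel \<beta> t))" and ps: "summable (\<lambda>n. norm (f n t))" for t
  proof -
    have fe: "f n t = of_real (exp (- a * t) * frac_kernel \<beta> t) * (((of_real a - z) * of_real t) ^ n /\<^sub>R fact n)" for n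
      by (simp only: f_def power_mult_distrib scaleR_conv_of_real of_real_mult of_real_power)
         (simp add: divide_inverse mult_ac)
    have "(\<lambda>n. f n t) sums (of_real (exp (- a * t) * frac_kernel \<beta> t) * exp ((of_real a - z) * of_real t))"
      unfolding fe by (intro sums_mult exp_converges)
    also have "of_real (exp (- a * t) * frac_kernel \<beta> t) * exp ((of_real a - z) * of_real t) = exp (- z * of_real t) * of_real (frac_kernel \<beta> t)"
    proof -
      have "exp (complex_of_real (- a * t)) * exp ((of_real a - z) * of_real t) = exp (- z * of_real t)"
        by (simp add: exp_add[symmetric] algebra_simps)
      then show ?thesis by (simp only: of_real_mult exp_of_real[symmetric] mult.assoc mult.commute[of "of_real (frac_kernel \<beta> t)"])
          (simp only: mult.assoc[symmetric])
    qed
    finally show "(\<lambda>n. f n t) sums (exp (- z * of_real t) * of_real (frac_kernel \<beta> t))" .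
    show "summable (\<lambda>n. norm (f n t))" unfolding fe norm_mult by (intro summable_mult summable_norm_exp)
  qed
  have fi: "integrable lborel (f n)" for n using fint by (simp add: has_bochner_integral_iff)
  have su: "(\<Sum>n. f n t) = exp (- z * of_real t) * of_real (frac_kernel \<beta> t)" for t using pt by (simp add: sums_iff)
  have "(\<lambda>n. integral\<^sup>L lborel (f n)) sums (LINT t|lborel. exp (- z * of_real t) * of_real (frac_kernel \<beta> t))"
    using sums_integral[of lborel f, OF fi AE_I2[OF ps] sm] by (simp only: su)
  then have s1: "(\<lambda>n. of_real (a powr - \<beta>) * ((- of_real \<beta> gchoose n) * w ^ n)) sums (LINT t|lborel. exp (- z * of_real t) * of_real (frac_kernel \<beta> t))"
    using fint by (simp add: has_bochner_integral_iff)
  have s2: "(\<lambda>n. of_real (a powr - \<beta>) * ((- of_real \<beta> gchoose n) * w ^ n)) sums (of_real (a powr - \<beta>) * (1 + w) powr (- of_real \<beta>))"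
    by (intro sums_mult gen_binomial_complex w)
  have "of_real (a powr - \<beta>) * (1 + w) powr (- of_real \<beta>) = z powr (- of_real \<beta>)"
  proof -
    have "1 + w = z / of_real a" using a by (simp add: w_def field_simps)
    moreover have "Ln (z / of_real a) = Ln z - of_real (ln a)" using a z0 by (simp add: Ln_divide_of_real Ln_of_real)
    ultimately have "(1 + w) powr (- of_real \<beta>) = exp (- of_real \<beta> * (Ln z - of_real (ln a)))" using z0 a by (simp add: powr_def)
    also have "\<dots> = exp (- of_real \<beta> * Ln z) * exp (of_real (\<beta> * ln a))" by (simp add: exp_add[symmetric] algebra_simps)
    also have "exp (- of_real \<beta> * Ln z) = z powr (- of_real \<beta>)" using z0 by (simp add: powr_def)
    also have "exp (of_real (\<beta> * ln a)) = (of_real (a powr \<beta>) :: complex)" 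
      unfolding exp_of_real using a by (simp add: powr_def)
    finally show ?thesis using a by (simp add: powr_minus field_simps)
  qed
  with sums_unique2[OF s1 s2] have "(LINT t|lborel. exp (- z * of_real t) * of_real (frac_kernel \<beta> t)) = z powr (- of_real \<beta>)" by simp
  moreover have "integrable lborel (\<lambda>t. exp (- z * of_real t) * of_real (frac_kernel \<beta> t))"
    using integrable_suminf[of lborel f, OF fi AE_I2[OF ps] sm] by (simp only: su)
  ultimately show ?thesis by (simp add: has_bochner_integral_iff)
qed

definition laplace :: "(real \<Rightarrow> real) \<Rightarrow> complex \<Rightarrow> complex" where
  "laplace u z = (LINT t|lborel. exp (- z * of_real t) * of_real (u t))"

lemma weighted_integrable_iff:
  assumes [measurable]: "u \<in> borel_measurable borel"
  shows "integrable lborel (\<lambda>t. exp (- z * complex_of_real t) * of_real (u t)) \<longleftrightarrow> integrable lborel (\<lambda>t. exp (- Re z * t) * u t)"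
proof -
  have "integrable lborel (\<lambda>t. exp (- z * complex_of_real t) * of_real (u t))
     \<longleftrightarrow> integrable lborel (\<lambda>t. norm (exp (- z * complex_of_real t) * of_real (u t)))"
    by (rule integrable_norm_iff[symmetric]) measurable
  also have "(\<lambda>t. norm (exp (- z * complex_of_real t) * of_real (u t))) = (\<lambda>t. norm (exp (- Re z * t) * u t))"
    by (simp add: norm_mult abs_mult)
  also have "integrable lborel \<dots> \<longleftrightarrow> integrable lborel (\<lambda>t. exp (- Re z * t) * u t)"
    by (rule integrable_norm_iff) measurable
  finally show ?thesis .
qed

lemma laplace_conv:
  assumes [measurable]: "a \<in> borel_measurable borel" "b \<in> borel_measurable borel"
    and a: "integrable lborel (\<lambda>t. exp (- Re z * t) * a t)" and b: "integrable lborel (\<lambda>t. exp (- Re z * t) * b t)"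
  shows "laplace (conv a b) z = laplace a z * laplace b z"
proof -
  let ?a = "\<lambda>t. exp (- z * of_real t) * of_real (a t)" and ?b = "\<lambda>t. exp (- z * of_real t) * of_real (b t)"
  have "laplace a z * laplace b z = (LINT t|lborel. LINT s|lborel. ?a (t - s) * ?b s)"
    unfolding laplace_def by (rule conv_L1_Fubini(2)[symmetric]) (intro iffD2[OF weighted_integrable_iff] a b assms)+
  also have "(\<lambda>t. LINT s|lborel. ?a (t - s) * ?b s) = (\<lambda>t. exp (- z * of_real t) * of_real (conv a b t))"
  proof
    fix t
    have e: "?a (t - s) * ?b s = exp (- z * of_real t) * of_real (a (t - s) * b s)" for s
    proof -
      have "exp (- z * of_real (t - s)) * exp (- z * of_real s) = exp (- z * of_real t)"
        by (simp add: exp_add[symmetric] algebra_simps)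
      then show ?thesis by (metis (no_types, opaque_lifting) mult.assoc mult.left_commute of_real_mult)
    qed
    then show "(LINT s|lborel. ?a (t - s) * ?b s) = exp (- z * of_real t) * of_real (conv a b t)"
      by (simp only: e conv_def integral_mult_right_zero integral_complex_of_real)
  qed
  finally show ?thesis by (simp add: laplace_def)
qed

lemma laplace_shift: "laplace (\<lambda>t. u (t - r)) z = exp (- z * of_real r) * laplace u z"
proof -
  have "laplace (\<lambda>t. u (t - r)) z = (LINT t|lborel. exp (- z * of_real (r + 1 * t)) * of_real (u (r + 1 * t - r)))"
    unfolding laplace_def by (subst lborel_integral_real_affine[of 1 _ r]) auto
  also have "\<dots> = (LINT t|lborel. exp (- z * of_real r) * (exp (- z * of_real t) * of_real (u t)))"
  proof -
    have "exp (- z * of_real (r + 1 * t)) = exp (- z * of_real r) * exp (- z * of_real t)" for t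
      by (simp add: exp_add[symmetric] algebra_simps)
    then show ?thesis by (simp add: mult.assoc)
  qed
  finally show ?thesis by (simp add: laplace_def)
qed

lemma laplace_measurable [measurable]:
  assumes [measurable]: "u \<in> borel_measurable borel" "c \<in> borel_measurable borel"
  shows "(\<lambda>w. laplace u (c w)) \<in> borel_measurable borel"
  unfolding laplace_def by measurable

text \<open>
  The characteristic function of the standard normal distribution, rescaled.
\<close>
lemma gaussian_fourier:
  assumes "N > 0"
  shows "(LINT w|lborel. of_real (exp (- (w / N)\<^sup>2 / 2)) * exp (- (\<i> * of_real w * of_real t)))
      = complex_of_real (N * sqrt (2 * pi) * exp (- (N * t)\<^sup>2 / 2))"
proof -
  have "(LINT w|lborel. of_real (exp (- (w / N)\<^sup>2 / 2)) * exp (- (\<i> * of_real w * of_real t)))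
     = N *\<^sub>R (LINT x|lborel. of_real (exp (- x\<^sup>2 / 2)) * exp (- (\<i> * of_real (N * x) * of_real t)))"
    using assms by (subst lborel_integral_real_affine[of N _ 0]) auto
  also have "(LINT x|lborel. of_real (exp (- x\<^sup>2 / 2)) * exp (- (\<i> * of_real (N * x) * of_real t)))
     = (LINT x|lborel. of_real (sqrt (2 * pi)) * (std_normal_density x *\<^sub>R iexp ((- (N * t)) * x)))"
    by (intro Bochner_Integration.integral_cong) (auto simp: std_normal_density_def scaleR_conv_of_real mult_ac)
  also have "\<dots> = of_real (sqrt (2 * pi)) * (LINT x|lborel. std_normal_density x *\<^sub>R iexp ((- (N * t)) * x))"
    by (rule integral_mult_right_zero)
  also have "(LINT x|lborel. std_normal_density x *\<^sub>R iexp ((- (N * t)) * x)) = (CLINT x|std_normal_distribution. iexp ((- (N * t)) * x))"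
    by (rule integral_density[symmetric]) auto
  also have "(CLINT x|std_normal_distribution. iexp ((- (N * t)) * x)) = of_real (exp (- (N * t)\<^sup>2 / 2))"
    using fun_cong[OF char_std_normal_distribution, of "- (N * t)"] by (simp add: char_def)
  finally show ?thesis by (simp add: scaleR_conv_of_real)
qed

text \<open>
  The Plancherel identity for bounded integrable functions, by Gaussian regularization. The squared modulus
  of the Fourier transform of \<open>h\<close> is the Fourier transform of the autocorrelation of \<open>h\<close>, whose value at 0 is the squared norm of \<open>h\<close>. Integrating
  against a wide Gaussian turns into averaging the autocorrelation over a narrow one. The
  autocorrelation is largest at 0, which gives one inequality in general; its continuity at 0 gives the other.
\<close>
context
  fixes h :: "real \<Rightarrow> real" and M :: real
  assumes h: "integrable lborel h" and M: "\<And>t. \<bar>h t\<bar> \<le> M"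
begin

private definition "autocorrelation t = (LINT s|lborel. h (s + t) * h s)"

private lemma hm: "h \<in> borel_measurable borel" using h by auto

private lemma shifted_product_integrable: "integrable lborel (\<lambda>s. h (s + t) * h s)"
proof -
  note [measurable] = hm
  have "integrable lborel (\<lambda>s. M * h s)" using h by simp
  then show ?thesis
    by (rule Bochner_Integration.integrable_bound)
       (use M in \<open>auto simp: abs_mult intro!: AE_I2 mult_right_mono intro: order_trans[OF M abs_ge_self]\<close>)
qed

lemma square_integrable: "integrable lborel (\<lambda>t. (h t)\<^sup>2)"
  using shifted_product_integrable[of 0] by (simp add: power2_eq_square)

private lemma autocorrelation_le: "\<bar>autocorrelation t\<bar> \<le> (LINT s|lborel. (h s)\<^sup>2)"
proof -
  have i: "integrable lborel (\<lambda>s. (h (s + t))\<^sup>2)"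
    using lborel_integrable_real_affine[OF square_integrable, of 1 t] by (simp add: add.commute)
  have e: "(LINT s|lborel. (h (s + t))\<^sup>2) = (LINT s|lborel. (h s)\<^sup>2)"
    using lborel_integral_real_affine[of 1 "\<lambda>s. (h s)\<^sup>2" t] by (simp add: add.commute)
  have "\<bar>autocorrelation t\<bar> \<le> (LINT s|lborel. \<bar>h (s + t) * h s\<bar>)" unfolding autocorrelation_def by (rule integral_abs_bound)
  also have "\<dots> \<le> (LINT s|lborel. (h (s + t))\<^sup>2 / 2 + (h s)\<^sup>2 / 2)"
  proof (rule integral_mono)
    show "integrable lborel (\<lambda>s. \<bar>h (s + t) * h s\<bar>)" using shifted_product_integrable by simp
    show "integrable lborel (\<lambda>s. (h (s + t))\<^sup>2 / 2 + (h s)\<^sup>2 / 2)" using i square_integrable by simp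
    fix s
    have "0 \<le> (\<bar>h (s + t)\<bar> - \<bar>h s\<bar>)\<^sup>2" by simp
    then show "\<bar>h (s + t) * h s\<bar> \<le> (h (s + t))\<^sup>2 / 2 + (h s)\<^sup>2 / 2"
      by (simp add: power2_diff abs_mult)
  qed
  also have "\<dots> = (LINT s|lborel. (h s)\<^sup>2)" using i square_integrable e by simp
  finally show ?thesis .
qed

private lemma autocorrelation_fourier: "integrable lborel autocorrelation"
    "of_real ((cmod (laplace h (\<i> * of_real w)))\<^sup>2) = (LINT t|lborel. exp (- (\<i> * of_real w * of_real t)) * of_real (autocorrelation t))"
proof -
  note [measurable] = hm
  have hr: "integrable lborel (\<lambda>s. h (- s))" using lborel_integrable_real_affine[OF h, of "-1" 0] by simp
  have autocorrelation: "autocorrelation = (\<lambda>t. LINT s|lborel. h (t - s) * h (- s))"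
  proof
    fix t
    show "autocorrelation t = (LINT s|lborel. h (t - s) * h (- s))"
      unfolding autocorrelation_def using lborel_integral_real_affine[of "-1" "\<lambda>s. h (s + t) * h s" 0] by (simp add: add.commute)
  qed
  show "integrable lborel autocorrelation" unfolding autocorrelation by (rule conv_L1_Fubini(1)[OF h hr])
  let ?a = "\<lambda>t. exp (- (\<i> * of_real w * of_real t)) * of_real (h t) :: complex"
  let ?b = "\<lambda>t. exp (- (\<i> * of_real w * of_real t)) * of_real (h (- t)) :: complex"
  have wi: "integrable lborel (\<lambda>t. exp (- (\<i> * of_real w * of_real t)) * complex_of_real (u t))"
    if "integrable lborel u" for u
  proof (rule Bochner_Integration.integrable_bound[OF that])
    have [measurable]: "u \<in> borel_measurable borel" using that by auto
    show "(\<lambda>t. exp (- (\<i> * of_real w * of_real t)) * complex_of_real (u t)) \<in> borel_measurable lborel" by measurable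
  qed (auto simp: norm_mult)
  have "(LINT t|lborel. ?b t) = cnj (LINT t|lborel. ?a t)"
  proof -
    have "(LINT t|lborel. ?b t) = (LINT t|lborel. cnj (?a t))"
      using lborel_integral_real_affine[of "-1" ?b 0] by (simp add: exp_cnj)
    then show ?thesis by (simp only: Bochner_Integration.integral_cnj)
  qed
  moreover have "laplace h (\<i> * of_real w) = (LINT t|lborel. ?a t)" by (simp add: laplace_def)
  ultimately have "of_real ((cmod (laplace h (\<i> * of_real w)))\<^sup>2) = (LINT t|lborel. ?a t) * (LINT t|lborel. ?b t)"
    by (simp only: complex_norm_square)
  also have "\<dots> = (LINT t|lborel. LINT s|lborel. ?a (t - s) * ?b s)"
    by (rule conv_L1_Fubini(2)[symmetric]) (intro wi h hr)+
  also have "(\<lambda>t. LINT s|lborel. ?a (t - s) * ?b s) = (\<lambda>t. exp (- (\<i> * of_real w * of_real t)) * of_real (autocorrelation t))"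
  proof
    fix t
    have e: "?a (t - s) * ?b s = exp (- (\<i> * of_real w * of_real t)) * of_real (h (t - s) * h (- s))" for s
    proof -
      have "exp (- (\<i> * of_real w * of_real (t - s))) * exp (- (\<i> * of_real w * of_real s)) = (exp (- (\<i> * of_real w * of_real t)) :: complex)"
        by (simp add: exp_add[symmetric] algebra_simps)
      then show ?thesis by (metis (no_types, opaque_lifting) mult.assoc mult.left_commute of_real_mult)
    qed
    then show "(LINT s|lborel. ?a (t - s) * ?b s) = exp (- (\<i> * of_real w * of_real t)) * of_real (autocorrelation t)"
      by (simp only: e integral_mult_right_zero integral_complex_of_real autocorrelation)
  qed
  finally show "of_real ((cmod (laplace h (\<i> * of_real w)))\<^sup>2) = (LINT t|lborel. exp (- (\<i> * of_real w * of_real t)) * of_real (autocorrelation t))" .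
qed

private lemma gaussian_plancherel:
  assumes N: "N > 0"
  shows "integrable lborel (\<lambda>w. exp (- (w / N)\<^sup>2 / 2) * (cmod (laplace h (\<i> * of_real w)))\<^sup>2)" (is ?A)
    and "(LINT w|lborel. exp (- (w / N)\<^sup>2 / 2) * (cmod (laplace h (\<i> * of_real w)))\<^sup>2)
      = 2 * pi * (LINT x|lborel. std_normal_density x * autocorrelation (x / N))" (is ?B)
proof -
  have [measurable]: "autocorrelation \<in> borel_measurable borel" using autocorrelation_fourier(1) by auto
  let ?n = "\<lambda>w. exp (- (w / N)\<^sup>2 / 2)"
  have n0: "integrable lborel ?n"
  proof -
    have "integrable lborel (\<lambda>x. sqrt (2 * pi) * std_normal_density (0 + (1 / N) * x))"
      by (intro integrable_mult_right lborel_integrable_real_affine integrable_normal_density) (use N in auto)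
    then show ?thesis by (simp add: std_normal_density_def)
  qed
  let ?F = "\<lambda>w t. complex_of_real (?n w) * (exp (- (\<i> * of_real w * of_real t)) * of_real (autocorrelation t))"
  have I: "integrable (lborel \<Otimes>\<^sub>M lborel) (\<lambda>(w, t). ?F w t)"
  proof (rule lborel_pair.Fubini_integrable)
    show "integrable lborel (\<lambda>w. LINT t|lborel. norm (case (w, t) of (w, t) \<Rightarrow> ?F w t))"
      using n0 by (simp add: norm_mult)
    show "AE w in lborel. integrable lborel (\<lambda>t. case (w, t) of (w, t) \<Rightarrow> ?F w t)"
    proof (rule AE_I2)
      fix w
      have "integrable lborel (\<lambda>t. ?n w * autocorrelation t)" using autocorrelation_fourier(1) by simp
      then show "integrable lborel (\<lambda>t. case (w, t) of (w, t) \<Rightarrow> ?F w t)"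
        by (rule Bochner_Integration.integrable_bound) (auto simp: norm_mult)
    qed
  qed measurable
  have inner: "(LINT t|lborel. ?F w t) = of_real (?n w * (cmod (laplace h (\<i> * of_real w)))\<^sup>2)" for w
    unfolding of_real_mult autocorrelation_fourier(2) by simp
  have J: "integrable lborel (\<lambda>w. complex_of_real (?n w * (cmod (laplace h (\<i> * of_real w)))\<^sup>2))"
    using lborel_pair.integrable_fst[OF I] by (simp only: inner)
  then show ?A by (simp only: complex_of_real_integrable_eq)
  have "complex_of_real (LINT w|lborel. ?n w * (cmod (laplace h (\<i> * of_real w)))\<^sup>2) = (LINT w|lborel. LINT t|lborel. ?F w t)"
    by (simp only: inner integral_complex_of_real)
  also have "\<dots> = (LINT t|lborel. LINT w|lborel. ?F w t)"
    using lborel_pair.Fubini_integral[OF I] by simp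
  also have "(\<lambda>t. LINT w|lborel. ?F w t) = (\<lambda>t. complex_of_real (N * sqrt (2 * pi) * exp (- (N * t)\<^sup>2 / 2) * autocorrelation t))"
  proof
    fix t
    have "(LINT w|lborel. ?F w t) = (LINT w|lborel. (of_real (?n w) * exp (- (\<i> * of_real w * of_real t))) * of_real (autocorrelation t))"
      by (simp add: mult.assoc)
    also have "\<dots> = (LINT w|lborel. of_real (?n w) * exp (- (\<i> * of_real w * of_real t))) * of_real (autocorrelation t)" by simp
    finally show "(LINT w|lborel. ?F w t) = complex_of_real (N * sqrt (2 * pi) * exp (- (N * t)\<^sup>2 / 2) * autocorrelation t)"
      unfolding gaussian_fourier[OF N] by simp
  qed
  also have "(LINT t|lborel. complex_of_real (N * sqrt (2 * pi) * exp (- (N * t)\<^sup>2 / 2) * autocorrelation t))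
     = of_real (LINT t|lborel. N * sqrt (2 * pi) * exp (- (N * t)\<^sup>2 / 2) * autocorrelation t)" by (rule integral_complex_of_real)
  also have "(LINT t|lborel. N * sqrt (2 * pi) * exp (- (N * t)\<^sup>2 / 2) * autocorrelation t)
     = (1 / N) * (LINT x|lborel. N * sqrt (2 * pi) * exp (- (N * (0 + (1 / N) * x))\<^sup>2 / 2) * autocorrelation (0 + (1 / N) * x))"
    using N by (subst lborel_integral_real_affine[of "1 / N" _ 0]) auto
  also have "(\<lambda>x. N * sqrt (2 * pi) * exp (- (N * (0 + (1 / N) * x))\<^sup>2 / 2) * autocorrelation (0 + (1 / N) * x))
     = (\<lambda>x. (N * (2 * pi)) * (std_normal_density x * autocorrelation (x / N)))"
    using N by (auto simp: fun_eq_iff std_normal_density_def real_sqrt_mult field_simps)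
  also have "(1 / N) * (LINT x|lborel. (N * (2 * pi)) * (std_normal_density x * autocorrelation (x / N)))
     = 2 * pi * (LINT x|lborel. std_normal_density x * autocorrelation (x / N))" using N by simp
  finally show ?B by (simp only: of_real_eq_iff)
qed

private lemma normal_autocorrelation_integrable: "integrable lborel (\<lambda>x. std_normal_density x * autocorrelation (x / N))"
proof -
  have [measurable]: "autocorrelation \<in> borel_measurable borel" using autocorrelation_fourier(1) by auto
  have "integrable lborel (\<lambda>x. (LINT s|lborel. (h s)\<^sup>2) * std_normal_density x)"
    by (intro integrable_mult_right integrable_normal_density) simp
  then show ?thesis
  proof (rule Bochner_Integration.integrable_bound)
    show "AE x in lborel. norm (std_normal_density x * autocorrelation (x / N)) \<le> norm ((LINT s|lborel. (h s)\<^sup>2) * std_normal_density x)"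
      using autocorrelation_le by (intro AE_I2) (auto simp: abs_mult mult.commute[of "std_normal_density _"] intro!: mult_right_mono intro: order_trans[OF autocorrelation_le abs_ge_self])
  qed measurable
qed

lemma plancherel_le:
  shows "integrable lborel (\<lambda>w. (cmod (laplace h (\<i> * of_real w)))\<^sup>2)" (is ?A)
    and "(LINT w|lborel. (cmod (laplace h (\<i> * of_real w)))\<^sup>2) \<le> 2 * pi * (LINT t|lborel. (h t)\<^sup>2)" (is ?B)
proof -
  note [measurable] = hm
  define E where "E = (LINT t|lborel. (h t)\<^sup>2)"
  have E: "E \<ge> 0" by (simp add: E_def)
  define f where "f = (\<lambda>w. (cmod (laplace h (\<i> * of_real w)))\<^sup>2)"
  have [measurable]: "f \<in> borel_measurable borel" unfolding f_def by measurable
  let ?n = "\<lambda>k w. exp (- (w / real (Suc k))\<^sup>2 / 2)"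
  have "(\<integral>\<^sup>+ w. ennreal (f w) \<partial>lborel) = (\<integral>\<^sup>+ w. liminf (\<lambda>k. ennreal (?n k w * f w)) \<partial>lborel)"
  proof (rule nn_integral_cong)
    fix w
    have "(\<lambda>k. w / real (Suc k)) \<longlonglongrightarrow> 0"
      using tendsto_mult[OF tendsto_const[of w] LIMSEQ_inverse_real_of_nat] by (simp add: divide_inverse)
    then have "(\<lambda>k. ?n k w * f w) \<longlonglongrightarrow> exp (- 0\<^sup>2 / 2) * f w" by (intro tendsto_intros) auto
    then have "(\<lambda>k. ennreal (?n k w * f w)) \<longlonglongrightarrow> ennreal (f w)" by (intro tendsto_ennrealI) simp
    then show "ennreal (f w) = liminf (\<lambda>k. ennreal (?n k w * f w))"
      by (intro lim_imp_Liminf[symmetric]) auto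
  qed
  also have "\<dots> \<le> liminf (\<lambda>k. \<integral>\<^sup>+ w. ennreal (?n k w * f w) \<partial>lborel)"
    by (rule nn_integral_liminf) measurable
  also have "\<dots> \<le> ennreal (2 * pi * E)"
  proof (rule Liminf_le[OF sequentially_bot], rule always_eventually, rule allI)
    fix k
    have "(\<integral>\<^sup>+ w. ennreal (?n k w * f w) \<partial>lborel) = ennreal (LINT w|lborel. ?n k w * f w)"
      unfolding f_def by (rule nn_integral_eq_integral[OF gaussian_plancherel(1)]) auto
    also have "(LINT w|lborel. ?n k w * f w) = 2 * pi * (LINT x|lborel. std_normal_density x * autocorrelation (x / real (Suc k)))"
      unfolding f_def by (rule gaussian_plancherel(2)) simp
    also have "\<dots> \<le> 2 * pi * (LINT x|lborel. std_normal_density x * E)"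
      using autocorrelation_le by (intro mult_left_mono integral_mono normal_autocorrelation_integrable integrable_mult_left integrable_normal_density)
        (auto simp: E_def abs_le_iff)
    also have "(LINT x|lborel. std_normal_density x * E) = E" by (simp add: integral_normal_density)
    finally show "(\<integral>\<^sup>+ w. ennreal (?n k w * f w) \<partial>lborel) \<le> ennreal (2 * pi * E)" by (simp add: ennreal_leI)
  qed
  finally have le: "(\<integral>\<^sup>+ w. ennreal (f w) \<partial>lborel) \<le> ennreal (2 * pi * E)" .
  have i: "integrable lborel f"
    by (rule integrableI_nonneg) (use le in \<open>auto simp: f_def intro: le_less_trans\<close>)
  then show ?A by (simp add: f_def)
  have "ennreal (LINT w|lborel. f w) \<le> ennreal (2 * pi * E)"
    using le nn_integral_eq_integral[OF i] by (simp add: f_def)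
  then show ?B using E by (simp add: E_def f_def ennreal_le_iff)
qed

lemma plancherel_ge:
  assumes cont: "AE t in lborel. isCont h t"
  shows "2 * pi * (LINT t|lborel. (h t)\<^sup>2) \<le> (LINT w|lborel. (cmod (laplace h (\<i> * of_real w)))\<^sup>2)"
proof -
  note [measurable] = hm
  have [measurable]: "autocorrelation \<in> borel_measurable borel" using autocorrelation_fourier(1) by auto
  define E where "E = (LINT t|lborel. (h t)\<^sup>2)"
  have autocorrelation_lim: "(\<lambda>k. autocorrelation (x / real (Suc k))) \<longlonglongrightarrow> E" for x
  proof -
    have l: "(\<lambda>k. x / real (Suc k)) \<longlonglongrightarrow> 0"
      using tendsto_mult[OF tendsto_const[of x] LIMSEQ_inverse_real_of_nat] by (simp add: divide_inverse)
    have "(\<lambda>k. LINT s|lborel. h (s + x / real (Suc k)) * h s) \<longlonglongrightarrow> (LINT s|lborel. h s * h s)"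
    proof (rule integral_dominated_convergence[where w="\<lambda>s. M * \<bar>h s\<bar>"])
      show "AE s in lborel. (\<lambda>k. h (s + x / real (Suc k)) * h s) \<longlonglongrightarrow> h s * h s"
        using cont
      proof eventually_elim
        case (elim s)
        have "(\<lambda>k. s + x / real (Suc k)) \<longlonglongrightarrow> s + 0" by (intro tendsto_intros l)
        then have "(\<lambda>k. h (s + x / real (Suc k))) \<longlonglongrightarrow> h s" using isCont_tendsto_compose[OF elim] by simp
        then show ?case by (intro tendsto_intros)
      qed
      show "AE s in lborel. norm (h (s + x / real (Suc k)) * h s) \<le> M * \<bar>h s\<bar>" for k
        using M by (intro AE_I2) (auto simp: abs_mult intro!: mult_right_mono)
    qed (use h in auto)
    then show ?thesis by (simp add: autocorrelation_def E_def power2_eq_square)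
  qed
  have "(\<lambda>k. LINT x|lborel. std_normal_density x * autocorrelation (x / real (Suc k))) \<longlonglongrightarrow> (LINT x|lborel. std_normal_density x * E)"
  proof (rule integral_dominated_convergence[where w="\<lambda>x. std_normal_density x * E"])
    show "AE x in lborel. (\<lambda>k. std_normal_density x * autocorrelation (x / real (Suc k))) \<longlonglongrightarrow> std_normal_density x * E"
      by (intro AE_I2 tendsto_intros autocorrelation_lim)
    show "AE x in lborel. norm (std_normal_density x * autocorrelation (x / real (Suc k))) \<le> std_normal_density x * E" for k
      using autocorrelation_le by (intro AE_I2) (auto simp: abs_mult E_def intro!: mult_left_mono)
  qed (auto intro!: integrable_mult_left integrable_normal_density)
  then have lim: "(\<lambda>k. 2 * pi * (LINT x|lborel. std_normal_density x * autocorrelation (x / real (Suc k)))) \<longlonglongrightarrow> 2 * pi * E"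
    by (intro tendsto_intros) (simp add: integral_normal_density)
  have "2 * pi * (LINT x|lborel. std_normal_density x * autocorrelation (x / real (Suc k))) \<le> (LINT w|lborel. (cmod (laplace h (\<i> * of_real w)))\<^sup>2)" for k
  proof -
    have "2 * pi * (LINT x|lborel. std_normal_density x * autocorrelation (x / real (Suc k)))
        = (LINT w|lborel. exp (- (w / real (Suc k))\<^sup>2 / 2) * (cmod (laplace h (\<i> * of_real w)))\<^sup>2)"
      by (rule gaussian_plancherel(2)[symmetric]) simp
    also have "\<dots> \<le> (LINT w|lborel. (cmod (laplace h (\<i> * of_real w)))\<^sup>2)"
      by (rule integral_mono[OF gaussian_plancherel(1) plancherel_le(1)]) (auto intro!: mult_left_le_one_le)
    finally show ?thesis .
  qed
  then have "2 * pi * E \<le> (LINT w|lborel. (cmod (laplace h (\<i> * of_real w)))\<^sup>2)"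
    by (intro tendsto_upperbound[OF lim]) auto
  then show ?thesis by (simp add: E_def)
qed

end

section \<open>Bounded solutions and zeros of the characteristic function\<close>

text \<open>
  The factor by which the two delays act on a Laplace transform; the characteristic function is
  \<open>z\<^sup>\<alpha> + \<gamma> - k delay_symbol z\<close>.
\<close>
definition delay_symbol :: "real \<Rightarrow> real \<Rightarrow> real \<Rightarrow> complex \<Rightarrow> complex" where
  "delay_symbol \<gamma> \<tau>1 \<tau>2 z = exp (- z * of_real \<tau>1) - of_real (exp (- \<gamma> * \<tau>2)) * exp (- z * of_real (\<tau>1 + \<tau>2))"

text \<open>
  The characteristic function divided by \<open>z\<^sup>\<alpha>\<close>. In this normalization it tends to 1 at infinity, hence it is
  bounded away from 0 on a vertical line as soon as it has no zero there.
\<close>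
definition char_factor :: "real \<Rightarrow> real \<Rightarrow> real \<Rightarrow> real \<Rightarrow> real \<Rightarrow> complex \<Rightarrow> complex" where
  "char_factor \<alpha> \<gamma> k \<tau>1 \<tau>2 z = 1 + z powr (- of_real \<alpha>) * (of_real \<gamma> - of_real k * delay_symbol \<gamma> \<tau>1 \<tau>2 z)"

lemma norm_powr_real_exponent:
  "z \<noteq> 0 \<Longrightarrow> cmod (z powr of_real a) = cmod z powr a"
  by (simp add: powr_def)

lemma char_factor_near_1:
  assumes "Re z > 0" "\<tau>1 \<ge> 0" "\<tau>2 \<ge> 0"
  shows "cmod (char_factor \<alpha> \<gamma> k \<tau>1 \<tau>2 z - 1) \<le> cmod z powr (- \<alpha>) * (\<bar>\<gamma>\<bar> + \<bar>k\<bar> * (1 + exp (- \<gamma> * \<tau>2)))"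
proof -
  have z: "z \<noteq> 0" using assms by auto
  have "cmod (delay_symbol \<gamma> \<tau>1 \<tau>2 z) \<le> cmod (exp (- z * of_real \<tau>1)) + cmod (of_real (exp (- \<gamma> * \<tau>2)) * exp (- z * of_real (\<tau>1 + \<tau>2)))"
    unfolding delay_symbol_def by (rule norm_triangle_ineq4)
  also have "\<dots> \<le> 1 + exp (- \<gamma> * \<tau>2) * 1"
    unfolding norm_mult using assms by (intro add_mono mult_mono) (auto intro!: mult_nonneg_nonneg)
  finally have E: "cmod (delay_symbol \<gamma> \<tau>1 \<tau>2 z) \<le> 1 + exp (- \<gamma> * \<tau>2)" by simp
  have "cmod (of_real \<gamma> - of_real k * delay_symbol \<gamma> \<tau>1 \<tau>2 z) \<le> \<bar>\<gamma>\<bar> + \<bar>k\<bar> * cmod (delay_symbol \<gamma> \<tau>1 \<tau>2 z)"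
    using norm_triangle_ineq4[of "of_real \<gamma>" "of_real k * delay_symbol \<gamma> \<tau>1 \<tau>2 z"] by (simp add: norm_mult)
  also have "\<dots> \<le> \<bar>\<gamma>\<bar> + \<bar>k\<bar> * (1 + exp (- \<gamma> * \<tau>2))" using E by (intro add_mono mult_left_mono) auto
  finally show ?thesis
    using norm_powr_real_exponent[OF z, of "- \<alpha>"] by (simp add: char_factor_def norm_mult mult_left_mono)
qed

lemma char_factor_holomorphic: "char_factor \<alpha> \<gamma> k \<tau>1 \<tau>2 holomorphic_on {z. Re z > 0}"
proof -
  have "z \<notin> \<real>\<^sub>\<le>\<^sub>0" if "Re z > 0" for z using that by (auto simp: complex_nonpos_Reals_iff)
  then show ?thesis unfolding char_factor_def[abs_def] delay_symbol_def by (intro holomorphic_intros) auto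
qed

text \<open>
  Only countably many vertical lines contain a zero. On a line without zeros, compactness gives a lower bound for
  bounded imaginary parts, and the limit 1 at infinity gives one for the others.
\<close>
lemma zero_free_vertical_line:
  assumes \<alpha>: "0 < \<alpha>" and \<tau>: "\<tau>1 \<ge> 0" "\<tau>2 \<ge> 0" and b: "b > 0"
  obtains \<mu> c0 where "0 < \<mu>" "\<mu> < b" "c0 > 0"
    "\<And>w::real. c0 \<le> cmod (char_factor \<alpha> \<gamma> k \<tau>1 \<tau>2 (of_real \<mu> + \<i> * of_real w))"
proof -
  let ?m = "char_factor \<alpha> \<gamma> k \<tau>1 \<tau>2" and ?S = "{z. Re z > 0}"
  define R where "R = \<bar>\<gamma>\<bar> + \<bar>k\<bar> * (1 + exp (- \<gamma> * \<tau>2))"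
  have R: "R \<ge> 0" by (simp add: R_def add_nonneg_nonneg mult_nonneg_nonneg)
  define W where "W = (2 * R + 1) powr (1 / \<alpha>)"
  have W: "W > 0" using R by (simp add: W_def)
  have far: "cmod (?m z) \<ge> 1 / 2" if "Re z > 0" "cmod z \<ge> W" for z
  proof -
    have "2 * R + 1 = W powr \<alpha>" using \<alpha> R by (simp add: W_def powr_powr)
    also have "\<dots> \<le> cmod z powr \<alpha>" using that W \<alpha> by (intro powr_mono2) auto
    finally have zz: "2 * R + 1 \<le> cmod z powr \<alpha>" .
    have "cmod (?m z - 1) \<le> cmod z powr (- \<alpha>) * R" unfolding R_def by (rule char_factor_near_1[OF that(1) \<tau>])
    also have "\<dots> = R / cmod z powr \<alpha>" by (simp add: powr_minus divide_inverse)
    also have "\<dots> \<le> 1 / 2" using zz R by (simp add: divide_le_eq)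
    finally have "cmod (?m z - 1) \<le> 1 / 2" .
    then show ?thesis using norm_triangle_ineq2[of 1 "1 - ?m z"] by (simp add: norm_minus_commute)
  qed
  have nc: "\<not> ?m constant_on ?S \<or> (\<forall>z\<in>?S. ?m z \<noteq> 0)"
  proof (rule disjCI)
    assume "\<not> (\<forall>z\<in>?S. ?m z \<noteq> 0)"
    then obtain z0 where z0: "z0 \<in> ?S" "?m z0 = 0" by auto
    show "\<not> ?m constant_on ?S"
    proof
      assume "?m constant_on ?S"
      then obtain y where y: "\<And>z. z \<in> ?S \<Longrightarrow> ?m z = y" unfolding constant_on_def by blast
      have "?m (of_real W) = 0" using y[of z0] y[of "of_real W"] z0 W by simp
      then show False using far[of "of_real W"] W by simp
    qed
  qed
  have cz: "countable {z \<in> ?S. ?m z = 0}"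
  proof (cases "\<forall>z\<in>?S. ?m z \<noteq> 0")
    case True
    then have "{z \<in> ?S. ?m z = 0} = {}" by auto
    then show ?thesis by (simp only: countable_empty)
  next
    case False
    show ?thesis
    proof (rule holomorphic_countable_zeros[OF char_factor_holomorphic])
      show "open ?S" by (rule open_halfspace_Re_gt)
      show "connected ?S" by (intro convex_connected convex_halfspace_Re_gt)
      have "?S = (\<Union>n::nat. {z. Re z \<ge> inverse (real (Suc n))})"
      proof (intro set_eqI iffI)
        fix z assume "z \<in> ?S"
        then obtain n where "inverse (real (Suc n)) < Re z" using reals_Archimedean[of "Re z"] by auto
        then show "z \<in> (\<Union>n::nat. {z. Re z \<ge> inverse (real (Suc n))})" by (auto intro: less_imp_le)
      next
        fix z assume "z \<in> (\<Union>n::nat. {z. Re z \<ge> inverse (real (Suc n))})"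
        then obtain n where "inverse (real (Suc n)) \<le> Re z" by auto
        moreover have "0 < inverse (real (Suc n))" by simp
        ultimately show "z \<in> ?S" by (simp only: mem_Collect_eq)
      qed
      moreover have "fsigma (\<Union>n::nat. {z. Re z \<ge> inverse (real (Suc n))})"
        by (rule fsigma.intros) (rule closed_halfspace_Re_ge)
      ultimately show "fsigma ?S" by (simp only:)
      show "\<not> ?m constant_on ?S" using nc False by blast
    qed
  qed
  then have "countable (Re ` {z \<in> ?S. ?m z = 0})" by (rule countable_image)
  moreover have "uncountable {0<..<b}" using b by (simp add: uncountable_open_interval)
  ultimately obtain \<mu> where \<mu>: "\<mu> \<in> {0<..<b}" "\<mu> \<notin> Re ` {z \<in> ?S. ?m z = 0}"
    by (meson countable_subset subsetI)
  have nz: "?m (of_real \<mu> + \<i> * of_real w) \<noteq> 0" for w :: real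
  proof
    assume "?m (of_real \<mu> + \<i> * of_real w) = 0"
    then have "of_real \<mu> + \<i> * of_real w \<in> {z \<in> ?S. ?m z = 0}" using \<mu>(1) by simp
    from imageI[OF this, of Re] show False using \<mu>(2) by simp
  qed
  have "continuous_on {- W..W} (\<lambda>w. cmod (?m (of_real \<mu> + \<i> * of_real w)))"
    by (intro continuous_intros continuous_on_compose2[OF holomorphic_on_imp_continuous_on[OF char_factor_holomorphic]]) (use \<mu>(1) in auto)
  then obtain w0 where w0: "\<And>w. w \<in> {- W..W} \<Longrightarrow> cmod (?m (of_real \<mu> + \<i> * of_real w0)) \<le> cmod (?m (of_real \<mu> + \<i> * of_real w))"
    using continuous_attains_inf[of "{-W..W}"] W by fastforce
  show ?thesis
  proof (rule that)
    show "0 < \<mu>" "\<mu> < b" using \<mu>(1) by auto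
    show "0 < min (1 / 2) (cmod (?m (of_real \<mu> + \<i> * of_real w0)))" using nz[of w0] by simp
    fix w :: real
    show "min (1 / 2) (cmod (?m (of_real \<mu> + \<i> * of_real w0))) \<le> cmod (?m (of_real \<mu> + \<i> * of_real w))"
    proof (cases "w \<in> {- W..W}")
      case True then show ?thesis using w0[OF True] by simp
    next
      case False
      have "\<bar>w\<bar> \<le> cmod (of_real \<mu> + \<i> * of_real w)" using abs_Im_le_cmod[of "of_real \<mu> + \<i> * of_real w"] by simp
      then have "W \<le> cmod (of_real \<mu> + \<i> * of_real w)" using False by auto
      then show ?thesis using far[of "of_real \<mu> + \<i> * of_real w"] \<mu>(1) by simp
    qed
  qed
qed

text \<open>
  Stability only speaks about given solutions; that they exist for all times is proved by truncating at
  \<open>2 \<epsilon>\<close>. The global solution of the truncated equation solves the original one as long as it is below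
  \<open>2 \<epsilon>\<close>, and stability then keeps it below \<open>\<epsilon>\<close>.
\<close>
lemma stable_imp_global_small:
  assumes st: "stable_equilibrium \<alpha> (delay_rhs \<gamma> g \<tau>2) \<tau>1 \<tau>2 0" and g: "g C1_differentiable_on UNIV"
    and \<alpha>: "0 < \<alpha>" "\<alpha> \<le> 1" and \<tau>: "\<tau>1 \<ge> 0" "\<tau>2 \<ge> 0" and \<epsilon>: "\<epsilon> > 0"
  obtains \<delta> where "\<delta> > 0" "\<And>\<phi>. history_near \<tau>1 \<tau>2 0 \<delta> \<phi> \<Longrightarrow>
     \<exists>x. is_solution \<alpha> (delay_rhs \<gamma> g \<tau>2) \<tau>1 \<tau>2 \<phi> \<infinity> x \<and> (\<forall>t\<ge>-(\<tau>1 + \<tau>2). \<bar>x t\<bar> < \<epsilon>)"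
proof -
  obtain \<delta>0 where \<delta>0: "\<delta>0 > 0" and stab: "\<And>\<phi> T x t. history_near \<tau>1 \<tau>2 0 \<delta>0 \<phi> \<Longrightarrow>
      is_solution \<alpha> (delay_rhs \<gamma> g \<tau>2) \<tau>1 \<tau>2 \<phi> T x \<Longrightarrow> t \<ge> 0 \<Longrightarrow> ereal t < T \<Longrightarrow> \<bar>x t\<bar> < \<epsilon>"
    using st \<epsilon> unfolding stable_equilibrium_def by (metis diff_zero)
  show ?thesis
  proof (rule that[of "min \<delta>0 \<epsilon>"])
    show "min \<delta>0 \<epsilon> > 0" using \<delta>0 \<epsilon> by simp
    fix \<phi> assume near: "history_near \<tau>1 \<tau>2 0 (min \<delta>0 \<epsilon>) \<phi>"
    then have near0: "history_near \<tau>1 \<tau>2 0 \<delta>0 \<phi>" by (auto simp: history_near_def)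
    obtain x where x: "is_solution \<alpha> (delay_rhs \<gamma> (truncate (2 * \<epsilon>) g) \<tau>2) \<tau>1 \<tau>2 \<phi> \<infinity> x"
      using truncated_solution_exists[OF g _ \<alpha> \<tau>, of "2 * \<epsilon>" \<phi>] near \<epsilon> unfolding history_near_def by auto
    have hist: "\<bar>x s\<bar> < \<epsilon>" if "- (\<tau>1 + \<tau>2) \<le> s" "s \<le> 0" for s
      using x near that by (auto simp: is_solution_def history_near_def)
    have orig: "is_solution \<alpha> (delay_rhs \<gamma> g \<tau>2) \<tau>1 \<tau>2 \<phi> T x"
      if T: "0 < T" and le: "\<And>s. 0 \<le> s \<Longrightarrow> ereal s < T \<Longrightarrow> \<bar>x s\<bar> \<le> 2 * \<epsilon>" for T
    proof (rule is_solution_transfer[OF x T])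
      fix t assume t: "0 < t" "ereal t < T"
      have le': "\<bar>x s\<bar> \<le> 2 * \<epsilon>" if "- (\<tau>1 + \<tau>2) \<le> s" "s \<le> t" for s
      proof (cases "s \<le> 0")
        case True then show ?thesis using hist[of s] that \<epsilon> by simp
      next
        case False
        have "ereal s < T" using that(2) t(2) by (meson ereal_less_eq(3) le_less_trans)
        then show ?thesis using le[of s] False by simp
      qed
      show "delay_rhs \<gamma> (truncate (2 * \<epsilon>) g) \<tau>2 (x t) (x (t - \<tau>1)) (x (t - \<tau>1 - \<tau>2))
          = delay_rhs \<gamma> g \<tau>2 (x t) (x (t - \<tau>1)) (x (t - \<tau>1 - \<tau>2))"
        unfolding delay_rhs_def using t \<tau> by (simp add: truncate_eq le')
    qed
    have xc: "continuous_on {0..t} x" for t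
      by (rule continuous_on_subset[OF solution_continuous[OF x]]) (use \<tau> in auto)
    have bd: "\<bar>x t\<bar> < 2 * \<epsilon>" if t: "t \<ge> 0" for t
    proof (rule ccontr)
      assume big: "\<not> \<bar>x t\<bar> < 2 * \<epsilon>"
      obtain t1 where t1: "0 < t1" "t1 \<le> t" "- \<bar>x t1\<bar> = - (2 * \<epsilon>)" "\<And>s. 0 \<le> s \<Longrightarrow> s < t1 \<Longrightarrow> - \<bar>x s\<bar> > - (2 * \<epsilon>)"
      proof (rule first_time_le[of 0 t "\<lambda>s. - \<bar>x s\<bar>" "- (2 * \<epsilon>)"])
        show "continuous_on {0..t} (\<lambda>s. - \<bar>x s\<bar>)" by (intro continuous_intros xc)
      qed (use t hist[of 0] \<tau> \<epsilon> big in auto)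
      have sol: "is_solution \<alpha> (delay_rhs \<gamma> g \<tau>2) \<tau>1 \<tau>2 \<phi> (ereal t1) x"
        by (rule orig) (use t1(1) t1(4) in \<open>auto intro: less_imp_le\<close>)
      obtain t2 where t2: "0 < t2" "t2 \<le> t1" "- \<bar>x t2\<bar> = - \<epsilon>"
      proof (rule first_time_le[of 0 t1 "\<lambda>s. - \<bar>x s\<bar>" "- \<epsilon>"])
        show "continuous_on {0..t1} (\<lambda>s. - \<bar>x s\<bar>)" by (intro continuous_intros xc)
      qed (use t1 hist[of 0] \<tau> \<epsilon> in auto)
      have "t2 < t1" using t2 t1(3) \<epsilon> by (cases "t2 = t1") auto
      then have "\<bar>x t2\<bar> < \<epsilon>" using stab[OF near0 sol, of t2] t2 by simp
      then show False using t2(3) by simp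
    qed
    have sol: "is_solution \<alpha> (delay_rhs \<gamma> g \<tau>2) \<tau>1 \<tau>2 \<phi> \<infinity> x"
      by (rule orig) (use bd in \<open>auto intro: less_imp_le\<close>)
    have "\<bar>x t\<bar> < \<epsilon>" if "t \<ge> - (\<tau>1 + \<tau>2)" for t
      using hist[of t] stab[OF near0 sol, of t] that by (cases "t \<le> 0") auto
    then show "\<exists>x. is_solution \<alpha> (delay_rhs \<gamma> g \<tau>2) \<tau>1 \<tau>2 \<phi> \<infinity> x \<and> (\<forall>t\<ge>-(\<tau>1 + \<tau>2). \<bar>x t\<bar> < \<epsilon>)"
      using sol by (intro exI[of _ x]) auto
  qed
qed

lemma weighted_integrable:
  fixes u :: "real \<Rightarrow> real"
  assumes [measurable]: "u \<in> borel_measurable borel" and "\<And>t. t < 0 \<Longrightarrow> u t = 0" "\<And>t. \<bar>u t\<bar> \<le> M" and a: "a > 0"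
  shows "integrable lborel (\<lambda>t. exp (- a * t) * u t)"
proof -
  have "integrable lborel (\<lambda>t::real. M * (exp (- a * t) * frac_kernel 1 t))"
    using frac_kernel_laplace_real[of 1 a] a by (intro integrable_mult_right) (auto simp: has_bochner_integral_iff)
  then show ?thesis
  proof (rule Bochner_Integration.integrable_bound)
    have "AE t in lborel. t \<noteq> (0::real)" by (rule AE_lborel_singleton)
    then show "AE t in lborel. norm (exp (- a * t) * u t) \<le> norm (M * (exp (- a * t) * frac_kernel 1 t))"
    proof eventually_elim
      case (elim t)
      show ?case
      proof (cases "t < 0")
        case False
        have "\<bar>u t\<bar> \<le> \<bar>M\<bar>" using assms(3)[of t] by linarith
        then show ?thesis using elim False by (simp add: frac_kernel_1 abs_mult)
      qed (use assms in simp)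
    qed
  qed measurable
qed

text \<open>
  The difference between the delayed terms of the nonlinear equation and those of the linearization applied to
  the solution extended by 0 to negative times. It therefore contains both the nonlinear part and the
  whole influence of the history.
\<close>
definition remainder :: "real \<Rightarrow> real \<Rightarrow> (real \<Rightarrow> real) \<Rightarrow> real \<Rightarrow> real \<Rightarrow> (real \<Rightarrow> real) \<Rightarrow> real \<Rightarrow> real" where
  "remainder \<gamma> k g \<tau>1 \<tau>2 x = causal_part (\<lambda>t. delayed_feedback \<gamma> g \<tau>1 \<tau>2 x t
     - (k * causal_part x (t - \<tau>1) - exp (- \<gamma> * \<tau>2) * (k * causal_part x (t - (\<tau>1 + \<tau>2)))))"

text \<open>
  A global solution with values in the range where \<open>g\<close> grows at most linearly. Then \<open>x\<close> and all the delayed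
  terms are bounded, and their Laplace transforms exist on the whole right half-plane.
\<close>
locale bounded_delay_solution =
  fixes \<alpha> \<gamma> k r \<kappa> :: real and g :: "real \<Rightarrow> real" and \<tau>1 \<tau>2 :: real and \<phi> x :: "real \<Rightarrow> real"
  assumes \<alpha>: "0 < \<alpha>" "\<alpha> \<le> 1" and \<tau>: "\<tau>1 \<ge> 0" "\<tau>2 \<ge> 0" and g: "continuous_on UNIV g"
    and \<kappa>: "\<And>v. \<bar>v\<bar> \<le> r \<Longrightarrow> \<bar>g v\<bar> \<le> \<kappa> * \<bar>v\<bar>" "\<kappa> \<ge> 0"
    and sol: "is_solution \<alpha> (delay_rhs \<gamma> g \<tau>2) \<tau>1 \<tau>2 \<phi> \<infinity> x"
    and small: "\<And>t. t \<ge> - (\<tau>1 + \<tau>2) \<Longrightarrow> \<bar>x t\<bar> \<le> r"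
begin

abbreviation "y \<equiv> causal_part x"
abbreviation "q \<equiv> remainder \<gamma> k g \<tau>1 \<tau>2 x"
abbreviation "c \<equiv> exp (- \<gamma> * \<tau>2)"

lemma r_nonneg: "r \<ge> 0" using small[of 0] \<tau> by (auto intro: order_trans[OF abs_ge_zero])

lemma x_cont: "continuous_on {- (\<tau>1 + \<tau>2)..} x"
  using sol by (simp add: is_solution_def atLeast_def)

lemma y_bounded: "causal_bounded y"
  by (intro causal_bounded_causal_part continuous_on_subset[OF x_cont]) (use \<tau> in auto)

lemma y_meas [measurable]: "y \<in> borel_measurable borel" using y_bounded by (rule causal_bounded_measurable)

lemma y_le: "\<bar>y t\<bar> \<le> r" using small[of t] \<tau> r_nonneg by (auto simp: causal_part_def)

lemma feedback_cont: "continuous_on {0..} (delayed_feedback \<gamma> g \<tau>1 \<tau>2 x)"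
  unfolding delayed_feedback_def[abs_def]
  by (intro continuous_intros continuous_on_compose2[OF g] continuous_on_compose2[OF x_cont]) (use \<tau> in auto)

lemma q_meas [measurable]: "q \<in> borel_measurable borel"
proof -
  have [measurable]: "causal_part (delayed_feedback \<gamma> g \<tau>1 \<tau>2 x) \<in> borel_measurable borel"
    by (rule causal_bounded_measurable[OF causal_bounded_causal_part[OF feedback_cont]])
  have "q = (\<lambda>t. if t < 0 then 0 else causal_part (delayed_feedback \<gamma> g \<tau>1 \<tau>2 x) t
     - (k * y (t - \<tau>1) - c * (k * y (t - (\<tau>1 + \<tau>2)))))"
    by (auto simp: remainder_def causal_part_def fun_eq_iff)
  also have "\<dots> \<in> borel_measurable borel" by measurable
  finally show ?thesis .
qed

lemma q_neg: "t < 0 \<Longrightarrow> q t = 0" by (simp add: remainder_def causal_part_def)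

lemma q_le: 
  assumes b: "\<And>s. s \<ge> - (\<tau>1 + \<tau>2) \<Longrightarrow> \<bar>g (x s) - k * y s\<bar> \<le> b s" and t: "t \<ge> 0"
  shows "\<bar>q t\<bar> \<le> b (t - \<tau>1) + c * b (t - (\<tau>1 + \<tau>2))"
proof -
  let ?A = "g (x (t - \<tau>1)) - k * y (t - \<tau>1)" and ?B = "g (x (t - (\<tau>1 + \<tau>2))) - k * y (t - (\<tau>1 + \<tau>2))"
  have "q t = ?A - c * ?B" using t by (simp add: remainder_def causal_part_def delayed_feedback_def algebra_simps)
  also have "\<bar>\<dots>\<bar> \<le> \<bar>?A\<bar> + \<bar>c * ?B\<bar>" by (rule abs_triangle_ineq4)
  also have "\<bar>c * ?B\<bar> = c * \<bar>?B\<bar>" by (simp add: abs_mult)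
  also have "\<bar>?A\<bar> + c * \<bar>?B\<bar> \<le> b (t - \<tau>1) + c * b (t - (\<tau>1 + \<tau>2))"
    using t \<tau> by (intro add_mono mult_left_mono b) auto
  finally show ?thesis .
qed

lemma q_bounded: "\<bar>q t\<bar> \<le> (1 + c) * ((\<kappa> + \<bar>k\<bar>) * r)"
proof (cases "t < 0")
  case True then show ?thesis using q_neg[OF True] \<kappa>(2) r_nonneg by simp
next
  case False
  have "\<bar>q t\<bar> \<le> (\<lambda>s. (\<kappa> + \<bar>k\<bar>) * r) (t - \<tau>1) + c * (\<lambda>s. (\<kappa> + \<bar>k\<bar>) * r) (t - (\<tau>1 + \<tau>2))"
  proof (rule q_le)
    fix s assume s: "s \<ge> - (\<tau>1 + \<tau>2)"
    have "\<bar>g (x s)\<bar> \<le> \<kappa> * r" using \<kappa>(1)[OF small[OF s]] mult_left_mono[OF small[OF s] \<kappa>(2)] by linarith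
    moreover have "\<bar>k * y s\<bar> \<le> \<bar>k\<bar> * r" unfolding abs_mult using y_le by (intro mult_left_mono) auto
    ultimately show "\<bar>g (x s) - k * y s\<bar> \<le> (\<kappa> + \<bar>k\<bar>) * r" by (simp add: distrib_right)
  qed (use False in simp)
  then show ?thesis by (simp add: algebra_simps)
qed

text \<open>
  Take transforms in the Volterra equation, where a delay of a function that vanishes at negative times becomes
  multiplication by an exponential.
\<close>
lemma laplace_identity:
  assumes z: "Re z > 0"
  shows "char_factor \<alpha> \<gamma> k \<tau>1 \<tau>2 z * laplace y z = of_real (x 0) * laplace (frac_kernel 1) z + z powr (- of_real \<alpha>) * laplace q z"
proof -
  define p where "p = causal_part (rhs_along (delay_rhs \<gamma> g \<tau>2) \<tau>1 \<tau>2 x)"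
  have wi: "integrable lborel (\<lambda>t. exp (- z * complex_of_real t) * of_real (u t))"
    if "u \<in> borel_measurable borel" "\<And>t. t < 0 \<Longrightarrow> u t = 0" "\<And>t. \<bar>u t\<bar> \<le> M" for u M
    unfolding weighted_integrable_iff[OF that(1)] by (rule weighted_integrable[OF that z])
  have yi: "integrable lborel (\<lambda>t. exp (- z * complex_of_real t) * of_real (y t))"
    by (rule wi[OF y_meas _ y_le]) (simp add: causal_part_def)
  have ysi: "integrable lborel (\<lambda>t. exp (- z * complex_of_real t) * of_real (y (t - s)))" if "s \<ge> 0" for s
  proof (rule wi)
    show "(\<lambda>t. y (t - s)) \<in> borel_measurable borel" by measurable
    show "y (t - s) = 0" if "t < 0" for t using that \<open>s \<ge> 0\<close> by (simp add: causal_part_def)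
    show "\<bar>y (t - s)\<bar> \<le> r" for t by (rule y_le)
  qed
  have qi: "integrable lborel (\<lambda>t. exp (- z * complex_of_real t) * of_real (q t))"
    by (rule wi[OF q_meas q_neg q_bounded])
  have p: "p t = - \<gamma> * y t + k * y (t - \<tau>1) - c * k * y (t - (\<tau>1 + \<tau>2)) + q t" for t
    unfolding p_def remainder_def using \<tau> by (auto simp: causal_part_def rhs_along_delay_rhs algebra_simps)
  have [measurable]: "p \<in> borel_measurable borel" unfolding p[abs_def] by measurable
  have pz: "t < 0 \<Longrightarrow> p t = 0" for t by (simp add: p_def causal_part_def)
  have pb: "\<bar>p t\<bar> \<le> \<bar>\<gamma>\<bar> * r + \<bar>k\<bar> * r + c * \<bar>k\<bar> * r + (1 + c) * ((\<kappa> + \<bar>k\<bar>) * r)" for t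
  proof -
    have "\<bar>p t\<bar> \<le> \<bar>\<gamma>\<bar> * \<bar>y t\<bar> + \<bar>k\<bar> * \<bar>y (t - \<tau>1)\<bar> + c * \<bar>k\<bar> * \<bar>y (t - (\<tau>1 + \<tau>2))\<bar> + \<bar>q t\<bar>"
    proof -
      have "\<bar>p t\<bar> \<le> \<bar>- \<gamma> * y t\<bar> + \<bar>k * y (t - \<tau>1)\<bar> + \<bar>c * k * y (t - (\<tau>1 + \<tau>2))\<bar> + \<bar>q t\<bar>"
        unfolding p by linarith
      then show ?thesis by (simp add: abs_mult)
    qed
    also have "\<dots> \<le> \<bar>\<gamma>\<bar> * r + \<bar>k\<bar> * r + c * \<bar>k\<bar> * r + (1 + c) * ((\<kappa> + \<bar>k\<bar>) * r)"
      by (intro add_mono mult_left_mono y_le q_bounded) auto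
    finally show ?thesis .
  qed
  have LB: "integrable lborel (\<lambda>t. exp (- Re z * t) * frac_kernel \<alpha> t)" "integrable lborel (\<lambda>t. exp (- Re z * t) * frac_kernel 1 t)"
    using frac_kernel_laplace_real[OF \<alpha>(1) z] frac_kernel_laplace_real[OF zero_less_one z] by (auto simp: has_bochner_integral_iff)
  have Lp: "integrable lborel (\<lambda>t. exp (- Re z * t) * p t)" by (rule weighted_integrable[OF _ pz pb z]) measurable
  have cm: "conv (frac_kernel \<alpha>) p \<in> borel_measurable borel" unfolding conv_def[abs_def] by measurable
  have cz: "t < 0 \<Longrightarrow> conv (frac_kernel \<alpha>) p t = 0" for t
    by (rule conv_neg) (auto simp: frac_kernel_nonpos_eq_0 pz)
  have volt: "y t = x 0 * frac_kernel 1 t + conv (frac_kernel \<alpha>) p t" if "t \<noteq> 0" for t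
  proof (cases "t < 0")
    case True then show ?thesis by (simp add: causal_part_def cz frac_kernel_1)
  next
    case False
    have "x t = x 0 + conv (frac_kernel \<alpha>) p t" unfolding p_def
      by (rule solution_imp_volterra[OF sol \<alpha> continuous_delay_rhs[OF g] \<tau>]) (use False in auto)
    then show ?thesis using False that by (simp add: causal_part_def frac_kernel_1)
  qed
  have ae: "AE t in lborel. exp (- z * complex_of_real t) * of_real (y t)
      = of_real (x 0) * (exp (- z * of_real t) * of_real (frac_kernel 1 t)) + exp (- z * of_real t) * of_real (conv (frac_kernel \<alpha>) p t)"
  proof -
    have "AE t in lborel. t \<noteq> (0::real)" by (rule AE_lborel_singleton)
    then show ?thesis by eventually_elim (simp add: volt algebra_simps)
  qed
  have F1: "integrable lborel (\<lambda>t. of_real (x 0) * (exp (- z * complex_of_real t) * of_real (frac_kernel 1 t)))"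
    by (intro integrable_mult_right) (use LB in \<open>simp only: weighted_integrable_iff[OF frac_kernel_measurable]\<close>)
  have C1: "integrable lborel (\<lambda>t. exp (- z * complex_of_real t) * of_real (conv (frac_kernel \<alpha>) p t))"
  proof -
    have "integrable lborel (\<lambda>t. (exp (- z * complex_of_real t) * of_real (y t)) - of_real (x 0) * (exp (- z * complex_of_real t) * of_real (frac_kernel 1 t)))"
      by (intro Bochner_Integration.integrable_diff yi F1)
    then show ?thesis
    proof (rule integrable_cong_AE_imp)
      show "AE t in lborel. (exp (- z * complex_of_real t) * of_real (y t)) - of_real (x 0) * (exp (- z * complex_of_real t) * of_real (frac_kernel 1 t))
        = exp (- z * complex_of_real t) * of_real (conv (frac_kernel \<alpha>) p t)"
        using ae by eventually_elim simp
    qed (use cm in measurable)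
  qed
  have "laplace y z = of_real (x 0) * laplace (frac_kernel 1) z + laplace (conv (frac_kernel \<alpha>) p) z"
  proof -
    have "laplace y z = (LINT t|lborel. of_real (x 0) * (exp (- z * of_real t) * of_real (frac_kernel 1 t)) + exp (- z * of_real t) * of_real (conv (frac_kernel \<alpha>) p t))"
      unfolding laplace_def using ae by (intro integral_cong_AE) (use cm in measurable)
    also have "\<dots> = (LINT t|lborel. of_real (x 0) * (exp (- z * of_real t) * of_real (frac_kernel 1 t))) + (LINT t|lborel. exp (- z * of_real t) * of_real (conv (frac_kernel \<alpha>) p t))"
      by (rule Bochner_Integration.integral_add[OF F1 C1])
    finally show ?thesis by (simp only: laplace_def integral_mult_right_zero)
  qed
  also have "laplace (conv (frac_kernel \<alpha>) p) z = z powr (- of_real \<alpha>) * laplace p z"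
  proof -
    have "laplace (frac_kernel \<alpha>) z = z powr (- of_real \<alpha>)"
      using frac_kernel_laplace_complex[OF \<alpha>(1) z] by (simp add: laplace_def has_bochner_integral_iff)
    then show ?thesis using laplace_conv[OF frac_kernel_measurable _ LB(1) Lp] by simp
  qed
  also have "laplace p z = - of_real \<gamma> * laplace y z + of_real k * delay_symbol \<gamma> \<tau>1 \<tau>2 z * laplace y z + laplace q z"
  proof -
    let ?e = "\<lambda>t. exp (- z * complex_of_real t)"
    have pe: "?e t * of_real (p t) = of_real (- \<gamma>) * (?e t * of_real (y t)) + of_real k * (?e t * of_real (y (t - \<tau>1)))
       + of_real (- c * k) * (?e t * of_real (y (t - (\<tau>1 + \<tau>2)))) + ?e t * of_real (q t)" for t
      unfolding p by (simp add: algebra_simps)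
    have "laplace p z = of_real (- \<gamma>) * laplace y z + of_real k * laplace (\<lambda>t. y (t - \<tau>1)) z
       + of_real (- c * k) * laplace (\<lambda>t. y (t - (\<tau>1 + \<tau>2))) z + laplace q z"
    proof -
      note hb = has_bochner_integral_integrable
      have "has_bochner_integral lborel (\<lambda>t. ?e t * of_real (p t)) (of_real (- \<gamma>) * laplace y z
         + of_real k * laplace (\<lambda>t. y (t - \<tau>1)) z + of_real (- c * k) * laplace (\<lambda>t. y (t - (\<tau>1 + \<tau>2))) z + laplace q z)"
        unfolding pe laplace_def
        by (intro has_bochner_integral_add has_bochner_integral_mult_right hb yi ysi qi \<tau> add_nonneg_nonneg)
      then show ?thesis unfolding laplace_def[of p] by (rule has_bochner_integral_integral_eq)
    qed
    then show ?thesis unfolding laplace_shift by (simp add: delay_symbol_def algebra_simps)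
  qed
  finally have e: "laplace y z = of_real (x 0) * laplace (frac_kernel 1) z + z powr (- of_real \<alpha>) *
      (- of_real \<gamma> * laplace y z + of_real k * delay_symbol \<gamma> \<tau>1 \<tau>2 z * laplace y z + laplace q z)" .
  have "char_factor \<alpha> \<gamma> k \<tau>1 \<tau>2 z * laplace y z = laplace y z + z powr (- of_real \<alpha>) * (of_real \<gamma> * laplace y z - of_real k * delay_symbol \<gamma> \<tau>1 \<tau>2 z * laplace y z)"
    by (simp add: char_factor_def algebra_simps)
  also have "\<dots> = of_real (x 0) * laplace (frac_kernel 1) z + z powr (- of_real \<alpha>) * laplace q z"
    by (subst (1) e) (simp only: algebra_simps, simp)
  finally show ?thesis .
qed

end

section \<open>Instability from a positive characteristic root\<close>

lemma laplace_weight: "laplace (\<lambda>t. exp (- \<mu> * t) * u t) (\<i> * of_real w) = laplace u (of_real \<mu> + \<i> * of_real w)"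
  unfolding laplace_def
proof (rule Bochner_Integration.integral_cong)
  fix t :: real
  have "exp (- (\<i> * of_real w) * of_real t) * of_real (exp (- \<mu> * t)) = exp (- (of_real \<mu> + \<i> * of_real w) * of_real t)"
    unfolding exp_of_real[symmetric] by (simp add: exp_add[symmetric] algebra_simps)
  then show "exp (- (\<i> * of_real w) * of_real t) * of_real (exp (- \<mu> * t) * u t) = exp (- (of_real \<mu> + \<i> * of_real w) * of_real t) * of_real (u t)"
    by (simp only: of_real_mult mult.assoc[symmetric])
qed simp

context bounded_delay_solution
begin

text \<open>
  Divide \<open>laplace_identity\<close> by \<open>char_factor\<close>, whose modulus is at least \<open>c0\<close> on the line, and use
  Plancherel in both directions: from \<open>x\<close> to its transform on the left, from the transforms of \<open>q\<close> and of the
  constant 1 back to time on the right.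
\<close>
lemma weighted_l2_estimate:
  assumes \<mu>: "\<mu> > 0" and c0: "c0 > 0"
    and line: "\<And>w::real. c0 \<le> cmod (char_factor \<alpha> \<gamma> k \<tau>1 \<tau>2 (of_real \<mu> + \<i> * of_real w))"
  shows "integrable lborel (\<lambda>t. (exp (- \<mu> * t) * y t)\<^sup>2)" (is ?A)
    and "(LINT t|lborel. (exp (- \<mu> * t) * y t)\<^sup>2)
      \<le> ((x 0)\<^sup>2 / \<mu> + 2 * (\<mu> powr (- \<alpha>))\<^sup>2 * (LINT t|lborel. (exp (- \<mu> * t) * q t)\<^sup>2)) / c0\<^sup>2" (is "?N \<le> _")
proof -
  define Q where "Q = (1 + c) * ((\<kappa> + \<bar>k\<bar>) * r)"
  have wb: "\<bar>exp (- \<mu> * t) * u t\<bar> \<le> M" if "\<And>t. t < 0 \<Longrightarrow> u t = 0" "\<And>t. \<bar>u t\<bar> \<le> M" for u :: "real \<Rightarrow> real" and M t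
  proof (cases "t < 0")
    case True then show ?thesis using that(1)[OF True] order_trans[OF abs_ge_zero that(2)] by simp
  next
    case False
    have "exp (- \<mu> * t) * \<bar>u t\<bar> \<le> 1 * M" using that(2)[of t] False \<mu> by (intro mult_mono) auto
    then show ?thesis by (simp add: abs_mult)
  qed
  have y0: "t < 0 \<Longrightarrow> y t = 0" for t by (simp add: causal_part_def)
  have f0: "t < 0 \<Longrightarrow> frac_kernel 1 t = 0" and f1: "\<bar>frac_kernel 1 t\<bar> \<le> 1" for t by (auto simp: frac_kernel_1)
  have yi: "integrable lborel (\<lambda>t. exp (- \<mu> * t) * y t)" and yb: "\<bar>exp (- \<mu> * t) * y t\<bar> \<le> r" for t
    by (rule weighted_integrable[OF y_meas y0 y_le \<mu>], assumption) (rule wb[OF y0 y_le], assumption)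
  have qi: "integrable lborel (\<lambda>t. exp (- \<mu> * t) * q t)" and qb: "\<bar>exp (- \<mu> * t) * q t\<bar> \<le> Q" for t
    unfolding Q_def by (rule weighted_integrable[OF q_meas q_neg q_bounded \<mu>], assumption) (rule wb[OF q_neg q_bounded], assumption)
  have fi: "integrable lborel (\<lambda>t. exp (- \<mu> * t) * frac_kernel 1 t)" and fb: "\<bar>exp (- \<mu> * t) * frac_kernel 1 t\<bar> \<le> 1" for t
    by (rule weighted_integrable[OF frac_kernel_measurable f0 f1 \<mu>], assumption) (rule wb[OF f0 f1], assumption)
  show ?A by (rule square_integrable[OF yi yb])
  have cont: "AE t in lborel. isCont (\<lambda>t. exp (- \<mu> * t) * y t) t"
  proof -
    have "AE t in lborel. t \<noteq> (0::real)" by (rule AE_lborel_singleton)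
    then show ?thesis
    proof eventually_elim
      case (elim t)
      have "isCont y t"
      proof (cases "t < 0")
        case True
        have "\<forall>\<^sub>F s in nhds t. 0 = y s"
          using eventually_nhds_in_open[of "{..<0}" t] True by (auto elim!: eventually_mono simp: causal_part_def)
        then show ?thesis using isCont_cong[of "\<lambda>_. 0" y t] by simp
      next
        case False
        then have t: "t > 0" using elim by simp
        have "continuous_on {0<..} x" by (rule continuous_on_subset[OF x_cont]) (use \<tau> in auto)
        then have "isCont x t" using t by (simp add: continuous_on_eq_continuous_at)
        moreover have "\<forall>\<^sub>F s in nhds t. x s = y s"
          using eventually_nhds_in_open[of "{0<..}" t] t by (auto elim!: eventually_mono simp: causal_part_def)
        ultimately show ?thesis using isCont_cong[of x y t] by simp
      qed
      then show ?case by (intro continuous_intros)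
    qed
  qed
  have ge: "2 * pi * ?N \<le> (LINT w|lborel. (cmod (laplace y (of_real \<mu> + \<i> * of_real w)))\<^sup>2)"
    using plancherel_ge[OF yi yb cont] by (simp only: laplace_weight)
  define fF where "fF = (\<lambda>w. (cmod (laplace (frac_kernel 1) (of_real \<mu> + \<i> * of_real w)))\<^sup>2)"
  define fQ where "fQ = (\<lambda>w. (cmod (laplace q (of_real \<mu> + \<i> * of_real w)))\<^sup>2)"
  define nq where "nq = (LINT t|lborel. (exp (- \<mu> * t) * q t)\<^sup>2)"
  have iy: "integrable lborel (\<lambda>w. (cmod (laplace y (of_real \<mu> + \<i> * of_real w)))\<^sup>2)"
    using plancherel_le(1)[OF yi yb] by (simp only: laplace_weight)
  have iF: "integrable lborel fF" and lF0: "(LINT w|lborel. fF w) \<le> 2 * pi * (LINT t|lborel. (exp (- \<mu> * t) * frac_kernel 1 t)\<^sup>2)"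
    using plancherel_le[OF fi fb] unfolding laplace_weight fF_def by auto
  have iQ: "integrable lborel fQ" and lQ: "(LINT w|lborel. fQ w) \<le> 2 * pi * nq"
    using plancherel_le[OF qi qb] unfolding laplace_weight fQ_def nq_def by auto
  have "(LINT t|lborel. (exp (- \<mu> * t) * frac_kernel 1 t)\<^sup>2) = (LINT t|lborel. exp (- (2 * \<mu>) * t) * frac_kernel 1 t)"
    by (rule Bochner_Integration.integral_cong) (auto simp: frac_kernel_1 power2_eq_square exp_add[symmetric])
  also have "\<dots> = 1 / (2 * \<mu>)"
    using frac_kernel_laplace_real[of 1 "2 * \<mu>"] \<mu> by (simp add: has_bochner_integral_iff powr_minus_divide)
  finally have lF: "(LINT w|lborel. fF w) \<le> 2 * pi * (1 / (2 * \<mu>))" using lF0 by simp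
  define e where "e = \<mu> powr (- \<alpha>)"
  have pw: "(cmod (laplace y (of_real \<mu> + \<i> * of_real w)))\<^sup>2 \<le> (2 / c0\<^sup>2) * ((x 0)\<^sup>2 * fF w + e\<^sup>2 * fQ w)" for w
  proof -
    let ?z = "of_real \<mu> + \<i> * of_real w :: complex"
    define X where "X = cmod (laplace y ?z)"
    define U where "U = \<bar>x 0\<bar> * cmod (laplace (frac_kernel 1) ?z)"
    define V where "V = e * cmod (laplace q ?z)"
    have z: "Re ?z > 0" "?z \<noteq> 0" using \<mu> by (auto simp: complex_eq_iff)
    have "\<mu> \<le> cmod ?z" using abs_Re_le_cmod[of ?z] \<mu> by simp
    then have "cmod ?z powr (- \<alpha>) \<le> e" unfolding e_def using \<mu> \<alpha> by (intro powr_mono2') auto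
    then have pz: "cmod (?z powr (- of_real \<alpha>)) \<le> e" using norm_powr_real_exponent[OF z(2), of "- \<alpha>"] by simp
    have "c0 * X \<le> cmod (char_factor \<alpha> \<gamma> k \<tau>1 \<tau>2 ?z) * X" using line by (intro mult_right_mono) (auto simp: X_def)
    also have "\<dots> = cmod (of_real (x 0) * laplace (frac_kernel 1) ?z + ?z powr (- of_real \<alpha>) * laplace q ?z)"
      unfolding X_def norm_mult[symmetric] laplace_identity[OF z(1)] ..
    also have "\<dots> \<le> U + cmod (?z powr (- of_real \<alpha>)) * cmod (laplace q ?z)"
      using norm_triangle_ineq[of "of_real (x 0) * laplace (frac_kernel 1) ?z" "?z powr (- of_real \<alpha>) * laplace q ?z"]
      by (simp only: norm_mult U_def norm_of_real)
    also have "\<dots> \<le> U + V" unfolding V_def using pz by (intro add_left_mono mult_right_mono) auto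
    finally have "(c0 * X)\<^sup>2 \<le> (U + V)\<^sup>2" using c0 by (intro power_mono) (auto simp: X_def)
    also have "\<dots> \<le> 2 * (U\<^sup>2 + V\<^sup>2)"
      using zero_le_power2[of "U - V"] by (simp add: power2_eq_square algebra_simps)
    finally have "X\<^sup>2 \<le> (2 / c0\<^sup>2) * (U\<^sup>2 + V\<^sup>2)" using c0 by (simp add: power_mult_distrib field_simps)
    then show ?thesis by (simp add: X_def U_def V_def fF_def fQ_def power_mult_distrib)
  qed
  have "(LINT w|lborel. (cmod (laplace y (of_real \<mu> + \<i> * of_real w)))\<^sup>2) \<le> (LINT w|lborel. (2 / c0\<^sup>2) * ((x 0)\<^sup>2 * fF w + e\<^sup>2 * fQ w))"
    by (rule integral_mono[OF iy _ pw]) (use iF iQ in auto)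
  also have "\<dots> = (2 / c0\<^sup>2) * ((x 0)\<^sup>2 * (LINT w|lborel. fF w) + e\<^sup>2 * (LINT w|lborel. fQ w))"
    using iF iQ by simp
  also have "\<dots> \<le> (2 / c0\<^sup>2) * ((x 0)\<^sup>2 * (2 * pi * (1 / (2 * \<mu>))) + e\<^sup>2 * (2 * pi * nq))"
    by (intro mult_left_mono add_mono lF lQ) auto
  also have "\<dots> = 2 * pi * (((x 0)\<^sup>2 / \<mu> + 2 * e\<^sup>2 * nq) / c0\<^sup>2)"
    using \<mu> c0 by (simp add: field_simps)
  finally have "2 * pi * ?N \<le> 2 * pi * (((x 0)\<^sup>2 / \<mu> + 2 * e\<^sup>2 * nq) / c0\<^sup>2)" using ge by linarith
  then show "?N \<le> ((x 0)\<^sup>2 / \<mu> + 2 * (\<mu> powr (- \<alpha>))\<^sup>2 * (LINT t|lborel. (exp (- \<mu> * t) * q t)\<^sup>2)) / c0\<^sup>2"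
    using pi_gt_zero by (simp only: mult_le_cancel_left_pos e_def nq_def)
qed

end

lemma weight_shift:
  assumes "l > 0" "s \<ge> 0" "b (t - s) \<ge> (0::real)"
  shows "exp (- l * t) * b (t - s) \<le> exp (- l * (t - s)) * b (t - s)"
  using assms by (intro mult_right_mono) auto

lemma integral_shift: "(LINT t|lborel. f (t - s :: real)) = (LINT t|lborel. (f t :: real))"
  using lborel_integral_real_affine[of 1 f "- s"] by simp

lemma integrable_shift: "integrable lborel f \<Longrightarrow> integrable lborel (\<lambda>t. f (t - s :: real) :: real)"
  using lborel_integrable_real_affine[of f 1 "- s"] by simp

text \<open>
  The history rises from 0 to \<open>d\<close> within the last \<open>h\<close> time units. Up to factors independent of \<open>d\<close>,
  the remainder is then at most \<open>\<eta> \<bar>x\<bar>\<close> plus \<open>d\<close> on a set of measure \<open>h\<close>. The weighted estimate on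
  a zero-free line bounds the \<open>L\<^sup>2\<close> norm of \<open>exp (- \<mu> t) x(t)\<close> by \<open>d\<close>, once \<open>\<eta>\<close> is small enough to absorb
  the solution on the right. Hence the transform of the remainder at the root \<open>l > \<mu>\<close> is a small multiple of
  \<open>d\<close>, whereas the identity at \<open>l\<close> makes it equal to \<open>d l powr (\<alpha> - 1)\<close> in modulus. The constants
  \<open>\<mu>, c0, K1, K2, K3, K4\<close> do not depend on \<open>\<eta>\<close>, \<open>h\<close> and \<open>d\<close>, which are chosen after them in this order.
\<close>
theorem positive_root_instability:
  assumes g: "g C1_differentiable_on UNIV" "g 0 = 0" "(g has_real_derivative k) (at 0)"
    and \<alpha>: "0 < \<alpha>" "\<alpha> \<le> 1" and \<tau>: "\<tau>1 \<ge> 0" "\<tau>2 \<ge> 0"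
    and l: "l > 0" and root: "l powr \<alpha> + \<gamma> - k * (exp (- l * \<tau>1) - exp (- \<gamma> * \<tau>2) * exp (- l * (\<tau>1 + \<tau>2))) = 0"
  shows "unstable_equilibrium \<alpha> (delay_rhs \<gamma> g \<tau>2) \<tau>1 \<tau>2 0"
  unfolding unstable_equilibrium_def
proof
  assume st: "stable_equilibrium \<alpha> (delay_rhs \<gamma> g \<tau>2) \<tau>1 \<tau>2 0"
  define c where "c = exp (- \<gamma> * \<tau>2)"
  have c: "c > 0" by (simp add: c_def)
  have gc: "continuous_on UNIV g" by (rule C1_continuous[OF g(1)])
  obtain \<mu> c0 where \<mu>: "0 < \<mu>" "\<mu> < l" and c0: "c0 > 0"
    and line: "\<And>w::real. c0 \<le> cmod (char_factor \<alpha> \<gamma> k \<tau>1 \<tau>2 (of_real \<mu> + \<i> * of_real w))"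
    using zero_free_vertical_line[OF \<alpha>(1) \<tau> l] by blast
  define \<kappa> where "\<kappa> = \<bar>k\<bar> + 1"
  have \<kappa>: "\<kappa> \<ge> 0" by (simp add: \<kappa>_def)
  define K1 where "K1 = 1 / (\<mu> * c0\<^sup>2)"
  define K2 where "K2 = 8 * (\<mu> powr (- \<alpha>))\<^sup>2 * (1 + c\<^sup>2) / c0\<^sup>2"
  have K1: "K1 \<ge> 0" and K2: "K2 > 0" using \<mu> c0 c by (auto simp: K1_def K2_def add_pos_pos intro!: divide_pos_pos mult_pos_pos)
  define K3 where "K3 = 2 * (K1 + K2 * (\<kappa>\<^sup>2 * (exp \<mu>)\<^sup>2))"
  have K3: "K3 \<ge> 0" using K1 K2 by (simp add: K3_def)
  define K4 where "K4 = (1 / (2 * (l - \<mu>)) + K3) / 2"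
  have K4: "K4 > 0" using K3 \<mu> by (simp add: K4_def add_pos_nonneg)
  define A where "A = l powr (\<alpha> - 1)"
  have A: "A > 0" using l by (simp add: A_def)
  define \<eta> where "\<eta> = min 1 (min (1 / (1 + 2 * K2)) (A / (4 * (1 + c) * K4)))"
  have \<eta>: "\<eta> > 0" "\<eta> \<le> 1" "\<eta> * (1 + 2 * K2) \<le> 1" "\<eta> * (4 * (1 + c) * K4) \<le> A"
  proof -
    have p1: "1 + 2 * K2 > 0" "4 * (1 + c) * K4 > 0" using K2 K4 c by (auto intro!: mult_pos_pos add_pos_pos)
    show "\<eta> > 0" using p1 A by (simp add: \<eta>_def)
    show "\<eta> \<le> 1" by (simp add: \<eta>_def)
    have "\<eta> \<le> 1 / (1 + 2 * K2)" "\<eta> \<le> A / (4 * (1 + c) * K4)" by (auto simp: \<eta>_def)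
    then show "\<eta> * (1 + 2 * K2) \<le> 1" "\<eta> * (4 * (1 + c) * K4) \<le> A" using p1 by (simp_all only: pos_le_divide_eq)
  qed
  have K2\<eta>: "K2 * \<eta>\<^sup>2 \<le> 1 / 2"
  proof -
    have "\<eta>\<^sup>2 \<le> \<eta>" using \<eta> by (simp add: power2_eq_square mult_left_le)
    then have "K2 * \<eta>\<^sup>2 \<le> K2 * \<eta>" using K2 by (intro mult_left_mono) auto
    moreover have "\<eta> + 2 * (K2 * \<eta>) \<le> 1" using \<eta>(3) by (simp add: algebra_simps)
    ultimately show ?thesis using \<eta>(1) by linarith
  qed
  define h where "h = min 1 (A / (4 * (1 + c) * \<kappa> * exp l))"
  have \<kappa>0: "\<kappa> > 0" by (simp add: \<kappa>_def add_nonneg_pos)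
  have h: "h > 0" "h \<le> 1" "h * (4 * (1 + c) * \<kappa> * exp l) \<le> A"
  proof -
    have p1: "4 * (1 + c) * \<kappa> * exp l > 0" using \<kappa>0 c by (auto intro!: mult_pos_pos add_pos_pos)
    show "h > 0" using p1 A by (simp add: h_def)
    show "h \<le> 1" by (simp add: h_def)
    have "h \<le> A / (4 * (1 + c) * \<kappa> * exp l)" by (simp add: h_def)
    then show "h * (4 * (1 + c) * \<kappa> * exp l) \<le> A" using p1 by (simp only: pos_le_divide_eq)
  qed
  obtain r where r: "r > 0" and gr: "\<And>v. \<bar>v\<bar> \<le> r \<Longrightarrow> \<bar>g v - k * v\<bar> \<le> \<eta> * \<bar>v\<bar>"
    using derivative_at_0_bound[OF g(2,3) \<eta>(1)] by blast
  have g\<kappa>: "\<bar>g v\<bar> \<le> \<kappa> * \<bar>v\<bar>" if "\<bar>v\<bar> \<le> r" for v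
  proof -
    have "\<bar>g v\<bar> \<le> \<bar>k * v\<bar> + \<bar>g v - k * v\<bar>" by linarith
    also have "\<dots> \<le> \<bar>k\<bar> * \<bar>v\<bar> + \<eta> * \<bar>v\<bar>" using gr[OF that] by (simp add: abs_mult)
    also have "\<dots> \<le> \<bar>k\<bar> * \<bar>v\<bar> + 1 * \<bar>v\<bar>" using \<eta> by (intro add_left_mono mult_right_mono) auto
    finally show ?thesis by (simp add: \<kappa>_def distrib_right)
  qed
  obtain \<delta> where \<delta>: "\<delta> > 0" and glob: "\<And>\<phi>. history_near \<tau>1 \<tau>2 0 \<delta> \<phi> \<Longrightarrow>
     \<exists>x. is_solution \<alpha> (delay_rhs \<gamma> g \<tau>2) \<tau>1 \<tau>2 \<phi> \<infinity> x \<and> (\<forall>t\<ge>-(\<tau>1 + \<tau>2). \<bar>x t\<bar> < r)"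
    using stable_imp_global_small[OF st g(1) \<alpha> \<tau> r] by blast
  define d where "d = \<delta> / 2"
  have d: "d > 0" "d < \<delta>" using \<delta> by (auto simp: d_def)
  define \<phi> where "\<phi> = (\<lambda>s. d * max 0 (1 + s / h))"
  have \<phi>le: "\<bar>\<phi> s\<bar> \<le> d * indicator {- h..0} s" if "s \<le> 0" for s
  proof (cases "s \<ge> - h")
    case True
    then have "max 0 (1 + s / h) \<le> 1" using that h by (simp add: divide_nonpos_pos)
    then have "\<bar>\<phi> s\<bar> \<le> d * 1" unfolding \<phi>_def abs_mult using d by (intro mult_mono) auto
    then show ?thesis using True that by simp
  next
    case False
    then have "s / h \<le> - 1" using h by (simp add: divide_le_eq)
    then show ?thesis using False d by (simp add: \<phi>_def)
  qed
  have "history_near \<tau>1 \<tau>2 0 \<delta> \<phi>" unfolding history_near_def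
  proof (intro conjI ballI)
    show "continuous_on {- (\<tau>1 + \<tau>2)..0} \<phi>" unfolding \<phi>_def using h by (intro continuous_intros) auto
    fix s assume "s \<in> {- (\<tau>1 + \<tau>2)..0}"
    then have "\<bar>\<phi> s\<bar> \<le> d * indicator {- h..0} s" using \<phi>le by simp
    also have "\<dots> \<le> d" using d by (simp add: indicator_def)
    finally show "\<bar>\<phi> s - 0\<bar> < \<delta>" using d by simp
  qed
  then obtain x where sol: "is_solution \<alpha> (delay_rhs \<gamma> g \<tau>2) \<tau>1 \<tau>2 \<phi> \<infinity> x" and xr: "\<And>t. t \<ge> -(\<tau>1 + \<tau>2) \<Longrightarrow> \<bar>x t\<bar> < r"
    using glob by blast
  interpret bounded_delay_solution \<alpha> \<gamma> k r \<kappa> g \<tau>1 \<tau>2 \<phi> x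
    by unfold_locales (use \<alpha> \<tau> gc g\<kappa> \<kappa> sol xr in \<open>auto intro: less_imp_le\<close>)
  have hist: "x s = \<phi> s" if "s \<ge> - (\<tau>1 + \<tau>2)" "s \<le> 0" for s using sol that by (simp add: is_solution_def)
  have x0: "x 0 = d" using hist[of 0] \<tau> by (simp add: \<phi>_def)
  define b where "b = (\<lambda>s. \<eta> * \<bar>y s\<bar> + \<kappa> * d * indicator {- h..0} s)"
  have b0: "b s \<ge> 0" for s using \<eta> \<kappa> d by (simp add: b_def)
  have [measurable]: "b \<in> borel_measurable borel" unfolding b_def by measurable
  have bnd: "\<bar>g (x s) - k * y s\<bar> \<le> b s" if s: "s \<ge> - (\<tau>1 + \<tau>2)" for s
  proof (cases "s < 0")
    case True
    have "\<bar>g (x s)\<bar> \<le> \<kappa> * \<bar>x s\<bar>" using g\<kappa> xr[OF s] by simp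
    also have "\<dots> \<le> \<kappa> * (d * indicator {- h..0} s)" using hist[OF s] \<phi>le[of s] True \<kappa> by (intro mult_left_mono) auto
    finally show ?thesis using True by (simp add: b_def causal_part_def)
  next
    case False
    have "\<bar>g (x s) - k * x s\<bar> \<le> \<eta> * \<bar>x s\<bar>" using gr xr[OF s] by simp
    moreover have "\<kappa> * d * indicator {- h..0} s \<ge> 0" using \<kappa> d by simp
    ultimately show ?thesis using False by (simp add: b_def causal_part_def)
  qed
  have qb: "\<bar>q t\<bar> \<le> b (t - \<tau>1) + c * b (t - (\<tau>1 + \<tau>2))" for t
  proof (cases "t < 0")
    case True then show ?thesis using q_neg[OF True] b0 c by (simp add: add_nonneg_nonneg)
  next
    case False then show ?thesis using q_le[OF bnd, of t] by (simp add: c_def)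
  qed
  have wq: "\<bar>exp (- a * t) * q t\<bar> \<le> exp (- a * (t - \<tau>1)) * b (t - \<tau>1) + c * (exp (- a * (t - (\<tau>1 + \<tau>2))) * b (t - (\<tau>1 + \<tau>2)))"
    if a: "a > 0" for a t
  proof -
    have "\<bar>exp (- a * t) * q t\<bar> = exp (- a * t) * \<bar>q t\<bar>" by (simp add: abs_mult)
    also have "\<dots> \<le> exp (- a * t) * (b (t - \<tau>1) + c * b (t - (\<tau>1 + \<tau>2)))" using qb by (intro mult_left_mono) auto
    also have "\<dots> = exp (- a * t) * b (t - \<tau>1) + c * (exp (- a * t) * b (t - (\<tau>1 + \<tau>2)))" by (simp add: algebra_simps)
    also have "\<dots> \<le> exp (- a * (t - \<tau>1)) * b (t - \<tau>1) + c * (exp (- a * (t - (\<tau>1 + \<tau>2))) * b (t - (\<tau>1 + \<tau>2)))"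
      using a \<tau> b0 c by (intro add_mono mult_left_mono weight_shift) auto
    finally show ?thesis .
  qed
  have bw: "exp (- a * s) * b s \<le> \<eta> * \<bar>exp (- a * s) * y s\<bar> + \<kappa> * d * exp a * indicator {- h..0} s" if a: "a > 0" for a s
  proof -
    have "exp (- a * s) * indicator {- h..0} s \<le> exp a * (indicator {- h..0} s :: real)"
    proof (cases "s \<in> {- h..0}")
      case True
      have "- a * s \<le> a * 1" using True h a mult_left_mono[of "- s" 1 a] by auto
      then show ?thesis using True by simp
    qed simp
    then have "\<kappa> * d * (exp (- a * s) * indicator {- h..0} s) \<le> \<kappa> * d * (exp a * indicator {- h..0} s)"
      using \<kappa> d by (intro mult_left_mono) auto
    then show ?thesis by (simp add: b_def abs_mult algebra_simps)
  qed
  have ind: "integrable lborel (indicator {- h..0} :: real \<Rightarrow> real)" "(LINT s|lborel. indicator {- h..0} s) = h"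
    using h by (auto intro!: integrable_real_indicator simp: emeasure_lborel_Icc_eq)
  \<comment> \<open>The ramp of the history contributes to the \<open>L\<^sup>2\<close> bound a multiple of \<open>d\<close>, by \<open>h \<le> 1\<close>; the
    multiple \<open>\<eta>\<close> of the solution is absorbed.\<close>
  define N where "N = (LINT t|lborel. (exp (- \<mu> * t) * y t)\<^sup>2)"
  have yi2: "integrable lborel (\<lambda>t. (exp (- \<mu> * t) * y t)\<^sup>2)" by (rule weighted_l2_estimate(1)[OF \<mu>(1) c0 line])
  define B where "B = (\<lambda>s. 2 * \<eta>\<^sup>2 * (exp (- \<mu> * s) * y s)\<^sup>2 + 2 * (\<kappa> * d * exp \<mu>)\<^sup>2 * indicator {- h..0} s)"
  have Bi: "integrable lborel B" unfolding B_def using yi2 ind by (intro Bochner_Integration.integrable_add integrable_mult_right) auto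
  have BI: "(LINT s|lborel. B s) \<le> 2 * \<eta>\<^sup>2 * N + 2 * (\<kappa> * d * exp \<mu>)\<^sup>2"
  proof -
    have "(LINT s|lborel. B s) = 2 * \<eta>\<^sup>2 * N + 2 * (\<kappa> * d * exp \<mu>)\<^sup>2 * h"
      unfolding B_def using yi2 ind by (simp add: N_def)
    also have "\<dots> \<le> 2 * \<eta>\<^sup>2 * N + 2 * (\<kappa> * d * exp \<mu>)\<^sup>2 * 1" using h by (intro add_left_mono mult_left_mono) auto
    finally show ?thesis by simp
  qed
  have sq: "(exp (- \<mu> * s) * b s)\<^sup>2 \<le> B s" for s
  proof -
    let ?u = "\<eta> * \<bar>exp (- \<mu> * s) * y s\<bar>" and ?v = "\<kappa> * d * exp \<mu> * indicator {- h..0} s"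
    have "(exp (- \<mu> * s) * b s)\<^sup>2 \<le> (?u + ?v)\<^sup>2" using bw[OF \<mu>(1)] b0 by (intro power_mono) auto
    also have "\<dots> \<le> 2 * ?u\<^sup>2 + 2 * ?v\<^sup>2" using zero_le_power2[of "?u - ?v"] by (simp add: power2_diff power2_sum)
    also have "?v\<^sup>2 = (\<kappa> * d * exp \<mu>)\<^sup>2 * indicator {- h..0} s" by (simp add: indicator_def)
    also have "2 * ?u\<^sup>2 = 2 * \<eta>\<^sup>2 * (exp (- \<mu> * s) * y s)\<^sup>2" by (simp only: power_mult_distrib power2_abs mult.assoc)
    finally show ?thesis by (simp add: B_def mult.assoc)
  qed
  have nq: "(LINT t|lborel. (exp (- \<mu> * t) * q t)\<^sup>2) \<le> 2 * (1 + c\<^sup>2) * (LINT s|lborel. B s)"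
  proof -
    have pw: "(exp (- \<mu> * t) * q t)\<^sup>2 \<le> 2 * B (t - \<tau>1) + 2 * c\<^sup>2 * B (t - (\<tau>1 + \<tau>2))" for t
    proof -
      let ?u = "exp (- \<mu> * (t - \<tau>1)) * b (t - \<tau>1)" and ?v = "exp (- \<mu> * (t - (\<tau>1 + \<tau>2))) * b (t - (\<tau>1 + \<tau>2))"
      have "(exp (- \<mu> * t) * q t)\<^sup>2 = \<bar>exp (- \<mu> * t) * q t\<bar>\<^sup>2" by simp
      also have "\<dots> \<le> (?u + c * ?v)\<^sup>2" by (intro power_mono wq \<mu>) simp
      also have "\<dots> \<le> 2 * ?u\<^sup>2 + 2 * (c * ?v)\<^sup>2" using zero_le_power2[of "?u - c * ?v"] by (simp add: power2_diff power2_sum)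
      also have "\<dots> = 2 * ?u\<^sup>2 + 2 * c\<^sup>2 * ?v\<^sup>2" by (simp add: power_mult_distrib)
      also have "\<dots> \<le> 2 * B (t - \<tau>1) + 2 * c\<^sup>2 * B (t - (\<tau>1 + \<tau>2))" by (intro add_mono mult_left_mono sq) auto
      finally show ?thesis .
    qed
    have i1: "integrable lborel (\<lambda>t. 2 * B (t - \<tau>1))" and i2: "integrable lborel (\<lambda>t. 2 * c\<^sup>2 * B (t - (\<tau>1 + \<tau>2)))"
      by (intro integrable_mult_right integrable_shift Bi)+
    have "(LINT t|lborel. (exp (- \<mu> * t) * q t)\<^sup>2) \<le> (LINT t|lborel. 2 * B (t - \<tau>1) + 2 * c\<^sup>2 * B (t - (\<tau>1 + \<tau>2)))"
    proof (rule integral_mono[OF _ Bochner_Integration.integrable_add[OF i1 i2] pw])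
      show "integrable lborel (\<lambda>t. (exp (- \<mu> * t) * q t)\<^sup>2)"
        by (rule Bochner_Integration.integrable_bound[OF Bochner_Integration.integrable_add[OF i1 i2]])
           (measurable, simp only: real_norm_def abs_power2, intro AE_I2 order_trans[OF pw abs_ge_self])
    qed
    also have "\<dots> = (LINT t|lborel. 2 * B (t - \<tau>1)) + (LINT t|lborel. 2 * c\<^sup>2 * B (t - (\<tau>1 + \<tau>2)))"
      by (rule Bochner_Integration.integral_add[OF i1 i2])
    also have "\<dots> = 2 * (LINT s|lborel. B s) + 2 * c\<^sup>2 * (LINT s|lborel. B s)"
      by (simp only: integral_mult_right_zero integral_shift)
    finally show ?thesis by (simp add: algebra_simps)
  qed
  have N: "N \<le> K3 * d\<^sup>2"
  proof -
    have "N \<le> (d\<^sup>2 / \<mu> + 2 * (\<mu> powr (- \<alpha>))\<^sup>2 * (LINT t|lborel. (exp (- \<mu> * t) * q t)\<^sup>2)) / c0\<^sup>2"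
      using weighted_l2_estimate(2)[OF \<mu>(1) c0 line] by (simp only: N_def x0)
    also have "\<dots> \<le> (d\<^sup>2 / \<mu> + 2 * (\<mu> powr (- \<alpha>))\<^sup>2 * (2 * (1 + c\<^sup>2) * (2 * \<eta>\<^sup>2 * N + 2 * (\<kappa> * d * exp \<mu>)\<^sup>2))) / c0\<^sup>2"
      using nq mult_left_mono[OF BI, of "2 * (1 + c\<^sup>2)"]
      by (intro divide_right_mono add_left_mono mult_left_mono) auto
    also have "\<dots> = K1 * d\<^sup>2 + (K2 * \<eta>\<^sup>2) * N + K2 * (\<kappa>\<^sup>2 * (exp \<mu>)\<^sup>2) * d\<^sup>2"
      using \<mu> c0 by (simp add: K1_def K2_def power_mult_distrib field_simps)
    also have "\<dots> \<le> K1 * d\<^sup>2 + (1 / 2) * N + K2 * (\<kappa>\<^sup>2 * (exp \<mu>)\<^sup>2) * d\<^sup>2"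
      using K2\<eta> by (intro add_mono mult_right_mono) (auto simp: N_def)
    finally have "N \<le> 2 * (K1 * d\<^sup>2 + K2 * (\<kappa>\<^sup>2 * (exp \<mu>)\<^sup>2) * d\<^sup>2)" by simp
    also have "\<dots> = K3 * d\<^sup>2" by (simp add: K3_def algebra_simps)
    finally show ?thesis .
  qed
  \<comment> \<open>Since \<open>l > \<mu>\<close>, the stronger weight turns the \<open>L\<^sup>2\<close> bound into an \<open>L\<^sup>1\<close> bound. The inequality between
    arithmetic and geometric mean is scaled with \<open>d\<close> so that both terms are of order \<open>d\<close>.\<close>
  have li: "integrable lborel (\<lambda>s. \<bar>exp (- l * s) * y s\<bar>)"
  proof (rule integrable_abs, rule weighted_integrable[OF y_meas _ y_le l])
    show "t < 0 \<Longrightarrow> y t = 0" for t by (simp add: causal_part_def)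
  qed
  have L1: "(LINT s|lborel. \<bar>exp (- l * s) * y s\<bar>) \<le> d * K4"
  proof -
    have lap: "has_bochner_integral lborel (\<lambda>t. exp (- (2 * (l - \<mu>)) * t) * frac_kernel 1 t) (1 / (2 * (l - \<mu>)))"
      using frac_kernel_laplace_real[of 1 "2 * (l - \<mu>)"] \<mu> by (simp add: powr_minus_divide)
    have i1: "integrable lborel (\<lambda>t. d / 2 * (exp (- (2 * (l - \<mu>)) * t) * frac_kernel 1 t))"
      using lap by (intro integrable_mult_right) (simp add: has_bochner_integral_iff)
    have i2: "integrable lborel (\<lambda>t. 1 / (2 * d) * (exp (- \<mu> * t) * y t)\<^sup>2)" by (intro integrable_mult_right yi2)
    have "(LINT s|lborel. \<bar>exp (- l * s) * y s\<bar>) \<le> (LINT s|lborel. d / 2 * (exp (- (2 * (l - \<mu>)) * s) * frac_kernel 1 s) + 1 / (2 * d) * (exp (- \<mu> * s) * y s)\<^sup>2)"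
    proof (rule integral_mono_AE[OF li Bochner_Integration.integrable_add[OF i1 i2]])
      have "AE s in lborel. s \<noteq> (0::real)" by (rule AE_lborel_singleton)
      then show "AE s in lborel. \<bar>exp (- l * s) * y s\<bar> \<le> d / 2 * (exp (- (2 * (l - \<mu>)) * s) * frac_kernel 1 s) + 1 / (2 * d) * (exp (- \<mu> * s) * y s)\<^sup>2"
      proof eventually_elim
        case (elim s)
        show ?case
        proof (cases "s < 0")
          case True then show ?thesis by (simp add: causal_part_def frac_kernel_1)
        next
          case False
          define u where "u = exp (- (l - \<mu>) * s)"
          define v where "v = \<bar>exp (- \<mu> * s) * y s\<bar>"
          have "exp (- l * s) = u * exp (- \<mu> * s)" by (simp add: u_def exp_add[symmetric] algebra_simps)
          then have "\<bar>exp (- l * s) * y s\<bar> = u * v" by (simp only: v_def abs_mult mult.assoc) (simp add: u_def)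
          moreover have "u\<^sup>2 = exp (- (2 * (l - \<mu>)) * s)" by (simp add: u_def power2_eq_square exp_add[symmetric] algebra_simps)
          moreover have "v\<^sup>2 = (exp (- \<mu> * s) * y s)\<^sup>2" by (simp add: v_def)
          moreover have "u * v \<le> d / 2 * u\<^sup>2 + 1 / (2 * d) * v\<^sup>2"
          proof -
            have "0 \<le> (d * u - v)\<^sup>2 / (2 * d)" using d by simp
            also have "\<dots> = d / 2 * u\<^sup>2 + 1 / (2 * d) * v\<^sup>2 - u * v" using d by (simp add: power2_eq_square field_simps)
            finally show ?thesis by simp
          qed
          moreover have "frac_kernel 1 s = 1" using False elim by (simp add: frac_kernel_1)
          ultimately show ?thesis by (simp only: mult_1_right)
        qed
      qed
    qed
    also have "\<dots> = d / 2 * (1 / (2 * (l - \<mu>))) + 1 / (2 * d) * N"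
      using Bochner_Integration.integral_add[OF i1 i2] lap by (simp only: integral_mult_right_zero has_bochner_integral_iff N_def)
    also have "\<dots> \<le> d / 2 * (1 / (2 * (l - \<mu>))) + 1 / (2 * d) * (K3 * d\<^sup>2)"
      using N d by (intro add_left_mono mult_left_mono) auto
    also have "\<dots> = d * K4"
    proof -
      have "d / 2 * w + 1 / (2 * d) * (K3 * d\<^sup>2) = d * ((w + K3) / 2)" for w
        using d by (simp add: power2_eq_square field_simps)
      then show ?thesis unfolding K4_def .
    qed
    finally show ?thesis .
  qed
  have lq: "cmod (laplace q (of_real l)) \<le> (1 + c) * (\<eta> * (d * K4) + \<kappa> * d * exp l * h)"
  proof -
    define D where "D = (\<lambda>s. \<eta> * \<bar>exp (- l * s) * y s\<bar> + \<kappa> * d * exp l * indicator {- h..0} s)"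
    have Di: "integrable lborel D" unfolding D_def using li ind by (intro Bochner_Integration.integrable_add integrable_mult_right) auto
    have DI: "(LINT s|lborel. D s) \<le> \<eta> * (d * K4) + \<kappa> * d * exp l * h"
    proof -
      have "(LINT s|lborel. D s) = \<eta> * (LINT s|lborel. \<bar>exp (- l * s) * y s\<bar>) + \<kappa> * d * exp l * h"
        unfolding D_def using li ind by (subst Bochner_Integration.integral_add) (auto simp del: abs_mult)
      then show ?thesis using mult_left_mono[OF L1, of \<eta>] \<eta> by simp
    qed
    have i1: "integrable lborel (\<lambda>t. D (t - \<tau>1))" and i2: "integrable lborel (\<lambda>t. c * D (t - (\<tau>1 + \<tau>2)))"
      by (intro integrable_mult_right integrable_shift Di)+
    have "cmod (laplace q (of_real l)) \<le> (LINT t|lborel. cmod (exp (- of_real l * of_real t) * of_real (q t)))"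
      unfolding laplace_def by (rule integral_norm_bound)
    also have "\<dots> = (LINT t|lborel. \<bar>exp (- l * t) * q t\<bar>)" by (simp add: norm_mult abs_mult)
    also have "\<dots> \<le> (LINT t|lborel. D (t - \<tau>1) + c * D (t - (\<tau>1 + \<tau>2)))"
    proof (rule integral_mono[OF _ Bochner_Integration.integrable_add[OF i1 i2]])
      show "integrable lborel (\<lambda>t. \<bar>exp (- l * t) * q t\<bar>)"
        by (rule integrable_abs, rule weighted_integrable[OF q_meas q_neg q_bounded l])
      fix t
      have "exp (- l * s) * b s \<le> D s" for s unfolding D_def by (rule bw[OF l])
      then have "exp (- l * (t - \<tau>1)) * b (t - \<tau>1) + c * (exp (- l * (t - (\<tau>1 + \<tau>2))) * b (t - (\<tau>1 + \<tau>2))) \<le> D (t - \<tau>1) + c * D (t - (\<tau>1 + \<tau>2))"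
        using c by (intro add_mono mult_left_mono) auto
      then show "\<bar>exp (- l * t) * q t\<bar> \<le> D (t - \<tau>1) + c * D (t - (\<tau>1 + \<tau>2))" using wq[OF l, of t] by linarith
    qed
    also have "\<dots> = (1 + c) * (LINT s|lborel. D s)"
      unfolding Bochner_Integration.integral_add[OF i1 i2] integral_mult_right_zero integral_shift by (simp add: algebra_simps)
    also have "\<dots> \<le> (1 + c) * (\<eta> * (d * K4) + \<kappa> * d * exp l * h)" using DI c by (intro mult_left_mono) auto
    finally show ?thesis .
  qed
  have zl: "complex_of_real l powr (- of_real \<alpha>) = of_real (l powr (- \<alpha>))"
    using l powr_of_real[of l "- \<alpha>"] by simp
  have "char_factor \<alpha> \<gamma> k \<tau>1 \<tau>2 (of_real l) = of_real (1 + l powr (- \<alpha>) * (\<gamma> - k * (exp (- l * \<tau>1) - exp (- \<gamma> * \<tau>2) * exp (- l * (\<tau>1 + \<tau>2)))))"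
    unfolding char_factor_def delay_symbol_def zl by (simp add: exp_of_real[symmetric])
  also have "\<gamma> - k * (exp (- l * \<tau>1) - exp (- \<gamma> * \<tau>2) * exp (- l * (\<tau>1 + \<tau>2))) = - (l powr \<alpha>)" using root by linarith
  also have "1 + l powr (- \<alpha>) * (- (l powr \<alpha>)) = 0" using l by (simp add: powr_add[symmetric])
  finally have m0: "char_factor \<alpha> \<gamma> k \<tau>1 \<tau>2 (of_real l) = 0" by simp
  have F: "laplace (frac_kernel 1) (of_real l) = of_real (1 / l)"
    using frac_kernel_laplace_complex[of 1 "of_real l"] l by (simp add: laplace_def has_bochner_integral_iff powr_minus divide_inverse)
  have "0 = of_real (d / l) + of_real (l powr (- \<alpha>)) * laplace q (of_real l)"
    using laplace_identity[of "of_real l"] l unfolding m0 F zl x0 by simp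
  then have "of_real (l powr (- \<alpha>)) * laplace q (of_real l) = - complex_of_real (d / l)" by (simp add: eq_neg_iff_add_eq_0 add.commute)
  then have "cmod (of_real (l powr (- \<alpha>)) * laplace q (of_real l)) = cmod (- complex_of_real (d / l))" by simp
  then have "l powr (- \<alpha>) * cmod (laplace q (of_real l)) = d / l" using d l by (simp add: norm_mult norm_divide)
  moreover have "l powr \<alpha> * l powr (- \<alpha>) = 1" using l by (simp add: powr_add[symmetric])
  ultimately have "cmod (laplace q (of_real l)) = l powr \<alpha> * (d / l)" by (metis mult.assoc mult_1)
  also have "l powr \<alpha> * (d / l) = d * A" using l by (simp add: A_def powr_diff)
  finally have "d * A \<le> (1 + c) * (\<eta> * (d * K4) + \<kappa> * d * exp l * h)" using lq by simp
  also have "\<dots> = d * ((\<eta> * (4 * (1 + c) * K4)) / 4 + (h * (4 * (1 + c) * \<kappa> * exp l)) / 4)" by (simp add: field_simps)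
  also have "\<dots> \<le> d * (A / 4 + A / 4)" using \<eta>(4) h(3) d by (intro mult_left_mono add_mono) auto
  finally have "d * A \<le> d * A / 2" by simp
  then show False using d A mult_pos_pos[of d A] by linarith
qed

text \<open>
  The characteristic function is negative at 0, where \<open>exp (- \<gamma> \<tau>2) \<ge> 1\<close>, and nonnegative at the point
  \<open>b\<close> at which \<open>b powr \<alpha>\<close> equals a bound \<open>R\<close> for the sum of the moduli of its negative terms.
\<close>
lemma positive_root_third_quadrant:
  fixes \<alpha> \<gamma> k \<tau>1 \<tau>2 :: real
  assumes \<alpha>: "0 < \<alpha>" and \<tau>: "\<tau>1 \<ge> 0" "\<tau>2 \<ge> 0" and \<gamma>: "\<gamma> < 0" and k: "k < 0"
  shows "\<exists>l>0. l powr \<alpha> + \<gamma> - k * (exp (- l * \<tau>1) - exp (- \<gamma> * \<tau>2) * exp (- l * (\<tau>1 + \<tau>2))) = 0"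
proof -
  define f where "f = (\<lambda>l. l powr \<alpha> + \<gamma> - k * (exp (- l * \<tau>1) - exp (- \<gamma> * \<tau>2) * exp (- l * (\<tau>1 + \<tau>2))))"
  define R where "R = - \<gamma> - k * exp (- \<gamma> * \<tau>2)"
  have R: "R > 0" using \<gamma> k mult_neg_pos[OF k, of "exp (- \<gamma> * \<tau>2)"] by (simp add: R_def)
  define b where "b = R powr (1 / \<alpha>)"
  have b: "b > 0" "b powr \<alpha> = R" using R \<alpha> by (auto simp: b_def powr_powr)
  have "f 0 < 0"
  proof -
    have "exp (- \<gamma> * \<tau>2) \<ge> 1" using \<gamma> \<tau> by (simp add: mult_nonpos_nonneg)
    then have "- k * (1 - exp (- \<gamma> * \<tau>2)) \<le> 0" using k by (intro mult_nonneg_nonpos) auto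
    then show ?thesis using \<gamma> \<alpha> by (simp add: f_def)
  qed
  moreover have "f b \<ge> 0"
  proof -
    have e: "exp (- b * (\<tau>1 + \<tau>2)) \<le> 1" using b \<tau> by simp
    have "- k * (exp (- \<gamma> * \<tau>2) * exp (- b * (\<tau>1 + \<tau>2))) \<le> - k * (exp (- \<gamma> * \<tau>2) * 1)"
      using k e by (intro mult_left_mono) auto
    moreover have "- k * exp (- b * \<tau>1) \<ge> 0" using k by (intro mult_nonneg_nonneg) auto
    ultimately show ?thesis by (simp add: f_def b R_def right_diff_distrib)
  qed
  moreover have "continuous_on {0..b} f" unfolding f_def
    using \<alpha> by (intro continuous_intros continuous_on_powr') auto
  ultimately obtain l where l: "0 \<le> l" "l \<le> b" "f l = 0" using IVT'[of f 0 0 b] b by auto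
  then have "l > 0" using \<open>f 0 < 0\<close> by (cases "l = 0") auto
  then show ?thesis using l(3) by (auto simp: f_def)
qed

section \<open>Delay-independent stability and instability\<close>

theorem theorem5p1:
  fixes \<gamma> k :: real and g :: "real \<Rightarrow> real"
  assumes "g C1_differentiable_on UNIV"
    and "\<not> linear g"
    and "g 0 = 0"
    and "(g has_real_derivative k) (at 0)"
  shows
    "(\<forall>\<tau>2\<ge>0. is_equilibrium (delay_rhs \<gamma> g \<tau>2) 0) \<and>
     ((\<gamma> > 2 * k \<and> 2 * k > 0) \<or> (\<gamma> > - 2 * k \<and> - 2 * k > 0) \<longrightarrow>
        (\<forall>\<tau>1\<ge>0. \<forall>\<tau>2\<ge>0. \<forall>\<alpha>. 0 < \<alpha> \<and> \<alpha> \<le> 1 \<longrightarrow>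
           asymptotically_stable_equilibrium \<alpha> (delay_rhs \<gamma> g \<tau>2) \<tau>1 \<tau>2 0)) \<and>
     (\<gamma> < 0 \<and> k < 0 \<longrightarrow>
        (\<forall>\<tau>1\<ge>0. \<forall>\<tau>2\<ge>0. \<forall>\<alpha>. 0 < \<alpha> \<and> \<alpha> \<le> 1 \<longrightarrow>
           unstable_equilibrium \<alpha> (delay_rhs \<gamma> g \<tau>2) \<tau>1 \<tau>2 0)) \<and>
     (k > 0 \<and> \<gamma> < 0 \<longrightarrow>
        (\<forall>\<tau>1\<ge>0. \<forall>\<tau>2\<ge>0.
           unstable_equilibrium 1 (delay_rhs \<gamma> g \<tau>2) \<tau>1 \<tau>2 0))"
proof (intro conjI impI allI)
  note g = assms(1,3,4)
  fix \<tau>1 \<tau>2 :: real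
  show "is_equilibrium (delay_rhs \<gamma> g \<tau>2) 0"
    using assms(3) by (simp add: is_equilibrium_def delay_rhs_def)
  assume \<tau>: "0 \<le> \<tau>1" "0 \<le> \<tau>2"
  show "asymptotically_stable_equilibrium \<alpha> (delay_rhs \<gamma> g \<tau>2) \<tau>1 \<tau>2 0"
    if "(\<gamma> > 2 * k \<and> 2 * k > 0) \<or> (\<gamma> > - 2 * k \<and> - 2 * k > 0)" "0 < \<alpha> \<and> \<alpha> \<le> 1" for \<alpha>
    by (rule delay_independent_stability[OF g]) (use that \<tau> in auto)
  show "unstable_equilibrium \<alpha> (delay_rhs \<gamma> g \<tau>2) \<tau>1 \<tau>2 0" if "\<gamma> < 0 \<and> k < 0" "0 < \<alpha> \<and> \<alpha> \<le> 1" for \<alpha>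
    using positive_root_third_quadrant[of \<alpha> \<tau>1 \<tau>2 \<gamma> k] that \<tau> positive_root_instability[OF g, of \<alpha> \<tau>1 \<tau>2 _ \<gamma>] by blast
  \<comment> \<open>At \<open>l = - \<gamma>\<close> the two delayed terms of the characteristic function cancel.\<close>
  show "unstable_equilibrium 1 (delay_rhs \<gamma> g \<tau>2) \<tau>1 \<tau>2 0" if "k > 0 \<and> \<gamma> < 0"
  proof (rule positive_root_instability[OF g, of 1 \<tau>1 \<tau>2 "- \<gamma>" \<gamma>])
    have "exp (- \<gamma> * \<tau>2) * exp (- (- \<gamma>) * (\<tau>1 + \<tau>2)) = exp (- (- \<gamma>) * \<tau>1)"
      by (simp add: exp_add[symmetric] algebra_simps)
    then show "(- \<gamma>) powr 1 + \<gamma> - k * (exp (- (- \<gamma>) * \<tau>1) - exp (- \<gamma> * \<tau>2) * exp (- (- \<gamma>) * (\<tau>1 + \<tau>2))) = 0"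
      using that by simp
  qed (use that \<tau> in auto)
qed

end
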